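(* Let $X$ and $Y$ be extended metric spaces. Suppose that there is a $*$-isomorphism $\mathcal R_1^*(X)\cong\mathcal R_2^*(Y)$, where $\mathcal R_1^*(X)$ is any one of $C^*_{\rm cp}(X)$, $C^*_{\rm ql}(X)$, $C^*_{\rm u}(X)$ and $\mathcal R_2^*(Y)$ is any one of $C^*_{\rm cp}(Y)$, $C^*_{\rm ql}(Y)$, $C^*_{\rm u}(Y)$. Then $X$ and $Y$ are coarsely equivalent.
   Context: An extended metric space is a set with a metric allowed to take the value $+\infty$. A subset $D\subseteq X$ is coarsely dense if there is $R<\infty$ such that every point of $X$ is within distance $R$ of $D$. A map $f\colon X\to Y$ is controlled if for every $r\ge 0$ there is $R\ge 0$ such that $d(x,x')\le r$ implies $d(f(x),f(x'))\le R$; two maps $f,f'\colon X\to Y$ are close if $\sup_{x}d(f(x),f'(x))<\infty$. $X$ and $Y$ are coarsely equivalent if there are controlled maps $f\colon X\to Y$, $g\colon Y\to X$ with $g\circ f$ and $f\circ g$ close to the identities. An $X$-module is a Hilbert space $\mathcal H_X$ with a unital Boolean algebra $\mathfrak A$ of subsets of $X$ (the measurable sets) and a map $A\mapsto 1_A$ from $\mathfrak A$ to projections in $\mathcal B(\mathcal H_X)$ with $1_{A\cap A'}=1_A1_{A'}$, $1_{A\sqcup A'}=1_A+1_{A'}$ for disjoint $A,A'$, $1_X=\mathrm{id}$, and such that for some $r\geq 0$ the subspaces $1_A(\mathcal H_X)$, with $A$ measurable of diameter $\le r$, span a dense subspace. It is discrete if there are $r\ge0$ and a partition $X=\bigsqcup_i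 A_i$ into measurable sets of diameter $\le r$ with $\sum_i 1_{A_i}=1$ strongly and such that $C\subseteq X$ is measurable whenever every $C\cap A_i$ is. It is ample if for some $r\ge 0$ the union of the measurable sets $A$ of diameter $\le r$ with $1_A$ of infinite rank is coarsely dense in $X$. Let $t\in\mathcal B(\mathcal H_X)$. It has propagation at most $r$ if $1_{A'}t1_A=0$ for all measurable $A,A'$ with $d(a',a)>r$ for all $a\in A,a'\in A'$. It is quasi-local if for every $\varepsilon>0$ there is $r\ge0$ such that $\|1_{A'}t1_A\|\le\varepsilon$ for all measurable $A,A'$ with $d(a',a)>r$ for all $a\in A$, $a'\in A'$. $C^*_{\rm cp}(\mathcal H_X)$ is the norm closure of the operators of finite propagation and $C^*_{\rm ql}(\mathcal H_X)$ the set of quasi-local operators. $C^*_{\rm cp}(X)$, $C^*_{\rm ql}(X)$ denote these algebras for a choice of ample discrete $X$-module, and the uniform Roe algebra is $C^*_{\rm u}(X)=C^*_{\rm cp}(\ell^2(X))$, where all subsets of $X$ are measurable and act by multiplication by indicator functions. *)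

theory Defs
  imports "HOL-Analysis.Analysis"
begin

section \<open>Coarse geometry of extended metric spaces\<close>

locale extended_metric_space =
  fixes X :: "'a set" and d :: "'a \<Rightarrow> 'a \<Rightarrow> ennreal"
  assumes dist_eq_0_iff: "\<lbrakk>x \<in> X; y \<in> X\<rbrakk> \<Longrightarrow> d x y = 0 \<longleftrightarrow> x = y"
    and dist_sym: "\<lbrakk>x \<in> X; y \<in> X\<rbrakk> \<Longrightarrow> d x y = d y x"
    and dist_triangle: "\<lbrakk>x \<in> X; y \<in> X; z \<in> X\<rbrakk> \<Longrightarrow> d x z \<le> d x y + d y z"

definition coarsely_dense :: "'a set \<Rightarrow> ('a \<Rightarrow> 'a \<Rightarrow> ennreal) \<Rightarrow> 'a set \<Rightarrow> bool" where
  "coarsely_dense X d D \<longleftrightarrow> D \<subseteq> X \<and> (\<exists>R::real. \<forall>x\<in>X. \<exists>y\<in>D. d x y \<le> ennreal R)"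

definition diam_le :: "('a \<Rightarrow> 'a \<Rightarrow> ennreal) \<Rightarrow> real \<Rightarrow> 'a set \<Rightarrow> bool" where
  "diam_le d r A \<longleftrightarrow> (\<forall>x\<in>A. \<forall>y\<in>A. d x y \<le> ennreal r)"

definition controlled ::
  "'a set \<Rightarrow> ('a \<Rightarrow> 'a \<Rightarrow> ennreal) \<Rightarrow> 'b set \<Rightarrow> ('b \<Rightarrow> 'b \<Rightarrow> ennreal) \<Rightarrow> ('a \<Rightarrow> 'b) \<Rightarrow> bool" where
  "controlled X dX Y dY f \<longleftrightarrow>
     (\<forall>r::real\<ge>0. \<exists>R::real\<ge>0. \<forall>x\<in>X. \<forall>x'\<in>X. dX x x' \<le> ennreal r \<longrightarrow> dY (f x) (f x') \<le> ennreal R)"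

definition close_maps ::
  "'a set \<Rightarrow> ('b \<Rightarrow> 'b \<Rightarrow> ennreal) \<Rightarrow> ('a \<Rightarrow> 'b) \<Rightarrow> ('a \<Rightarrow> 'b) \<Rightarrow> bool" where
  "close_maps X dY f f' \<longleftrightarrow> (SUP x\<in>X. dY (f x) (f' x)) < \<infinity>"

definition coarsely_equivalent ::
  "'a set \<Rightarrow> ('a \<Rightarrow> 'a \<Rightarrow> ennreal) \<Rightarrow> 'b set \<Rightarrow> ('b \<Rightarrow> 'b \<Rightarrow> ennreal) \<Rightarrow> bool" where
  "coarsely_equivalent X dX Y dY \<longleftrightarrow>
     (\<exists>f\<in>X \<rightarrow> Y. \<exists>g\<in>Y \<rightarrow> X. controlled X dX Y dY f \<and> controlled Y dY X dX g \<and>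
        close_maps X dX (g \<circ> f) id \<and> close_maps Y dY (f \<circ> g) id)"


section \<open>Complex Hilbert spaces\<close>

text \<open>The inner product is conjugate-linear in the first and linear in the second argument;
  its real part is the real inner product, which induces the norm.\<close>

class complex_hilbert = real_inner + complete_space +
  fixes scaleC :: "complex \<Rightarrow> 'a \<Rightarrow> 'a" (infixr "*\<^sub>C" 75)
    and cinner :: "'a \<Rightarrow> 'a \<Rightarrow> complex"
  assumes scaleC_add_right: "c *\<^sub>C (x + y) = c *\<^sub>C x + c *\<^sub>C y"
    and scaleC_add_left: "(b + c) *\<^sub>C x = b *\<^sub>C x + c *\<^sub>C x"
    and scaleC_scaleC: "b *\<^sub>C c *\<^sub>C x = (b * c) *\<^sub>C x"
    and scaleC_of_real: "complex_of_real r *\<^sub>C x = r *\<^sub>R x"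
    and cinner_commute: "cinner x y = cnj (cinner y x)"
    and cinner_add_right: "cinner x (y + z) = cinner x y + cinner x z"
    and cinner_scaleC_right: "cinner x (c *\<^sub>C y) = c * cinner x y"
    and Re_cinner: "Re (cinner x y) = inner x y"

lemma vector_space_scaleC: "vector_space (scaleC :: complex \<Rightarrow> 'h \<Rightarrow> 'h::complex_hilbert)"
  using scaleC_of_real[of 1]
  by unfold_locales (auto simp: scaleC_add_right scaleC_add_left scaleC_scaleC)

abbreviation cspan :: "'h::complex_hilbert set \<Rightarrow> 'h set" where
  "cspan \<equiv> module.span scaleC"

abbreviation csubspace :: "'h::complex_hilbert set \<Rightarrow> bool" where
  "csubspace \<equiv> module.subspace scaleC"

lemma cinner_self: "cinner x x = complex_of_real ((norm x)\<^sup>2)"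
proof -
  have "Im (cinner x x) = 0"
    using arg_cong[OF cinner_commute[of x x], of Im] by simp
  moreover have "Re (cinner x x) = (norm x)\<^sup>2"
    by (simp add: Re_cinner power2_norm_eq_inner)
  ultimately show ?thesis by (simp add: complex_eq_iff)
qed

lemma norm_scaleC: "norm (c *\<^sub>C x) = cmod c * norm (x::'h::complex_hilbert)"
proof -
  have "cinner (c *\<^sub>C x) (c *\<^sub>C x) = c * cnj (c * cinner x x)"
    by (metis cinner_commute cinner_scaleC_right)
  also have "\<dots> = complex_of_real ((cmod c * norm x)\<^sup>2)"
    by (simp add: cinner_self power_mult_distrib flip: complex_norm_square)
  finally have "(norm (c *\<^sub>C x))\<^sup>2 = (cmod c * norm x)\<^sup>2"
    by (simp only: cinner_self of_real_eq_iff)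
  then show ?thesis by (simp add: power2_eq_iff_nonneg)
qed

lemma bounded_linear_scaleC: "bounded_linear ((*\<^sub>C) c :: 'h \<Rightarrow> 'h::complex_hilbert)"
proof (rule bounded_linear_intro)
  show "c *\<^sub>C (x + y) = c *\<^sub>C x + c *\<^sub>C y" for x y :: 'h by (rule scaleC_add_right)
  show "c *\<^sub>C (r *\<^sub>R x) = r *\<^sub>R (c *\<^sub>C x)" for r and x :: 'h
    by (simp add: scaleC_scaleC mult.commute flip: scaleC_of_real)
  show "norm (c *\<^sub>C x) \<le> norm x * cmod c" for x :: 'h by (simp add: norm_scaleC)
qed

lift_definition scaleC_op :: "complex \<Rightarrow> ('h \<Rightarrow>\<^sub>L 'h::complex_hilbert) \<Rightarrow> ('h \<Rightarrow>\<^sub>L 'h)"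
  is "\<lambda>c t v. c *\<^sub>C t v"
  by (rule bounded_linear_compose[OF bounded_linear_scaleC])

definition clinear_op :: "('h \<Rightarrow>\<^sub>L 'h::complex_hilbert) \<Rightarrow> bool" where
  "clinear_op t \<longleftrightarrow> (\<forall>c v. t (c *\<^sub>C v) = c *\<^sub>C t v)"

text \<open>Well defined for complex-linear \<open>t\<close>, by the Riesz representation theorem.\<close>

definition adj :: "('h \<Rightarrow>\<^sub>L 'h::complex_hilbert) \<Rightarrow> ('h \<Rightarrow>\<^sub>L 'h)" where
  "adj t = (THE s. \<forall>v w. cinner (blinfun_apply s v) w = cinner v (blinfun_apply t w))"

text \<open>A Hilbert space is a closed subspace \<open>H\<close> of a type of class \<open>complex_hilbert\<close>
  (possibly the whole type). Its bounded operators are represented on the whole type, extended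
  by zero on the orthogonal complement of \<open>H\<close>; this preserves the algebraic operations,
  the adjoint and the norm. It allows \<open>\<ell>\<^sup>2(X)\<close> for a set \<open>X\<close> to be a module.\<close>

definition bounded_operators :: "'h::complex_hilbert set \<Rightarrow> ('h \<Rightarrow>\<^sub>L 'h) set" where
  "bounded_operators H =
     {t. clinear_op t \<and> (\<forall>v. t v \<in> H) \<and> (\<forall>v. (\<forall>w\<in>H. cinner w v = 0) \<longrightarrow> t v = 0)}"

definition is_projection :: "('h \<Rightarrow>\<^sub>L 'h::complex_hilbert) \<Rightarrow> bool" where
  "is_projection p \<longleftrightarrow> p o\<^sub>L p = p \<and> adj p = p"

definition infinite_rank :: "('h \<Rightarrow>\<^sub>L 'h::complex_hilbert) \<Rightarrow> bool" where
  "infinite_rank t \<longleftrightarrow> \<not> (\<exists>B. finite B \<and> range (blinfun_apply t) \<subseteq> cspan B)"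

definition star_isomorphism ::
  "('h \<Rightarrow>\<^sub>L 'h::complex_hilbert) set \<Rightarrow> ('k \<Rightarrow>\<^sub>L 'k::complex_hilbert) set \<Rightarrow>
     (('h \<Rightarrow>\<^sub>L 'h) \<Rightarrow> ('k \<Rightarrow>\<^sub>L 'k)) \<Rightarrow> bool" where
  "star_isomorphism R S \<phi> \<longleftrightarrow> bij_betw \<phi> R S \<and>
     (\<forall>s\<in>R. \<forall>t\<in>R. \<phi> (s + t) = \<phi> s + \<phi> t) \<and>
     (\<forall>c. \<forall>t\<in>R. \<phi> (scaleC_op c t) = scaleC_op c (\<phi> t)) \<and>
     (\<forall>s\<in>R. \<forall>t\<in>R. \<phi> (s o\<^sub>L t) = \<phi> s o\<^sub>L \<phi> t) \<and>
     (\<forall>t\<in>R. \<phi> (adj t) = adj (\<phi> t))"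

definition star_isomorphic ::
  "('h \<Rightarrow>\<^sub>L 'h::complex_hilbert) set \<Rightarrow> ('k \<Rightarrow>\<^sub>L 'k::complex_hilbert) set \<Rightarrow> bool"
  (infix "\<cong>\<^sub>*" 50) where
  "R \<cong>\<^sub>* S \<longleftrightarrow> (\<exists>\<phi>. star_isomorphism R S \<phi>)"


section \<open>Modules over extended metric spaces and their Roe algebras\<close>

record (overloaded) ('a, 'h) coarse_module =
  msets :: "'a set set"
  hspace :: "'h set"
  ind :: "'a set \<Rightarrow> 'h \<Rightarrow>\<^sub>L 'h"

text \<open>\<open>ind M A\<close> is the projection \<open>1\<^sub>A\<close>; its values at non-measurable sets are irrelevant.\<close>

definition X_module ::
  "'a set \<Rightarrow> ('a \<Rightarrow> 'a \<Rightarrow> ennreal) \<Rightarrow> ('a, 'h::complex_hilbert) coarse_module \<Rightarrow> bool" where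
  "X_module X d M \<longleftrightarrow>
     csubspace (hspace M) \<and> closed (hspace M) \<and>
     algebra X (msets M) \<and>
     (\<forall>A\<in>msets M. ind M A \<in> bounded_operators (hspace M) \<and> is_projection (ind M A)) \<and>
     (\<forall>A\<in>msets M. \<forall>A'\<in>msets M. ind M (A \<inter> A') = ind M A o\<^sub>L ind M A') \<and>
     (\<forall>A\<in>msets M. \<forall>A'\<in>msets M. A \<inter> A' = {} \<longrightarrow> ind M (A \<union> A') = ind M A + ind M A') \<and>
     (\<forall>v\<in>hspace M. ind M X v = v) \<and>
     (\<exists>r::real\<ge>0. closure (cspan (\<Union>A\<in>{A\<in>msets M. diam_le d r A}. ind M A ` hspace M)) = hspace M)"

definition discrete_module ::
  "'a set \<Rightarrow> ('a \<Rightarrow> 'a \<Rightarrow> ennreal) \<Rightarrow> ('a, 'h::complex_hilbert) coarse_module \<Rightarrow> bool" where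
  "discrete_module X d M \<longleftrightarrow> X_module X d M \<and>
     (\<exists>r::real\<ge>0. \<exists>P. partition_on X P \<and> (\<forall>A\<in>P. A \<in> msets M \<and> diam_le d r A) \<and>
        (\<forall>v\<in>hspace M. ((\<lambda>A. ind M A v) has_sum v) P) \<and>
        (\<forall>C\<subseteq>X. (\<forall>A\<in>P. C \<inter> A \<in> msets M) \<longrightarrow> C \<in> msets M))"

definition ample_module ::
  "'a set \<Rightarrow> ('a \<Rightarrow> 'a \<Rightarrow> ennreal) \<Rightarrow> ('a, 'h::complex_hilbert) coarse_module \<Rightarrow> bool" where
  "ample_module X d M \<longleftrightarrow> X_module X d M \<and>
     (\<exists>r::real\<ge>0. coarsely_dense X d (\<Union>{A\<in>msets M. diam_le d r A \<and> infinite_rank (ind M A)}))"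

definition separated :: "('a \<Rightarrow> 'a \<Rightarrow> ennreal) \<Rightarrow> real \<Rightarrow> 'a set \<Rightarrow> 'a set \<Rightarrow> bool" where
  "separated d r A' A \<longleftrightarrow> (\<forall>a\<in>A. \<forall>a'\<in>A'. d a' a > ennreal r)"

definition propagation_le ::
  "('a \<Rightarrow> 'a \<Rightarrow> ennreal) \<Rightarrow> ('a, 'h::complex_hilbert) coarse_module \<Rightarrow> real \<Rightarrow> ('h \<Rightarrow>\<^sub>L 'h) \<Rightarrow> bool" where
  "propagation_le d M r t \<longleftrightarrow>
     (\<forall>A\<in>msets M. \<forall>A'\<in>msets M. separated d r A' A \<longrightarrow> ind M A' o\<^sub>L t o\<^sub>L ind M A = 0)"

definition quasi_local ::
  "('a \<Rightarrow> 'a \<Rightarrow> ennreal) \<Rightarrow> ('a, 'h::complex_hilbert) coarse_module \<Rightarrow> ('h \<Rightarrow>\<^sub>L 'h) \<Rightarrow> bool" where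
  "quasi_local d M t \<longleftrightarrow>
     (\<forall>\<epsilon>>0. \<exists>r\<ge>0. \<forall>A\<in>msets M. \<forall>A'\<in>msets M.
        separated d r A' A \<longrightarrow> norm (ind M A' o\<^sub>L t o\<^sub>L ind M A) \<le> \<epsilon>)"

definition Roe_cp ::
  "('a \<Rightarrow> 'a \<Rightarrow> ennreal) \<Rightarrow> ('a, 'h::complex_hilbert) coarse_module \<Rightarrow> ('h \<Rightarrow>\<^sub>L 'h) set" where
  "Roe_cp d M = closure {t \<in> bounded_operators (hspace M). \<exists>r\<ge>0. propagation_le d M r t}"

definition Roe_ql ::
  "('a \<Rightarrow> 'a \<Rightarrow> ennreal) \<Rightarrow> ('a, 'h::complex_hilbert) coarse_module \<Rightarrow> ('h \<Rightarrow>\<^sub>L 'h) set" where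
  "Roe_ql d M = {t \<in> bounded_operators (hspace M). quasi_local d M t}"


section \<open>Square-summable functions and the uniform Roe algebra\<close>

typedef 'a ell2 = "{f :: 'a \<Rightarrow> complex. (\<lambda>x. (cmod (f x))\<^sup>2) summable_on UNIV}"
  morphisms ell2_apply Abs_ell2
  by (rule exI[of _ "\<lambda>_. 0"]) simp

setup_lifting type_definition_ell2

lemma ell2_apply_summable: "(\<lambda>x. (cmod (ell2_apply f x))\<^sup>2) summable_on UNIV"
  using ell2_apply[of f] by simp

lemma ell2_ext: "(\<And>x. ell2_apply f x = ell2_apply g x) \<Longrightarrow> f = g"
  by (simp add: ext flip: ell2_apply_inject)

lemma summable_square_add:
  assumes "(\<lambda>x. (cmod (f x))\<^sup>2) summable_on A" "(\<lambda>x. (cmod (g x))\<^sup>2) summable_on A"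
  shows "(\<lambda>x. (cmod (f x + g x))\<^sup>2) summable_on A"
proof (rule summable_on_comparison_test)
  show "(\<lambda>x. 2 * (cmod (f x))\<^sup>2 + 2 * (cmod (g x))\<^sup>2) summable_on A"
    using assms by (intro summable_on_add summable_on_cmult_right)
  show "(cmod (f x + g x))\<^sup>2 \<le> 2 * (cmod (f x))\<^sup>2 + 2 * (cmod (g x))\<^sup>2" for x
  proof -
    have "(cmod (f x + g x))\<^sup>2 \<le> (cmod (f x) + cmod (g x))\<^sup>2"
      by (simp add: norm_triangle_ineq power_mono)
    also have "\<dots> \<le> 2 * (cmod (f x))\<^sup>2 + 2 * (cmod (g x))\<^sup>2"
      using sum_squares_bound[of "cmod (f x)" "cmod (g x)"] by (simp add: power2_sum)
    finally show ?thesis .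
  qed
qed auto

lemma summable_cnj_mult:
  assumes "(\<lambda>x. (cmod (f x))\<^sup>2) summable_on A" "(\<lambda>x. (cmod (g x))\<^sup>2) summable_on A"
  shows "(\<lambda>x. cnj (f x) * g x) summable_on A"
proof (rule abs_summable_summable, rule summable_on_comparison_test)
  show "(\<lambda>x. (cmod (f x))\<^sup>2 + (cmod (g x))\<^sup>2) summable_on A"
    using assms by (rule summable_on_add)
  show "cmod (cnj (f x) * g x) \<le> (cmod (f x))\<^sup>2 + (cmod (g x))\<^sup>2" for x
    using sum_squares_bound[of "cmod (f x)" "cmod (g x)"]
      mult_nonneg_nonneg[of "cmod (f x)" "cmod (g x)"] norm_ge_zero[of "f x"] norm_ge_zero[of "g x"]
    unfolding norm_mult complex_mod_cnj by linarith
qed auto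

instantiation ell2 :: (type) ab_group_add
begin

lift_definition zero_ell2 :: "'a ell2" is "\<lambda>_. 0" by simp
lift_definition plus_ell2 :: "'a ell2 \<Rightarrow> 'a ell2 \<Rightarrow> 'a ell2" is "\<lambda>f g x. f x + g x"
  by (rule summable_square_add)
lift_definition uminus_ell2 :: "'a ell2 \<Rightarrow> 'a ell2" is "\<lambda>f x. - f x" by simp
lift_definition minus_ell2 :: "'a ell2 \<Rightarrow> 'a ell2 \<Rightarrow> 'a ell2" is "\<lambda>f g x. f x - g x"
  using summable_square_add[of _ UNIV "\<lambda>x. - _ x"] by (simp add: fun_Compl_def)

instance
  by standard (transfer; simp add: fun_eq_iff)+

end

lemma ell2_apply_simps [simp]:
  "ell2_apply 0 x = 0"
  "ell2_apply (f + g) x = ell2_apply f x + ell2_apply g x"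
  "ell2_apply (f - g) x = ell2_apply f x - ell2_apply g x"
  "ell2_apply (- f) x = - ell2_apply f x"
  by (transfer; simp)+

lift_definition ell2_scaleC :: "complex \<Rightarrow> 'a ell2 \<Rightarrow> 'a ell2" is "\<lambda>c f x. c * f x"
  by (simp add: norm_mult power_mult_distrib summable_on_cmult_right)

definition ell2_cinner :: "'a ell2 \<Rightarrow> 'a ell2 \<Rightarrow> complex" where
  "ell2_cinner f g = (\<Sum>\<^sub>\<infinity>x. cnj (ell2_apply f x) * ell2_apply g x)"

lemma ell2_scaleC_apply [simp]: "ell2_apply (ell2_scaleC c f) x = c * ell2_apply f x"
  by transfer simp

lemma ell2_summable [simp]: "(\<lambda>x. cnj (ell2_apply f x) * ell2_apply g x) summable_on UNIV"
  by (intro summable_cnj_mult ell2_apply_summable)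

lemma ell2_cinner_commute: "ell2_cinner f g = cnj (ell2_cinner g f)"
  unfolding ell2_cinner_def infsum_cnj[symmetric] by (simp add: mult.commute)

lemma ell2_cinner_add_right: "ell2_cinner f (g + h) = ell2_cinner f g + ell2_cinner f h"
  unfolding ell2_cinner_def by (simp add: distrib_left infsum_add)

lemma ell2_cinner_scaleC_right: "ell2_cinner f (ell2_scaleC c g) = c * ell2_cinner f g"
  unfolding ell2_cinner_def by (simp add: mult.left_commute infsum_cmult_right')

lemma Re_ell2_cinner_self: "Re (ell2_cinner f f) = (\<Sum>\<^sub>\<infinity>x. (cmod (ell2_apply f x))\<^sup>2)"
proof -
  have "Re (cnj z * z) = (cmod z)\<^sup>2" for z
    by (simp add: cmod_power2 flip: power2_eq_square)
  then show ?thesis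
    unfolding ell2_cinner_def infsum_Re[OF ell2_summable, symmetric] by presburger
qed

instantiation ell2 :: (type) real_inner
begin

definition scaleR_ell2 :: "real \<Rightarrow> 'a ell2 \<Rightarrow> 'a ell2" where
  "scaleR_ell2 r = ell2_scaleC (complex_of_real r)"
definition inner_ell2 :: "'a ell2 \<Rightarrow> 'a ell2 \<Rightarrow> real" where
  "inner_ell2 f g = Re (ell2_cinner f g)"
definition norm_ell2 :: "'a ell2 \<Rightarrow> real" where
  "norm_ell2 f = sqrt (inner f f)"
definition dist_ell2 :: "'a ell2 \<Rightarrow> 'a ell2 \<Rightarrow> real" where
  "dist_ell2 f g = norm (f - g)"
definition sgn_ell2 :: "'a ell2 \<Rightarrow> 'a ell2" where
  "sgn_ell2 f = inverse (norm f) *\<^sub>R f"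
definition uniformity_ell2 :: "('a ell2 \<times> 'a ell2) filter" where
  "uniformity_ell2 = (INF e\<in>{0<..}. principal {(x, y). dist x y < e})"
definition open_ell2 :: "'a ell2 set \<Rightarrow> bool" where
  "open_ell2 U \<longleftrightarrow> (\<forall>x\<in>U. \<forall>\<^sub>F (x', y) in uniformity. x' = x \<longrightarrow> y \<in> U)"

instance
proof
  fix f g h :: "'a ell2" and r s :: real and U :: "'a ell2 set"
  show "r *\<^sub>R (f + g) = r *\<^sub>R f + r *\<^sub>R g" "(r + s) *\<^sub>R f = r *\<^sub>R f + s *\<^sub>R f"
    "r *\<^sub>R s *\<^sub>R f = (r * s) *\<^sub>R f" "1 *\<^sub>R f = f"
    by (auto intro!: ell2_ext simp: scaleR_ell2_def algebra_simps)
  show "sgn f = inverse (norm f) *\<^sub>R f" by (rule sgn_ell2_def)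
  show "dist f g = norm (f - g)" by (rule dist_ell2_def)
  show "(uniformity :: ('a ell2 \<times> 'a ell2) filter) = (INF e\<in>{0<..}. principal {(x, y). dist x y < e})"
    by (rule uniformity_ell2_def)
  show "open U \<longleftrightarrow> (\<forall>x\<in>U. \<forall>\<^sub>F (x', y) in uniformity. x' = x \<longrightarrow> y \<in> U)"
    by (rule open_ell2_def)
  show comm: "inner f' g' = inner g' f'" for f' g' :: "'a ell2"
    unfolding inner_ell2_def by (subst ell2_cinner_commute) simp
  have add: "inner h (f + g) = inner h f + inner h g"
    by (simp add: inner_ell2_def ell2_cinner_add_right)
  show "inner (f + g) h = inner f h + inner g h"
    using add by (simp add: comm[of _ h])
  have scl: "inner g (r *\<^sub>R f) = r * inner g f"
    by (simp add: inner_ell2_def scaleR_ell2_def ell2_cinner_scaleC_right)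
  show "inner (r *\<^sub>R f) g = r * inner f g"
    using scl by (simp add: comm[of _ g])
  show "0 \<le> inner f f"
    by (simp add: inner_ell2_def Re_ell2_cinner_self infsum_nonneg)
  show "norm f = sqrt (inner f f)" by (rule norm_ell2_def)
  show "inner f f = 0 \<longleftrightarrow> f = 0"
  proof
    assume "inner f f = 0"
    then have "(\<Sum>\<^sub>\<infinity>x. (cmod (ell2_apply f x))\<^sup>2) = 0"
      by (simp add: inner_ell2_def Re_ell2_cinner_self)
    then have "(cmod (ell2_apply f x))\<^sup>2 = 0" for x
      by (intro nonneg_infsum_le_0D[OF _ ell2_apply_summable, of f]) auto
    then show "f = 0" by (auto intro!: ell2_ext)
  qed (simp add: inner_ell2_def Re_ell2_cinner_self)
qed

end

lemma norm_ell2_square: "(norm f)\<^sup>2 = (\<Sum>\<^sub>\<infinity>x. (cmod (ell2_apply f x))\<^sup>2)"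
  by (simp add: power2_norm_eq_inner inner_ell2_def Re_ell2_cinner_self)

lemma sum_le_norm_ell2:
  assumes "finite F" shows "(\<Sum>x\<in>F. (cmod (ell2_apply f x))\<^sup>2) \<le> (norm f)\<^sup>2"
  unfolding norm_ell2_square
  by (rule finite_sum_le_infsum[OF ell2_apply_summable assms]) auto

lemma cmod_le_norm_ell2: "cmod (ell2_apply f x) \<le> norm f"
  using sum_le_norm_ell2[of "{x}" f] by (auto intro: power2_le_imp_le)

lemma Cauchy_ell2_convergent:
  fixes u :: "nat \<Rightarrow> 'a ell2"
  assumes "Cauchy u" shows "convergent u"
proof -
  have "Cauchy (\<lambda>n. ell2_apply (u n) x)" for x
    unfolding Cauchy_altdef2 dist_norm
  proof (intro allI impI)
    fix e :: real assume "e > 0"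
    then obtain N where "\<forall>n\<ge>N. norm (u n - u N) < e"
      using assms unfolding Cauchy_altdef2 dist_norm by blast
    then show "\<exists>N. \<forall>n\<ge>N. cmod (ell2_apply (u n) x - ell2_apply (u N) x) < e"
      by (metis cmod_le_norm_ell2 ell2_apply_simps(3) le_less_trans)
  qed
  then have "\<forall>x. \<exists>l. (\<lambda>n. ell2_apply (u n) x) \<longlonglongrightarrow> l"
    using Cauchy_convergent convergent_def by blast
  then obtain g where g: "\<And>x. (\<lambda>n. ell2_apply (u n) x) \<longlonglongrightarrow> g x" by metis
  have bound: "(\<Sum>x\<in>F. (cmod (ell2_apply (u n) x - g x))\<^sup>2) \<le> e\<^sup>2"
    if F: "finite F" and N: "\<And>m n. m \<ge> N \<Longrightarrow> n \<ge> N \<Longrightarrow> norm (u m - u n) < e" and n: "n \<ge> N" for F n N e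
  proof (rule LIMSEQ_le_const2)
    show "(\<lambda>m. \<Sum>x\<in>F. (cmod (ell2_apply (u n) x - ell2_apply (u m) x))\<^sup>2)
        \<longlonglongrightarrow> (\<Sum>x\<in>F. (cmod (ell2_apply (u n) x - g x))\<^sup>2)"
      by (intro tendsto_intros g)
    have "(\<Sum>x\<in>F. (cmod (ell2_apply (u n) x - ell2_apply (u m) x))\<^sup>2) \<le> e\<^sup>2" if "m \<ge> N" for m
    proof -
      have "(norm (u n - u m))\<^sup>2 \<le> e\<^sup>2"
        using N[OF n that] by (intro power_mono) auto
      then show ?thesis
        using sum_le_norm_ell2[OF F, of "u n - u m"] by simp
    qed
    then show "\<exists>N. \<forall>m\<ge>N. (\<Sum>x\<in>F. (cmod (ell2_apply (u n) x - ell2_apply (u m) x))\<^sup>2) \<le> e\<^sup>2"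
      by blast
  qed
  have summ: "(\<lambda>x. (cmod (ell2_apply (u n) x - g x))\<^sup>2) summable_on UNIV"
    if N: "\<And>m n. m \<ge> N \<Longrightarrow> n \<ge> N \<Longrightarrow> norm (u m - u n) < e" and n: "n \<ge> N" for n N e
    by (rule nonneg_bdd_above_summable_on) (auto intro!: bdd_aboveI2[of _ _ "e\<^sup>2"] bound[OF _ N n])
  obtain N1 where N1: "\<And>m n. m \<ge> N1 \<Longrightarrow> n \<ge> N1 \<Longrightarrow> norm (u m - u n) < 1"
    using assms unfolding Cauchy_def dist_norm by (metis zero_less_one)
  have "(\<lambda>x. (cmod (ell2_apply (u N1) x + - (ell2_apply (u N1) x - g x)))\<^sup>2) summable_on UNIV"
    by (intro summable_square_add ell2_apply_summable)
       (use summ[OF N1] in \<open>simp only: norm_minus_cancel\<close>)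
  then have g2: "ell2_apply (Abs_ell2 g) = g"
    by (intro Abs_ell2_inverse) simp
  have "u \<longlonglongrightarrow> Abs_ell2 g"
  proof (rule LIMSEQ_I)
    fix e :: real assume e: "e > 0"
    then obtain N where N: "\<And>m n. m \<ge> N \<Longrightarrow> n \<ge> N \<Longrightarrow> norm (u m - u n) < e / 2"
      using assms unfolding Cauchy_def dist_norm by (metis half_gt_zero)
    have "norm (u n - Abs_ell2 g) < e" if n: "n \<ge> N" for n
    proof -
      have "(norm (u n - Abs_ell2 g))\<^sup>2 \<le> (e / 2)\<^sup>2"
        unfolding norm_ell2_square
        by (rule infsum_le_finite_sums[OF ell2_apply_summable]) (simp add: g2 bound[OF _ N n])
      then have "norm (u n - Abs_ell2 g) \<le> e / 2"
        using e by (auto intro: power2_le_imp_le)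
      then show ?thesis using e by simp
    qed
    then show "\<exists>N. \<forall>n\<ge>N. norm (u n - Abs_ell2 g) < e" by blast
  qed
  then show ?thesis by (rule convergentI)
qed

instantiation ell2 :: (type) complex_hilbert
begin

definition "scaleC = (ell2_scaleC :: complex \<Rightarrow> 'a ell2 \<Rightarrow> 'a ell2)"
definition "cinner = (ell2_cinner :: 'a ell2 \<Rightarrow> 'a ell2 \<Rightarrow> complex)"

instance
proof
  fix f g h :: "'a ell2" and b c :: complex and r :: real
  show "Cauchy u \<Longrightarrow> convergent u" for u :: "nat \<Rightarrow> 'a ell2"
    by (rule Cauchy_ell2_convergent)
  show "c *\<^sub>C (f + g) = c *\<^sub>C f + c *\<^sub>C g" "(b + c) *\<^sub>C f = b *\<^sub>C f + c *\<^sub>C f"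
    "b *\<^sub>C c *\<^sub>C f = (b * c) *\<^sub>C f"
    by (auto intro!: ell2_ext simp: scaleC_ell2_def algebra_simps)
  show "complex_of_real r *\<^sub>C f = r *\<^sub>R f"
    by (simp add: scaleR_ell2_def scaleC_ell2_def)
qed (simp_all add: cinner_ell2_def scaleC_ell2_def inner_ell2_def ell2_cinner_add_right
    ell2_cinner_scaleC_right flip: ell2_cinner_commute)

end

lift_definition ell2_restrict :: "'a set \<Rightarrow> 'a ell2 \<Rightarrow> 'a ell2"
  is "\<lambda>A f x. if x \<in> A then f x else 0"
proof (rule summable_on_comparison_test)
  fix f :: "'a \<Rightarrow> complex" and A x
  assume "(\<lambda>x. (cmod (f x))\<^sup>2) summable_on UNIV"
  then show "(\<lambda>x. (cmod (f x))\<^sup>2) summable_on UNIV" .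
qed auto

lemma ell2_restrict_apply [simp]:
  "ell2_apply (ell2_restrict A f) x = (if x \<in> A then ell2_apply f x else 0)"
  by transfer simp

lift_definition mult_ind :: "'a set \<Rightarrow> 'a ell2 \<Rightarrow>\<^sub>L 'a ell2" is ell2_restrict
proof (rule bounded_linear_intro)
  fix A :: "'a set" and f g :: "'a ell2" and r :: real
  show "ell2_restrict A (f + g) = ell2_restrict A f + ell2_restrict A g"
    "ell2_restrict A (r *\<^sub>R f) = r *\<^sub>R ell2_restrict A f"
    by (auto intro!: ell2_ext simp: scaleR_ell2_def)
  have "(norm (ell2_restrict A f))\<^sup>2 \<le> (norm f)\<^sup>2"
    unfolding norm_ell2_square by (rule infsum_mono[OF ell2_apply_summable ell2_apply_summable]) simp
  then show "norm (ell2_restrict A f) \<le> norm f * 1"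
    by (auto intro: power2_le_imp_le)
qed

definition ell2_module :: "'a set \<Rightarrow> ('a, 'a ell2) coarse_module" where
  "ell2_module X = \<lparr>msets = Pow X, hspace = {f. \<forall>x. x \<notin> X \<longrightarrow> ell2_apply f x = 0}, ind = mult_ind\<rparr>"

definition Roe_u :: "'a set \<Rightarrow> ('a \<Rightarrow> 'a \<Rightarrow> ennreal) \<Rightarrow> ('a ell2 \<Rightarrow>\<^sub>L 'a ell2) set" where
  "Roe_u X d = Roe_cp d (ell2_module X)"

end

(* Only two features of the algebras matter: they contain all operators of finite propagation and
   consist of quasi-local operators. An isomorphism phi maps rank-one projections of R to rank-one
   projections, since S contains enough rank-one operators; so it matches unit vectors v and w up
   to phase, and q C = phi^-1(1_C) makes H_X a module over Y as well.

   Concentration: each q C is quasi-local over X, and a gliding hump (the Schur property of l^1)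
   makes this uniform in C. Hence, for v supported near x, all vectors q C v almost live near x.
   Decomposing v along a partition of Y into bounded pieces C and averaging over signs, some
   nonzero q C v is concentrated near x even relative to its norm, while its partner lives in C.
   This relates x to the points of C; the relation is symmetric in phi and phi^-1.

   Control: if related pairs had d(x,x') bounded and d(y,y') unbounded, then one could either choose
   such pairs mutually far apart in X or find them all in one bounded subset of X. In either case a
   sum of rank-one operators v |-> v' is an operator of finite propagation whose image under phi
   is not quasi-local. *)

theory Submission
  imports Defs
begin

section \<open>Operators on complex Hilbert spaces\<close>

text \<open>Infinite distances and infinite balls shape the argument. A rank-one operator between
  unit vectors living at infinite distance is not quasi-local, so \<open>R\<close> need not act
  irreducibly. Instead of building a unitary that implements \<open>\<phi>\<close>, the proof
  matches unit vectors one at a time, and carries only the scalars \<open>cinner v (t v)\<close> and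
  lower bounds for norms across \<open>\<phi>\<close>. With no bound on the number of pieces in a
  ball, all components \<open>q C v\<close> of one vector may be tiny, and then an absolute bound on
  the part of \<open>q C v\<close> outside \<open>D\<close> says nothing. Hence concentration is
  measured relative to \<open>norm (q C v)\<close>, and signs are averaged in order to compare sums
  of squares instead of single terms. Constants: quasi-locality of the image of an operator caps
  certain matrix coefficients at \<open>1/4\<close> for distant supports, while concentration up to
  \<open>1/100\<close> keeps the same coefficients above \<open>0.84 - 0.06 = 0.78\<close>. Only
  this gap matters.\<close>

instance complex_hilbert \<subseteq> banach ..

lemma mult_cnj_cmod: "z * cnj z = (complex_of_real (cmod z))\<^sup>2"
  by (simp flip: complex_norm_square)

lemma cinner_add_left: "cinner (x + y) z = cinner x z + cinner y z"
  by (metis cinner_add_right cinner_commute complex_cnj_add)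

lemma cinner_scaleC_left: "cinner (c *\<^sub>C x) y = cnj c * cinner x y"
  by (metis cinner_scaleC_right cinner_commute complex_cnj_mult)

lemma cinner_zero_right [simp]: "cinner x 0 = 0"
  using cinner_add_right[of x 0 0] by simp

lemma cinner_zero_left [simp]: "cinner 0 x = 0"
  using cinner_add_left[of 0 0 x] by simp

lemma cinner_diff_right: "cinner x (y - z) = cinner x y - cinner x z"
  using cinner_add_right[of x "y - z" z] by simp

lemma cinner_diff_left: "cinner (x - y) z = cinner x z - cinner y z"
  using cinner_add_left[of "x - y" y z] by simp

lemma cinner_sum_left: "cinner (sum f A) z = (\<Sum>i\<in>A. cinner (f i) z)"
  by (induction A rule: infinite_finite_induct) (auto simp: cinner_add_left)

lemma cinner_sum_right: "cinner z (sum f A) = (\<Sum>i\<in>A. cinner z (f i))"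
  by (induction A rule: infinite_finite_induct) (auto simp: cinner_add_right)

lemma scaleC_zero_left [simp]: "0 *\<^sub>C x = 0"
  using scaleC_of_real[of 0 x] by simp

lemma scaleC_one [simp]: "1 *\<^sub>C x = x"
  using scaleC_of_real[of 1 x] by simp

lemma scaleC_zero_right [simp]: "c *\<^sub>C 0 = 0"
  using scaleC_add_right[of c 0 0] by simp

text \<open>Multiplying \<open>y\<close> by the phase \<open>c\<close> makes the product real and
  nonnegative, which reduces the claim to the real inequality for \<open>inner\<close>.\<close>

lemma Cauchy_Schwarz_cinner: "cmod (cinner x y) \<le> norm x * norm y"
proof (cases "cinner x y = 0")
  case False
  define c where "c = cnj (cinner x y) / cmod (cinner x y)"
  have c: "c * cinner x y = cmod (cinner x y)" "cmod c = 1"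
    using False mult_cnj_cmod[of "cinner x y"]
    by (auto simp: c_def norm_divide power2_eq_square mult.commute)
  have "cmod (cinner x y) = inner x (c *\<^sub>C y)"
    by (simp add: cinner_scaleC_right c(1) flip: Re_cinner)
  also have "\<dots> \<le> norm x * norm (c *\<^sub>C y)" by (rule norm_cauchy_schwarz)
  finally show ?thesis by (simp add: norm_scaleC c)
qed simp

lemma bounded_linear_cinner: "bounded_linear (cinner x)"
proof (rule bounded_linear_intro)
  show "norm (cinner x y) \<le> norm y * norm x" for y
    using Cauchy_Schwarz_cinner[of x y] by (simp add: mult.commute)
  show "cinner x (r *\<^sub>R y) = r *\<^sub>R cinner x y" for r y
    by (simp add: cinner_scaleC_right scaleR_conv_of_real flip: scaleC_of_real)
qed (rule cinner_add_right)

lemma cinner_ext: "(\<And>w. cinner x w = cinner y w) \<Longrightarrow> x = y"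
  by (metis cinner_diff_left cinner_self eq_iff_diff_eq_0 of_real_eq_0_iff norm_eq_zero power_eq_0_iff)

section \<open>Riesz representation, adjoints and complex-linear operators\<close>

lemma riesz_representation:
  fixes f :: "'h::{real_inner,complete_space} \<Rightarrow> real"
  assumes "bounded_linear f"
  shows "\<exists>z. \<forall>x. f x = inner z x"
proof -
  interpret f: bounded_linear f by fact
  obtain K where K: "\<And>x. norm (f x) \<le> norm x * K" using f.bounded by blast
  \<comment> \<open>The representing vector minimizes the strictly convex functional \<open>J\<close>.\<close>
  define J where "J x = (norm x)\<^sup>2 - 2 * f x" for x
  have lower: "J x \<ge> - K\<^sup>2" for x
  proof -
    have "0 \<le> (norm x - K)\<^sup>2" by simp
    then show ?thesis using K[of x] by (simp add: J_def power2_diff)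
  qed
  define m where "m = (INF x. J x)"
  have bdd: "bdd_below (range J)" using lower by (rule bdd_belowI2)
  have m: "m \<le> J x" for x unfolding m_def by (rule cINF_lower[OF bdd]) simp
  have "\<exists>x. J x < m + 1 / Suc n" for n
    using cINF_less_iff[of UNIV J "m + 1 / Suc n"] bdd by (auto simp: m_def)
  then obtain u where u: "\<And>n. J (u n) < m + 1 / Suc n" by metis
  \<comment> \<open>Parallelogram identity: since the midpoint still has \<open>J\<close> at least
    \<open>m\<close>, two near-minimizers must be close to each other.\<close>
  have par: "(norm (x - y))\<^sup>2 \<le> 2 * (J x + J y - 2 * m)" for x y
  proof -
    define mid where "mid = (1/2) *\<^sub>R (x + y)"
    have "(norm (x - y))\<^sup>2 + 4 * J mid = 2 * (J x + J y)"
      unfolding J_def mid_def power2_norm_eq_inner f.add f.scaleR inner_simps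
      by (simp add: algebra_simps inner_commute)
    then show ?thesis using m[of mid] by argo
  qed
  have "Cauchy u"
  proof (rule metric_CauchyI)
    fix e :: real assume "e > 0"
    then obtain N where N: "1 / Suc N < e\<^sup>2 / 4"
      using nat_approx_posE[of "e\<^sup>2 / 4"] by auto
    show "\<exists>M. \<forall>k\<ge>M. \<forall>n\<ge>M. dist (u k) (u n) < e"
    proof (intro exI allI impI)
      fix k n assume kn: "k \<ge> N" "n \<ge> N"
      have le: "1 / real (Suc i) \<le> 1 / Suc N" if "i \<ge> N" for i
        using that by (simp add: frac_le)
      have "(norm (u k - u n))\<^sup>2 < e\<^sup>2"
        using par[of "u k" "u n"] u[of k] u[of n] le[OF kn(1)] le[OF kn(2)] N by argo
      then show "dist (u k) (u n) < e"
        using \<open>e > 0\<close> by (auto simp: dist_norm intro: power2_less_imp_less)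
    qed
  qed
  then obtain z where z: "u \<longlonglongrightarrow> z" using Cauchy_convergent convergent_def by blast
  have "(\<lambda>n. J (u n)) \<longlonglongrightarrow> J z"
    unfolding J_def by (intro tendsto_intros z f.tendsto)
  moreover have "(\<lambda>n. m + 1 / Suc n) \<longlonglongrightarrow> m + 0"
    by (intro tendsto_intros LIMSEQ_Suc[OF lim_1_over_n])
  ultimately have "J z \<le> m"
    using u by (intro LIMSEQ_le[of "\<lambda>n. J (u n)" _ "\<lambda>n. m + 1 / Suc n"]) (auto intro: less_imp_le)
  have "f x = inner z x" for x
  proof (cases "x = 0")
    case False
    \<comment> \<open>The minimizer of \<open>J\<close> along the line through \<open>z\<close> in
      direction \<open>x\<close>; moving there lowers \<open>J\<close> by
      \<open>(t * norm x)\<^sup>2\<close>, so minimality of \<open>z\<close> forces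
      \<open>t = 0\<close>.\<close>
    define t where "t = (f x - inner z x) / (norm x)\<^sup>2"
    have t: "t * (norm x)\<^sup>2 = f x - inner z x" using False by (simp add: t_def)
    have "J z \<le> J (z + t *\<^sub>R x)" using \<open>J z \<le> m\<close> m order_trans by blast
    also have "\<dots> = J z + t * (t * (norm x)\<^sup>2) - 2 * t * (f x - inner z x)"
      unfolding J_def power2_norm_eq_inner f.add f.scaleR
      by (simp add: inner_simps algebra_simps inner_commute)
    finally have "t * (t * (norm x)\<^sup>2) \<le> 0" unfolding t by (simp add: algebra_simps)
    then have "(t * norm x)\<^sup>2 \<le> 0" by (simp add: power2_eq_square mult_ac)
    then have "t = 0" using False by simp
    then show ?thesis using t by simp
  qed (simp add: f.zero)
  then show ?thesis by blast
qed

text \<open>Riesz is applied to the real form \<open>inner\<close>. The imaginary part of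
  \<open>cinner\<close> is recovered from its real part by multiplying with the imaginary unit, and
  this is where complex linearity of \<open>t\<close> enters.\<close>

lemma adj_exists:
  assumes "clinear_op t"
  shows "\<exists>s. \<forall>v w. cinner (blinfun_apply s v) w = cinner v (blinfun_apply t w)"
proof -
  have "\<exists>z. \<forall>w. inner v (t w) = inner z w" for v
    by (rule riesz_representation)
      (rule bounded_linear_compose[OF bounded_linear_inner_right blinfun.bounded_linear_right])
  then obtain s where s: "\<And>v w. inner v (t w) = inner (s v) w" by metis
  have Im: "Im (cinner x y) = - Re (cinner x (\<i> *\<^sub>C y))" for x y :: 'a
    by (simp add: cinner_scaleC_right)
  have cs: "cinner (s v) w = cinner v (t w)" for v w
    using assms by (intro complex_eqI) (simp_all add: Im Re_cinner clinear_op_def flip: s)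
  have "bounded_linear s"
  proof (rule bounded_linear_intro)
    show "s (x + y) = s x + s y" for x y
      by (rule cinner_ext) (simp add: cs cinner_add_left)
    show "s (r *\<^sub>R x) = r *\<^sub>R s x" for r x
      by (rule cinner_ext) (simp add: cs cinner_scaleC_left flip: scaleC_of_real)
    show "norm (s x) \<le> norm x * norm t" for x
    proof (cases "norm (s x) = 0")
      case False
      have "norm (s x) * norm (s x) = inner x (t (s x))"
        by (simp add: s power2_norm_eq_inner flip: power2_eq_square)
      also have "\<dots> \<le> norm x * (norm t * norm (s x))"
        using norm_cauchy_schwarz[of x "t (s x)"] norm_blinfun[of t "s x"]
        by (meson mult_left_mono norm_ge_zero order_trans)
      finally show ?thesis using False by (simp add: mult.assoc[symmetric])
    qed (simp add: mult_nonneg_nonneg)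
  qed
  then show ?thesis
    by (intro exI[of _ "Blinfun s"]) (simp add: bounded_linear_Blinfun_apply cs)
qed

lemma adj_eqI:
  assumes "\<And>v w. cinner (blinfun_apply s v) w = cinner v (blinfun_apply t w)"
  shows "adj t = s"
  unfolding adj_def
proof (rule the_equality)
  fix s' assume "\<forall>v w. cinner (blinfun_apply s' v) w = cinner v (blinfun_apply t w)"
  then show "s' = s" using assms by (intro blinfun_eqI cinner_ext) simp
qed (use assms in simp)

lemma cinner_adj:
  assumes "clinear_op t"
  shows "cinner (blinfun_apply (adj t) v) w = cinner v (blinfun_apply t w)"
  using adj_exists[OF assms] adj_eqI by metis

lemma clinear_op_adj: "clinear_op t \<Longrightarrow> clinear_op (adj t)"
  unfolding clinear_op_def[of "adj t"]
  by (intro allI cinner_ext) (simp add: cinner_adj cinner_scaleC_left)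

lemma adj_compose: "clinear_op s \<Longrightarrow> clinear_op t \<Longrightarrow> adj (s o\<^sub>L t) = adj t o\<^sub>L adj s"
  by (rule adj_eqI) (simp add: cinner_adj)

lemma norm_adj_le:
  assumes "clinear_op t" shows "norm (adj t) \<le> norm t"
proof (rule norm_blinfun_bound)
  fix x
  show "norm (adj t x) \<le> norm t * norm x"
  proof (cases "norm (adj t x) = 0")
    case False
    have "norm (adj t x) * norm (adj t x) = cmod (cinner x (t (adj t x)))"
      by (simp add: cinner_self power2_eq_square norm_mult flip: cinner_adj[OF assms])
    also have "\<dots> \<le> norm x * (norm t * norm (adj t x))"
      using Cauchy_Schwarz_cinner[of x "t (adj t x)"] norm_blinfun[of t "adj t x"]
      by (meson mult_left_mono norm_ge_zero order_trans)
    finally show ?thesis using False by (simp add: mult_ac)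
  qed (simp add: mult_nonneg_nonneg)
qed simp

lemma clinear_op_add: "clinear_op s \<Longrightarrow> clinear_op t \<Longrightarrow> clinear_op (s + t)"
  and clinear_op_diff: "clinear_op s \<Longrightarrow> clinear_op t \<Longrightarrow> clinear_op (s - t)"
  and clinear_op_scaleC: "clinear_op t \<Longrightarrow> clinear_op (scaleC_op c t)"
  and clinear_op_compose: "clinear_op s \<Longrightarrow> clinear_op t \<Longrightarrow> clinear_op (s o\<^sub>L t)"
  by (simp_all add: clinear_op_def blinfun.add_left blinfun.diff_left scaleC_add_right
      scaleC_op.rep_eq scaleC_scaleC mult.commute
      bounded_linear.linear[OF bounded_linear_scaleC] linear_diff)

lemma adj_diff: "clinear_op s \<Longrightarrow> clinear_op t \<Longrightarrow> adj (s - t) = adj s - adj t"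
  by (rule adj_eqI) (simp add: cinner_adj blinfun.diff_left cinner_diff_left cinner_diff_right)

lemma norm_scaleC_op: "norm (scaleC_op c t) \<le> cmod c * norm t"
proof (rule norm_blinfun_bound)
  show "norm (scaleC_op c t x) \<le> cmod c * norm t * norm x" for x
    using norm_blinfun[of t x] by (simp add: scaleC_op.rep_eq norm_scaleC mult_left_mono mult.assoc)
qed simp

lemma clinear_op_ext_scaleC: "clinear_op t \<Longrightarrow> blinfun_apply t (c *\<^sub>C v) = c *\<^sub>C t v"
  by (simp add: clinear_op_def)

section \<open>Rank-one operators |b><a|, written \<open>rank1 b a\<close>, and orthogonal
  families\<close>

lift_definition rank1 :: "'h::complex_hilbert \<Rightarrow> 'h \<Rightarrow> 'h \<Rightarrow>\<^sub>L 'h"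
  is "\<lambda>b a v. cinner a v *\<^sub>C b"
proof (rule bounded_linear_intro)
  fix a b x y :: 'h and r :: real
  show "cinner a (x + y) *\<^sub>C b = cinner a x *\<^sub>C b + cinner a y *\<^sub>C b"
    by (simp add: cinner_add_right scaleC_add_left)
  show "cinner a (r *\<^sub>R x) *\<^sub>C b = r *\<^sub>R cinner a x *\<^sub>C b"
    by (simp add: cinner_scaleC_right scaleC_scaleC flip: scaleC_of_real)
  show "norm (cinner a x *\<^sub>C b) \<le> norm x * (norm a * norm b)"
    using mult_right_mono[OF Cauchy_Schwarz_cinner[of a x] norm_ge_zero[of b]]
    by (simp add: norm_scaleC mult_ac)
qed

lemma rank1_apply: "rank1 b a v = cinner a v *\<^sub>C b"
  by (simp add: rank1.rep_eq)

lemma clinear_op_rank1: "clinear_op (rank1 b a)"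
  by (simp add: clinear_op_def rank1_apply cinner_scaleC_right scaleC_scaleC)

lemma compose_rank1: "clinear_op t \<Longrightarrow> t o\<^sub>L rank1 b a = rank1 (t b) a"
  by (rule blinfun_eqI) (simp add: rank1_apply clinear_op_def)

lemma rank1_compose: "clinear_op t \<Longrightarrow> rank1 b a o\<^sub>L t = rank1 b (adj t a)"
  by (rule blinfun_eqI) (simp add: rank1_apply cinner_adj)

lemma rank1_compose_rank1: "rank1 b a o\<^sub>L rank1 d c = scaleC_op (cinner a d) (rank1 b c)"
  by (rule blinfun_eqI) (simp add: rank1_apply scaleC_op.rep_eq cinner_scaleC_right scaleC_scaleC mult.commute)

lemma adj_rank1: "adj (rank1 b a) = rank1 a b"
  by (rule adj_eqI) (simp add: rank1_apply cinner_scaleC_left cinner_scaleC_right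
      cinner_commute[of b] mult.commute)

lemma rank1_scaleC: "rank1 (c *\<^sub>C b) (c' *\<^sub>C a) = scaleC_op (c * cnj c') (rank1 b a)"
  by (rule blinfun_eqI)
    (simp add: rank1_apply cinner_scaleC_left scaleC_scaleC scaleC_op.rep_eq mult_ac)

lemma rank1_self_apply: "norm v = 1 \<Longrightarrow> rank1 v v v = v"
  by (simp add: rank1_apply cinner_self)

lemma norm_rank1_unit:
  assumes "norm a = 1" "norm b = 1" shows "norm (rank1 b a) = 1"
proof (rule antisym)
  show "norm (rank1 b a) \<le> 1"
  proof (rule norm_blinfun_bound)
    show "norm (rank1 b a x) \<le> 1 * norm x" for x
      using Cauchy_Schwarz_cinner[of a x] assms by (simp add: rank1_apply norm_scaleC)
  qed simp
  show "1 \<le> norm (rank1 b a)"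
    using norm_blinfun[of "rank1 b a" a] assms by (simp add: rank1_apply norm_scaleC cinner_self)
qed

lemma scaleC_op_compose_left: "scaleC_op c s o\<^sub>L t = scaleC_op c (s o\<^sub>L t)"
  by (rule blinfun_eqI) (simp add: scaleC_op.rep_eq)

lemma scaleC_op_compose_right: "clinear_op s \<Longrightarrow> s o\<^sub>L scaleC_op c t = scaleC_op c (s o\<^sub>L t)"
  by (rule blinfun_eqI) (simp add: scaleC_op.rep_eq clinear_op_def)

lemma scaleC_op_scaleC_op: "scaleC_op b (scaleC_op c t) = scaleC_op (b * c) t"
  by (rule blinfun_eqI) (simp add: scaleC_op.rep_eq scaleC_scaleC)

lemma scaleC_op_one [simp]: "scaleC_op 1 t = t"
  by (rule blinfun_eqI) (simp add: scaleC_op.rep_eq)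

lemma scaleC_op_zero [simp]: "scaleC_op 0 t = 0"
  by (rule blinfun_eqI) (simp add: scaleC_op.rep_eq)

lemma norm_scaleC_op_eq: "norm (scaleC_op c t) = cmod c * norm t"
proof (cases "c = 0")
  case False
  have "norm (scaleC_op (inverse c) (scaleC_op c t)) \<le> cmod (inverse c) * norm (scaleC_op c t)"
    by (rule norm_scaleC_op)
  then have "cmod c * norm t \<le> norm (scaleC_op c t)"
    using False
    by (simp add: scaleC_op_scaleC_op norm_inverse inverse_eq_divide norm_divide pos_le_divide_eq
        mult.commute)
  then show ?thesis using norm_scaleC_op[of c t] by simp
qed simp

text \<open>Expand the square of \<open>norm (v - w)\<close>. The norms are only bounded by 1
  because the vectors used later are cut-down unit vectors such as \<open>q (C k) (v k)\<close>,
  which are not normalized.\<close>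

lemma bessel_inequality:
  fixes a :: "'i \<Rightarrow> 'h::complex_hilbert"
  assumes "finite F" and orth: "\<And>i j. i \<in> F \<Longrightarrow> j \<in> F \<Longrightarrow> i \<noteq> j \<Longrightarrow> cinner (a i) (a j) = 0"
    and unit: "\<And>i. i \<in> F \<Longrightarrow> norm (a i) \<le> 1"
  shows "(\<Sum>i\<in>F. (cmod (cinner (a i) v))\<^sup>2) \<le> (norm v)\<^sup>2"
proof -
  define c where "c i = cinner (a i) v" for i
  define w where "w = (\<Sum>i\<in>F. c i *\<^sub>C a i)"
  have wv: "cinner w v = (\<Sum>i\<in>F. (cmod (c i))\<^sup>2)"
    unfolding w_def cinner_sum_left cinner_scaleC_left of_real_sum
    by (intro sum.cong) (simp_all add: c_def mult_cnj_cmod mult.commute[of "cnj _"])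
  have aw: "cinner (a i) w = c i * (norm (a i))\<^sup>2" if "i \<in> F" for i
  proof -
    have "cinner (a i) w = (\<Sum>j\<in>F. if j = i then c i * (norm (a i))\<^sup>2 else 0)"
      unfolding w_def cinner_sum_right cinner_scaleC_right
      using that orth by (intro sum.cong) (auto simp: cinner_self)
    then show ?thesis using that \<open>finite F\<close> by simp
  qed
  have "cinner w w = (\<Sum>i\<in>F. (cmod (c i))\<^sup>2 * (norm (a i))\<^sup>2)"
  proof -
    have "cinner w w = (\<Sum>i\<in>F. cnj (c i) * cinner (a i) w)"
      by (subst w_def) (simp add: cinner_sum_left cinner_scaleC_left)
    also have "\<dots> = (\<Sum>i\<in>F. complex_of_real ((cmod (c i))\<^sup>2 * (norm (a i))\<^sup>2))"
      by (intro sum.cong) (simp_all add: aw mult_cnj_cmod mult.assoc[symmetric] mult.commute[of "cnj _"])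
    finally show ?thesis by simp
  qed
  then have "inner w w = (\<Sum>i\<in>F. (cmod (c i))\<^sup>2 * (norm (a i))\<^sup>2)"
    by (metis Re_cinner Re_complex_of_real)
  also have "\<dots> \<le> (\<Sum>i\<in>F. (cmod (c i))\<^sup>2)"
    using unit by (intro sum_mono mult_left_le) (auto simp: power_le_one)
  finally have ww: "inner w w \<le> (\<Sum>i\<in>F. (cmod (c i))\<^sup>2)" .
  have "0 \<le> inner (v - w) (v - w)" by simp
  also have "\<dots> = (norm v)\<^sup>2 - 2 * inner w v + inner w w"
    by (simp add: power2_norm_eq_inner inner_simps inner_commute)
  also have "inner w v = (\<Sum>i\<in>F. (cmod (c i))\<^sup>2)"
    using wv by (metis Re_cinner Re_complex_of_real)
  finally show ?thesis using ww by (simp add: c_def)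
qed

text \<open>Pythagoras for the \<open>b k\<close> and Bessel for the \<open>a k\<close> bound every
  block of the series by the corresponding block of squared coefficients, so it converges pointwise,
  though in general not in operator norm. This produces the operators whose images fail to be
  quasi-local in the control step.\<close>

lemma orthogonal_rank1_sum:
  fixes a b :: "nat \<Rightarrow> 'h::complex_hilbert"
  assumes a: "\<And>i j. i \<noteq> j \<Longrightarrow> cinner (a i) (a j) = 0" "\<And>i. norm (a i) \<le> 1"
    and b: "\<And>i j. i \<noteq> j \<Longrightarrow> cinner (b i) (b j) = 0" "\<And>i. norm (b i) \<le> 1"
  obtains T where "clinear_op T" "norm T \<le> 1" "\<And>v. (\<lambda>k. cinner (a k) v *\<^sub>C b k) sums T v"
proof -
  define c where "c v k = cinner (a k) v *\<^sub>C b k" for v k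
  have pyth: "(norm (\<Sum>k\<in>F. c v k))\<^sup>2 \<le> (\<Sum>k\<in>F. (cmod (cinner (a k) v))\<^sup>2)" if "finite F" for F v
  proof -
    have "inner (c v i) (c v j) = 0" if "i \<noteq> j" for i j
      using b(1)[OF that] by (simp add: c_def cinner_scaleC_left cinner_scaleC_right flip: Re_cinner)
    then have "(norm (\<Sum>k\<in>F. c v k))\<^sup>2 = (\<Sum>k\<in>F. (norm (c v k))\<^sup>2)"
      using that by (intro norm_sum_Pythagorean) (auto simp: pairwise_def orthogonal_def)
    also have "\<dots> \<le> (\<Sum>k\<in>F. (cmod (cinner (a k) v))\<^sup>2)"
      using b(2) by (intro sum_mono power_mono) (auto simp: c_def norm_scaleC mult_left_le)
    finally show ?thesis .
  qed
  have bessel: "(\<Sum>k\<in>F. (cmod (cinner (a k) v))\<^sup>2) \<le> (norm v)\<^sup>2" if "finite F" for F v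
    using that a by (intro bessel_inequality) auto
  have summ: "summable (\<lambda>k. (cmod (cinner (a k) v))\<^sup>2)" for v
    by (rule summableI_nonneg_bounded[where x = "(norm v)\<^sup>2"]) (auto intro: bessel)
  have "summable (c v)" for v
    unfolding summable_Cauchy
  proof (intro allI impI)
    fix e :: real assume "e > 0"
    then obtain N where N: "\<And>m n. m \<ge> N \<Longrightarrow> norm (\<Sum>k=m..<n. (cmod (cinner (a k) v))\<^sup>2) < e\<^sup>2"
      using summ[of v, unfolded summable_Cauchy, rule_format, of "e\<^sup>2"] by auto
    have "norm (sum (c v) {m..<n}) < e" if "m \<ge> N" for m n
    proof -
      have "(norm (sum (c v) {m..<n}))\<^sup>2 < e\<^sup>2"
        using pyth[of "{m..<n}" v] N[OF that, of n] by simp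
      then show ?thesis using \<open>e > 0\<close> by (auto intro: power2_less_imp_less)
    qed
    then show "\<exists>N. \<forall>m\<ge>N. \<forall>n. norm (sum (c v) {m..<n}) < e" by blast
  qed
  then have sums: "c v sums suminf (c v)" for v by (rule summable_sums)
  have bl: "bounded_linear (\<lambda>v. suminf (c v))"
  proof (rule bounded_linear_intro)
    show "suminf (c (x + y)) = suminf (c x) + suminf (c y)" for x y
    proof (rule sums_unique[symmetric])
      show "c (x + y) sums (suminf (c x) + suminf (c y))"
        using sums_add[OF sums[of x] sums[of y]]
        by (simp add: c_def[abs_def] cinner_add_right scaleC_add_left)
    qed
    show "suminf (c (r *\<^sub>R x)) = r *\<^sub>R suminf (c x)" for r x
    proof (rule sums_unique[symmetric])
      show "c (r *\<^sub>R x) sums (r *\<^sub>R suminf (c x))"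
        using sums_scaleR_right[OF sums[of x], of r]
        by (simp add: c_def[abs_def] cinner_scaleC_right scaleC_scaleC flip: scaleC_of_real)
    qed
    show "norm (suminf (c x)) \<le> norm x * 1" for x
    proof -
      have "(\<lambda>n. norm (sum (c x) {..<n})) \<longlonglongrightarrow> norm (suminf (c x))"
        using sums[of x] unfolding sums_def by (rule tendsto_norm)
      moreover have "norm (sum (c x) {..<n}) \<le> norm x" for n
        using order_trans[OF pyth bessel, of "{..<n}" x] by (auto intro: power2_le_imp_le)
      ultimately show ?thesis by (intro LIMSEQ_le_const2) auto
    qed
  qed
  have T: "Blinfun (\<lambda>v. suminf (c v)) v = suminf (c v)" for v
    by (simp add: bounded_linear_Blinfun_apply[OF bl])
  show ?thesis
  proof (rule that)
    show "(\<lambda>k. cinner (a k) v *\<^sub>C b k) sums Blinfun (\<lambda>v. suminf (c v)) v" for v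
      unfolding T using sums[of v] by (simp add: c_def[abs_def])
    show "clinear_op (Blinfun (\<lambda>v. suminf (c v)))"
      unfolding clinear_op_def
    proof (intro allI)
      fix s v
      have "c (s *\<^sub>C v) sums (s *\<^sub>C suminf (c v))"
        using bounded_linear.sums[OF bounded_linear_scaleC sums[of v], of s]
        by (simp add: c_def[abs_def] cinner_scaleC_right scaleC_scaleC)
      then show "Blinfun (\<lambda>v. suminf (c v)) (s *\<^sub>C v) = s *\<^sub>C Blinfun (\<lambda>v. suminf (c v)) v"
        unfolding T by (rule sums_unique[symmetric])
    qed
    show "norm (Blinfun (\<lambda>v. suminf (c v))) \<le> 1"
    proof (rule norm_blinfun_bound)
      fix x
      have "(\<lambda>n. norm (sum (c x) {..<n})) \<longlonglongrightarrow> norm (suminf (c x))"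
        using sums[of x] unfolding sums_def by (rule tendsto_norm)
      moreover have "norm (sum (c x) {..<n}) \<le> norm x" for n
        using order_trans[OF pyth bessel, of "{..<n}" x] by (auto intro: power2_le_imp_le)
      ultimately show "norm (Blinfun (\<lambda>v. suminf (c v)) x) \<le> 1 * norm x"
        unfolding T by (intro LIMSEQ_le_const2) auto
    qed simp
  qed
qed

section \<open>Orthogonal projections and a choice of signs\<close>

lemma projection_cinner:
  assumes "clinear_op p" "is_projection p"
  shows "cinner (blinfun_apply p v) w = cinner v (p w)"
  using assms cinner_adj unfolding is_projection_def by metis

lemma projection_cinner_self:
  assumes "clinear_op p" "is_projection p"
  shows "cinner v (blinfun_apply p v) = (norm (p v))\<^sup>2"
  using projection_cinner[OF assms, of v "p v"] assms(2)
  unfolding is_projection_def by (metis blinfun_apply_blinfun_compose cinner_self of_real_power)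

lemma projection_pythagoras:
  assumes "clinear_op p" "is_projection p"
  shows "(norm v)\<^sup>2 = (norm (blinfun_apply p v))\<^sup>2 + (norm (v - p v))\<^sup>2"
proof -
  have "Re (cinner v (p v)) = (norm (p v))\<^sup>2"
    using projection_cinner_self[OF assms, of v] by simp
  then have "inner v (p v) = inner (p v) (p v)" by (simp add: Re_cinner power2_norm_eq_inner)
  then show ?thesis by (simp add: power2_norm_eq_inner inner_simps inner_commute)
qed

lemma projection_norm_le:
  assumes "clinear_op p" "is_projection p"
  shows "norm (blinfun_apply p v) \<le> norm v"
proof -
  have "(norm (p v))\<^sup>2 \<le> (norm v)\<^sup>2" using projection_pythagoras[OF assms, of v] by simp
  then show ?thesis by (auto intro: power2_le_imp_le)
qed

lemma norm_projection_le: "clinear_op p \<Longrightarrow> is_projection p \<Longrightarrow> norm p \<le> 1"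
  by (rule norm_blinfun_bound) (auto intro: projection_norm_le)

text \<open>Over independent random signs the expected squared norm of the signed sum is the sum of
  the squared norms, so some choice does at least as well. The induction finds one greedily: each
  new sign makes the inner product with the current signed sum nonnegative.\<close>

lemma sum_norm_square_le_signed_sum:
  fixes u :: "'i \<Rightarrow> 'h::real_inner"
  assumes "finite F"
  obtains G where "G \<subseteq> F" "(\<Sum>i\<in>F. (norm (u i))\<^sup>2) \<le> (norm ((\<Sum>i\<in>G. u i) - (\<Sum>i\<in>F - G. u i)))\<^sup>2"
  using assms
proof (induction F arbitrary: thesis rule: finite_induct)
  case (insert x F)
  obtain G where G: "G \<subseteq> F" "(\<Sum>i\<in>F. (norm (u i))\<^sup>2) \<le> (norm ((\<Sum>i\<in>G. u i) - (\<Sum>i\<in>F - G. u i)))\<^sup>2"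
    using insert.IH by blast
  define s where "s = (\<Sum>i\<in>G. u i) - (\<Sum>i\<in>F - G. u i)"
  have fin: "finite G" "finite (F - G)" "x \<notin> G" "x \<notin> F - G"
    using insert.hyps G(1) by (auto intro: finite_subset)
  have sumF: "(\<Sum>i\<in>insert x F. (norm (u i))\<^sup>2) \<le> (norm s)\<^sup>2 + (norm (u x))\<^sup>2"
    using insert.hyps G(2) by (simp add: s_def)
  show ?case
  proof (cases "inner s (u x) \<ge> 0")
    case True
    have "(norm s)\<^sup>2 + (norm (u x))\<^sup>2 \<le> (norm (s + u x))\<^sup>2"
      using True by (simp add: power2_norm_eq_inner inner_simps inner_commute)
    moreover have "(\<Sum>i\<in>insert x G. u i) - (\<Sum>i\<in>insert x F - insert x G. u i) = s + u x"
      using fin insert.hyps G(1) by (simp add: s_def)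
    ultimately show ?thesis
      using G(1) sumF by (intro insert.prems[of "insert x G"]) (auto intro: order_trans)
  next
    case False
    have "(norm s)\<^sup>2 + (norm (u x))\<^sup>2 \<le> (norm (s - u x))\<^sup>2"
      using False by (simp add: power2_norm_eq_inner inner_simps inner_commute)
    moreover have "(\<Sum>i\<in>G. u i) - (\<Sum>i\<in>insert x F - G. u i) = s - u x"
      using fin insert.hyps G(1) by (simp add: s_def insert_Diff_if)
    ultimately show ?thesis
      using G(1) sumF by (intro insert.prems[of G]) (auto intro: order_trans)
  qed
qed simp

section \<open>Coarse modules and Roe-like algebras\<close>

lemma blinfun_compose_assoc: "(r o\<^sub>L s) o\<^sub>L t = r o\<^sub>L (s o\<^sub>L t)"
  by (rule blinfun_eqI) simp

lemma blinfun_compose_add_left: "(r + s) o\<^sub>L t = (r o\<^sub>L t) + (s o\<^sub>L t)"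
  and blinfun_compose_add_right: "t o\<^sub>L (r + s) = (t o\<^sub>L r) + (t o\<^sub>L s)"
  by (auto intro!: blinfun_eqI simp: blinfun.add_left blinfun.add_right)

text \<open>What ample discrete modules and \<open>ell2_module\<close> have in common. Ampleness
  enters in the form \<open>supported\<close>: within a uniform distance of every point there is an
  entire piece carrying nonzero vectors.\<close>

locale discrete_coarse_space = extended_metric_space X d
  for X :: "'a set" and d :: "'a \<Rightarrow> 'a \<Rightarrow> ennreal" +
  fixes M :: "('a, 'h::complex_hilbert) coarse_module" and P :: "'a set set" and r0 s0 :: real
  assumes module: "X_module X d M"
    and r0: "r0 \<ge> 0" and s0: "s0 \<ge> 0"
    and part: "partition_on X P"
    and piece: "\<And>A. A \<in> P \<Longrightarrow> A \<in> msets M" "\<And>A. A \<in> P \<Longrightarrow> diam_le d r0 A"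
    and piece_has_sum: "\<And>v. v \<in> hspace M \<Longrightarrow> ((\<lambda>A. ind M A v) has_sum v) P"
    and measurableI: "\<And>C. C \<subseteq> X \<Longrightarrow> (\<And>A. A \<in> P \<Longrightarrow> C \<inter> A \<in> msets M) \<Longrightarrow> C \<in> msets M"
    and supported: "\<And>x. x \<in> X \<Longrightarrow> \<exists>A\<in>P. ind M A \<noteq> 0 \<and> (\<forall>a\<in>A. d x a \<le> ennreal s0)"
begin

abbreviation "H \<equiv> hspace M"
abbreviation "\<iota> \<equiv> ind M"
abbreviation "BO \<equiv> bounded_operators H"

lemma msets_algebra: "algebra X (msets M)"
  and ind_BO: "A \<in> msets M \<Longrightarrow> \<iota> A \<in> BO"
  and ind_projection: "A \<in> msets M \<Longrightarrow> is_projection (\<iota> A)"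
  and ind_Int: "A \<in> msets M \<Longrightarrow> A' \<in> msets M \<Longrightarrow> \<iota> A o\<^sub>L \<iota> A' = \<iota> (A \<inter> A')"
  and ind_Un: "A \<in> msets M \<Longrightarrow> A' \<in> msets M \<Longrightarrow> A \<inter> A' = {} \<Longrightarrow> \<iota> (A \<union> A') = \<iota> A + \<iota> A'"
  and ind_space: "v \<in> H \<Longrightarrow> \<iota> X v = v"
  and csubspace_H: "csubspace H" and closed_H: "closed H"
  using module unfolding X_module_def by auto

sublocale algebra X "msets M" by (rule msets_algebra)

lemma H_zero [simp]: "0 \<in> H"
  and H_add: "v \<in> H \<Longrightarrow> w \<in> H \<Longrightarrow> v + w \<in> H"
  and H_scaleC: "v \<in> H \<Longrightarrow> c *\<^sub>C v \<in> H"
proof -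
  interpret vector_space "scaleC :: complex \<Rightarrow> 'h \<Rightarrow> 'h" by (rule vector_space_scaleC)
  show "0 \<in> H" "v \<in> H \<Longrightarrow> w \<in> H \<Longrightarrow> v + w \<in> H" "v \<in> H \<Longrightarrow> c *\<^sub>C v \<in> H"
    using csubspace_H by (auto intro: subspace_add subspace_scale subspace_0)
qed

lemma BO_clinear: "t \<in> BO \<Longrightarrow> clinear_op t"
  and BO_range: "t \<in> BO \<Longrightarrow> t v \<in> H"
  and BO_orthogonal: "t \<in> BO \<Longrightarrow> (\<And>w. w \<in> H \<Longrightarrow> cinner w v = 0) \<Longrightarrow> t v = 0"
  unfolding bounded_operators_def by auto

lemmas ind_clinear = BO_clinear[OF ind_BO]

lemma ind_range: "A \<in> msets M \<Longrightarrow> \<iota> A v \<in> H"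
  by (rule BO_range[OF ind_BO])

lemma ind_selfadjoint: "A \<in> msets M \<Longrightarrow> cinner (\<iota> A v) w = cinner v (\<iota> A w)"
  by (rule projection_cinner[OF ind_clinear ind_projection])

lemma ind_norm_le: "A \<in> msets M \<Longrightarrow> norm (\<iota> A v) \<le> norm v"
  by (rule projection_norm_le[OF ind_clinear ind_projection])

lemma norm_ind_le: "A \<in> msets M \<Longrightarrow> norm (\<iota> A) \<le> 1"
  by (rule norm_projection_le[OF ind_clinear ind_projection])

lemma ind_apply_Int:
  "A \<in> msets M \<Longrightarrow> A' \<in> msets M \<Longrightarrow> \<iota> A (\<iota> A' v) = \<iota> (A \<inter> A') v"
  using ind_Int[of A A'] by (metis blinfun_apply_blinfun_compose)

lemma ind_empty [simp]: "\<iota> {} = 0"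
  using ind_Un[of "{}" "{}"] by simp

lemma ind_idem: "A \<in> msets M \<Longrightarrow> \<iota> A (\<iota> A v) = \<iota> A v"
  by (simp add: ind_apply_Int)

lemma measurable_subset: "A \<in> msets M \<Longrightarrow> A \<subseteq> X"
  using sets_into_space by blast

lemma ind_space_apply: "t \<in> BO \<Longrightarrow> t (\<iota> X v) = t v"
proof -
  assume t: "t \<in> BO"
  have "t (v - \<iota> X v) = 0"
  proof (rule BO_orthogonal[OF t])
    fix w assume "w \<in> H"
    then show "cinner w (v - \<iota> X v) = 0"
      by (simp add: cinner_diff_right ind_space flip: ind_selfadjoint)
  qed
  then show ?thesis by (simp add: blinfun.diff_right)
qed

text \<open>\<open>\<iota> X\<close> is the orthogonal projection onto \<open>H\<close>. Written as
  operator identities, membership in \<open>BO\<close> passes through sums, scalars and adjoints by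
  pure algebra.\<close>

lemma BO_iff: "t \<in> BO \<longleftrightarrow> clinear_op t \<and> \<iota> X o\<^sub>L t = t \<and> t o\<^sub>L \<iota> X = t"
proof
  assume t: "t \<in> BO"
  then show "clinear_op t \<and> \<iota> X o\<^sub>L t = t \<and> t o\<^sub>L \<iota> X = t"
    by (auto intro!: blinfun_eqI simp: BO_clinear ind_space BO_range ind_space_apply)
next
  assume *: "clinear_op t \<and> \<iota> X o\<^sub>L t = t \<and> t o\<^sub>L \<iota> X = t"
  have "t v \<in> H" for v
    using * ind_range[OF top] by (metis blinfun_apply_blinfun_compose)
  moreover have "t v = 0" if "\<forall>w\<in>H. cinner w v = 0" for v
  proof -
    have "\<iota> X v = 0" using that by (intro BO_orthogonal[OF ind_BO[OF top]]) auto
    then show ?thesis using * by (metis blinfun_apply_blinfun_compose blinfun.zero_right)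
  qed
  ultimately show "t \<in> BO" using * by (simp add: bounded_operators_def)
qed

lemma adj_ind: "A \<in> msets M \<Longrightarrow> adj (\<iota> A) = \<iota> A"
  using ind_projection unfolding is_projection_def by blast

lemma BO_add: "s \<in> BO \<Longrightarrow> t \<in> BO \<Longrightarrow> s + t \<in> BO"
  by (auto simp: BO_iff clinear_op_add blinfun_compose_add_left blinfun_compose_add_right)

lemma BO_scaleC: "t \<in> BO \<Longrightarrow> scaleC_op c t \<in> BO"
  by (simp add: BO_iff clinear_op_scaleC scaleC_op_compose_left scaleC_op_compose_right ind_clinear)

lemma BO_compose: "s \<in> BO \<Longrightarrow> t \<in> BO \<Longrightarrow> s o\<^sub>L t \<in> BO"
  unfolding bounded_operators_def by (auto simp: clinear_op_compose blinfun.zero_right)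

lemma BO_adj: "t \<in> BO \<Longrightarrow> adj t \<in> BO"
  using adj_compose[of t "\<iota> X"] adj_compose[of "\<iota> X" t]
  by (simp add: BO_iff clinear_op_adj ind_clinear adj_ind)

lemma BO_rank1: "a \<in> H \<Longrightarrow> b \<in> H \<Longrightarrow> rank1 b a \<in> BO"
  by (simp add: BO_iff clinear_op_rank1 compose_rank1 rank1_compose ind_clinear adj_ind ind_space)

lemma ind_Diff: "A \<in> msets M \<Longrightarrow> \<iota> (X - A) = \<iota> X - \<iota> A"
proof -
  assume A: "A \<in> msets M"
  then have "A \<union> (X - A) = X" using measurable_subset by blast
  then show ?thesis using ind_Un[of A "X - A"] A compl_sets[OF A] by (simp add: algebra_simps)
qed

lemma ind_Diff_apply: "A \<in> msets M \<Longrightarrow> v \<in> H \<Longrightarrow> \<iota> (X - A) v = v - \<iota> A v"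
  by (simp add: ind_Diff blinfun.diff_left ind_space)

lemma BO_split: "A \<in> msets M \<Longrightarrow> t \<in> BO \<Longrightarrow> t = (\<iota> A o\<^sub>L t) + (\<iota> (X - A) o\<^sub>L t)"
  by (auto intro!: blinfun_eqI simp: ind_Diff_apply BO_range blinfun.add_left)

section \<open>Pieces of the partition and measurable neighbourhoods\<close>

lemma pieces_disjoint: "A \<in> P \<Longrightarrow> B \<in> P \<Longrightarrow> A \<noteq> B \<Longrightarrow> A \<inter> B = {}"
  using part unfolding partition_on_def pairwise_def disjnt_def by blast

lemma pieces_cover: "\<Union>P = X" and piece_nonempty: "{} \<notin> P"
  using part unfolding partition_on_def by auto

text \<open>Infinite unions are included: a union of pieces meets each piece in that piece or in
  nothing, which is all that \<open>measurableI\<close> tests. The operators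
  \<open>q (\<Union>Q)\<close> in the gliding hump rely on this.\<close>

lemma Union_pieces_measurable:
  assumes "Q \<subseteq> P" shows "\<Union>Q \<in> msets M"
proof (rule measurableI)
  show "\<Union>Q \<subseteq> X" using assms pieces_cover by blast
  fix A assume A: "A \<in> P"
  show "\<Union>Q \<inter> A \<in> msets M"
  proof (cases "A \<in> Q")
    case True
    then have "\<Union>Q \<inter> A = A" by blast
    then show ?thesis using piece(1)[OF A] by simp
  next
    case False
    then have "\<Union>Q \<inter> A = {}" using pieces_disjoint[OF _ A] assms by blast
    then show ?thesis by simp
  qed
qed

text \<open>A metric neighbourhood need not be measurable, so it is rounded up to whole pieces. The
  price is the extra \<open>r0\<close> in \<open>nbhdD\<close>.\<close>

definition nbhd :: "real \<Rightarrow> 'a set \<Rightarrow> 'a set" where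
  "nbhd r A = \<Union>{B \<in> P. \<exists>b\<in>B. \<exists>a\<in>A. d a b \<le> ennreal r}"

lemma nbhd_measurable: "nbhd r A \<in> msets M"
  unfolding nbhd_def by (rule Union_pieces_measurable) auto

lemma nbhdI:
  assumes "a \<in> A" "b \<in> X" "d a b \<le> ennreal r" shows "b \<in> nbhd r A"
proof -
  obtain B where "B \<in> P" "b \<in> B" using assms(2) pieces_cover by blast
  then show ?thesis using assms unfolding nbhd_def by blast
qed

lemma nbhdD:
  assumes "b \<in> nbhd r A" "A \<subseteq> X" "r \<ge> 0"
  obtains a where "a \<in> A" "d a b \<le> ennreal (r + r0)"
proof -
  obtain B b' a where B: "B \<in> P" "b \<in> B" "b' \<in> B" "a \<in> A" "d a b' \<le> ennreal r"
    using assms(1) unfolding nbhd_def by blast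
  have X: "a \<in> X" "b \<in> X" "b' \<in> X"
    using B assms(2) pieces_cover by auto
  have "d a b \<le> d a b' + d b' b" using dist_triangle X by blast
  also have "\<dots> \<le> ennreal r + ennreal r0"
    using B(5) piece(2)[OF B(1)] B(2,3) unfolding diam_le_def by (intro add_mono) auto
  finally show ?thesis using that B(4) r0 assms(3) by (simp flip: ennreal_plus)
qed

section \<open>Locality at a given distance and error\<close>

lemma separated_sym:
  "A \<subseteq> X \<Longrightarrow> A' \<subseteq> X \<Longrightarrow> separated d r A' A \<Longrightarrow> separated d r A A'"
  unfolding separated_def by (metis dist_sym subsetD)

lemma separated_mono:
  "separated d r' A' A \<Longrightarrow> r \<le> r' \<Longrightarrow> separated d r A' A"
  unfolding separated_def by (meson ennreal_leI le_less_trans)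

lemma separated_nbhd: "A \<subseteq> X \<Longrightarrow> separated d r (X - nbhd r A) A"
  unfolding separated_def by (metis DiffD1 DiffD2 dist_sym nbhdI not_le subsetD)

text \<open>One scale and one error of quasi-locality. Error 0 is propagation at most
  \<open>r\<close>, so a single calculus of sums, products and adjoints serves both
  algebras.\<close>

definition local_upto :: "real \<Rightarrow> real \<Rightarrow> ('h \<Rightarrow>\<^sub>L 'h) \<Rightarrow> bool" where
  "local_upto e r t \<longleftrightarrow> (\<forall>A\<in>msets M. \<forall>A'\<in>msets M.
     separated d r A' A \<longrightarrow> norm (\<iota> A' o\<^sub>L t o\<^sub>L \<iota> A) \<le> e)"

lemma propagation_le_iff: "propagation_le d M r t \<longleftrightarrow> local_upto 0 r t"
  unfolding propagation_le_def local_upto_def by simp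

lemma quasi_local_iff: "quasi_local d M t \<longleftrightarrow> (\<forall>e>0. \<exists>r\<ge>0. local_upto e r t)"
  unfolding quasi_local_def local_upto_def by simp

lemma local_upto_mono: "local_upto e r t \<Longrightarrow> e \<le> e' \<Longrightarrow> r \<le> r' \<Longrightarrow> local_upto e' r' t"
  unfolding local_upto_def by (meson separated_mono order_trans)

lemma local_upto_add:
  assumes "local_upto e r s" "local_upto e' r' t"
  shows "local_upto (e + e') (max r r') (s + t)"
  unfolding local_upto_def
proof (intro ballI impI)
  fix A A' assume A: "A \<in> msets M" "A' \<in> msets M" "separated d (max r r') A' A"
  have "norm (\<iota> A' o\<^sub>L s o\<^sub>L \<iota> A) \<le> e" "norm (\<iota> A' o\<^sub>L t o\<^sub>L \<iota> A) \<le> e'"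
    using assms A separated_mono[OF A(3)] unfolding local_upto_def by auto
  then show "norm (\<iota> A' o\<^sub>L (s + t) o\<^sub>L \<iota> A) \<le> e + e'"
    by (simp add: blinfun_compose_add_left blinfun_compose_add_right norm_triangle_mono)
qed

lemma local_upto_scaleC:
  "local_upto e r t \<Longrightarrow> local_upto (cmod c * e) r (scaleC_op c t)"
  unfolding local_upto_def
  by (simp add: scaleC_op_compose_left scaleC_op_compose_right ind_clinear norm_scaleC_op_eq mult_left_mono)

lemma local_upto_adj:
  assumes t: "clinear_op t" and "local_upto e r t"
  shows "local_upto e r (adj t)"
  unfolding local_upto_def
proof (intro ballI impI)
  fix A A' assume A: "A \<in> msets M" "A' \<in> msets M" "separated d r A' A"
  have "adj (\<iota> A o\<^sub>L t o\<^sub>L \<iota> A') = \<iota> A' o\<^sub>L adj t o\<^sub>L \<iota> A"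
    using A t by (simp add: adj_compose clinear_op_compose ind_clinear adj_ind blinfun_compose_assoc)
  then have "norm (\<iota> A' o\<^sub>L adj t o\<^sub>L \<iota> A) \<le> norm (\<iota> A o\<^sub>L t o\<^sub>L \<iota> A')"
    using A t by (metis norm_adj_le clinear_op_compose ind_clinear)
  also have "\<dots> \<le> e"
    using assms(2) A separated_sym[OF _ _ A(3)] measurable_subset unfolding local_upto_def by blast
  finally show "norm (\<iota> A' o\<^sub>L adj t o\<^sub>L \<iota> A) \<le> e" .
qed

lemma norm_compose_ind_le:
  assumes "A \<in> msets M" "A' \<in> msets M" shows "norm (\<iota> A' o\<^sub>L t o\<^sub>L \<iota> A) \<le> norm t"
proof -
  have "norm (\<iota> A' o\<^sub>L t o\<^sub>L \<iota> A) \<le> norm (\<iota> A') * norm t * norm (\<iota> A)"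
    by (meson mult_right_mono norm_blinfun_compose norm_ge_zero order_trans)
  also have "\<dots> \<le> 1 * norm t * 1"
    using assms norm_ind_le by (intro mult_mono) auto
  finally show ?thesis by simp
qed

text \<open>Between \<open>s\<close> and \<open>t\<close> insert the splitting of the identity given
  by \<open>D = nbhd r' A\<close>. From \<open>A\<close>, the operator \<open>t\<close> leaves
  \<open>D\<close> with norm at most \<open>e'\<close>, and \<open>D\<close> is still
  \<open>r\<close>-separated from \<open>A'\<close>; the summand \<open>r0\<close> pays for rounding
  \<open>D\<close> to whole pieces.\<close>

lemma local_upto_compose:
  assumes t: "t \<in> BO" and le: "local_upto e r s" "local_upto e' r' t" and r: "r \<ge> 0" "r' \<ge> 0"
  shows "local_upto (e * norm t + norm s * e') (r + (r' + r0)) (s o\<^sub>L t)"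
  unfolding local_upto_def
proof (intro ballI impI)
  fix A A' assume A: "A \<in> msets M" "A' \<in> msets M" and sep: "separated d (r + (r' + r0)) A' A"
  define D where "D = nbhd r' A"
  have D: "D \<in> msets M" "X - D \<in> msets M" using nbhd_measurable by (auto simp: D_def)
  have AX: "A \<subseteq> X" "A' \<subseteq> X" using A measurable_subset by auto
  have "separated d r A' D"
    unfolding separated_def
  proof (intro ballI)
    fix b a' assume b: "b \<in> D" "a' \<in> A'"
    obtain a where a: "a \<in> A" "d a b \<le> ennreal (r' + r0)"
      using nbhdD b(1) AX(1) r(2) unfolding D_def by blast
    have X: "a \<in> X" "b \<in> X" "a' \<in> X" using a b AX D measurable_subset by auto
    show "ennreal r < d a' b"
    proof (rule ccontr)
      assume "\<not> ennreal r < d a' b"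
      then have "d a' b + d b a \<le> ennreal r + ennreal (r' + r0)"
        using a(2) dist_sym X by (intro add_mono) auto
      then have "d a' a \<le> ennreal (r + (r' + r0))"
        using dist_triangle[OF X(3,2,1)] r r0 by (simp add: ennreal_plus[symmetric] del: ennreal_plus)
      then show False using sep a b unfolding separated_def by (meson leD)
    qed
  qed
  then have 1: "norm (\<iota> A' o\<^sub>L s o\<^sub>L \<iota> D) \<le> e" using le(1) A D unfolding local_upto_def by blast
  have "separated d r' (X - D) A" using separated_nbhd[OF AX(1)] by (simp add: D_def)
  then have 2: "norm (\<iota> (X - D) o\<^sub>L t o\<^sub>L \<iota> A) \<le> e'" using le(2) A D unfolding local_upto_def by blast
  define u where "u = (\<iota> A' o\<^sub>L s o\<^sub>L \<iota> D) o\<^sub>L (t o\<^sub>L \<iota> A)"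
  define w where "w = (\<iota> A' o\<^sub>L s) o\<^sub>L (\<iota> (X - D) o\<^sub>L t o\<^sub>L \<iota> A)"
  have "\<iota> A' o\<^sub>L (s o\<^sub>L t) o\<^sub>L \<iota> A = u + w"
    unfolding u_def w_def blinfun_compose_assoc
    using arg_cong[OF BO_split[OF D(1) t], of "\<lambda>x. \<iota> A' o\<^sub>L (s o\<^sub>L (x o\<^sub>L \<iota> A))"]
    by (simp add: blinfun_compose_assoc blinfun_compose_add_right blinfun_compose_add_left)
  moreover have "norm u \<le> e * norm t"
  proof -
    have "norm u \<le> norm (\<iota> A' o\<^sub>L s o\<^sub>L \<iota> D) * norm (t o\<^sub>L \<iota> A)"
      unfolding u_def by (rule norm_blinfun_compose)
    also have "\<dots> \<le> e * (norm t * 1)"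
      using 1 order_trans[OF norm_blinfun_compose[of t "\<iota> A"] mult_left_mono[OF norm_ind_le[OF A(1)]]]
      by (intro mult_mono) (auto intro: order_trans[OF norm_ge_zero])
    finally show ?thesis by simp
  qed
  moreover have "norm w \<le> norm s * e'"
  proof -
    have "norm w \<le> norm (\<iota> A' o\<^sub>L s) * norm (\<iota> (X - D) o\<^sub>L t o\<^sub>L \<iota> A)"
      unfolding w_def by (rule norm_blinfun_compose)
    also have "\<dots> \<le> (1 * norm s) * e'"
      using 2 order_trans[OF norm_blinfun_compose[of "\<iota> A'" s] mult_right_mono[OF norm_ind_le[OF A(2)]]]
      by (intro mult_mono) auto
    finally show ?thesis by simp
  qed
  ultimately show "norm (\<iota> A' o\<^sub>L (s o\<^sub>L t) o\<^sub>L \<iota> A) \<le> e * norm t + norm s * e'"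
    by (simp add: norm_triangle_mono)
qed

section \<open>Operators of finite propagation\<close>

definition finite_propagation :: "('h \<Rightarrow>\<^sub>L 'h) set" where
  "finite_propagation = {t \<in> BO. \<exists>r\<ge>0. propagation_le d M r t}"

lemma finite_propagation_iff: "t \<in> finite_propagation \<longleftrightarrow> t \<in> BO \<and> (\<exists>r\<ge>0. local_upto 0 r t)"
  by (simp add: finite_propagation_def propagation_le_iff)

lemma finite_propagation_quasi_local: "t \<in> finite_propagation \<Longrightarrow> quasi_local d M t"
  unfolding finite_propagation_iff quasi_local_iff using local_upto_mono[OF _ less_imp_le order_refl] by meson

lemma finite_propagation_add:
  "s \<in> finite_propagation \<Longrightarrow> t \<in> finite_propagation \<Longrightarrow> s + t \<in> finite_propagation"
proof -
  assume "s \<in> finite_propagation" "t \<in> finite_propagation"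
  then obtain r r' where r: "r \<ge> 0" "local_upto 0 r s" "local_upto 0 r' t" "s \<in> BO" "t \<in> BO"
    unfolding finite_propagation_iff by blast
  then show ?thesis
    unfolding finite_propagation_iff using BO_add local_upto_add[OF r(2,3)]
    by (intro conjI exI[of _ "max r r'"]) auto
qed

lemma finite_propagation_scaleC: "t \<in> finite_propagation \<Longrightarrow> scaleC_op c t \<in> finite_propagation"
  unfolding finite_propagation_iff using BO_scaleC local_upto_scaleC[of 0 _ t c] by (metis mult_zero_right)

lemma finite_propagation_adj: "t \<in> finite_propagation \<Longrightarrow> adj t \<in> finite_propagation"
  unfolding finite_propagation_iff using BO_adj local_upto_adj BO_clinear by meson

lemma finite_propagation_compose:
  assumes "s \<in> finite_propagation" "t \<in> finite_propagation"
  shows "s o\<^sub>L t \<in> finite_propagation"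
proof -
  obtain r r' where "r \<ge> 0" "r' \<ge> 0" "local_upto 0 r s" "local_upto 0 r' t" "s \<in> BO" "t \<in> BO"
    using assms unfolding finite_propagation_iff by blast
  then show ?thesis
    unfolding finite_propagation_iff using local_upto_compose[of t 0 r s 0 r'] BO_compose r0
    by (intro conjI exI[of _ "r + (r' + r0)"]) auto
qed

lemma finite_propagation_ind: "A \<in> msets M \<Longrightarrow> \<iota> A \<in> finite_propagation"
  unfolding finite_propagation_iff
proof (intro conjI exI[of _ 0])
  assume A: "A \<in> msets M"
  show "local_upto 0 0 (\<iota> A)"
    unfolding local_upto_def
  proof (intro ballI impI)
    fix B B' assume B: "B \<in> msets M" "B' \<in> msets M" "separated d 0 B' B"
    have "B' \<inter> B = {}"
    proof (rule ccontr)
      assume "B' \<inter> B \<noteq> {}"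
      then obtain b where b: "b \<in> B" "b \<in> B'" by blast
      then have "d b b = 0" using B(1) measurable_subset dist_eq_0_iff by blast
      then show False using B(3) b unfolding separated_def by fastforce
    qed
    then have "B' \<inter> A \<inter> B = {}" by blast
    then show "norm (\<iota> B' o\<^sub>L \<iota> A o\<^sub>L \<iota> B) \<le> 0"
      using A B by (simp add: ind_Int Int)
  qed
qed (simp_all add: ind_BO)

text \<open>\<open>T\<close> is an arbitrary bounded operator: the locality comes from
  \<open>D\<close> and \<open>D'\<close> alone, since a set \<open>B\<close> on the source side must
  meet \<open>D\<close> and a set \<open>B'\<close> on the target side must meet \<open>D'\<close>
  for the compression to survive.\<close>

lemma finite_propagation_compress:
  assumes T: "T \<in> BO" and D: "D \<in> msets M" "D' \<in> msets M" and r: "r \<ge> 0"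
    and near: "\<And>x y. x \<in> D \<Longrightarrow> y \<in> D' \<Longrightarrow> d y x \<le> ennreal r"
  shows "\<iota> D' o\<^sub>L T o\<^sub>L \<iota> D \<in> finite_propagation"
  unfolding finite_propagation_iff
proof (intro conjI exI[of _ r])
  show "\<iota> D' o\<^sub>L T o\<^sub>L \<iota> D \<in> BO" using T D by (intro BO_compose ind_BO)
  show "local_upto 0 r (\<iota> D' o\<^sub>L T o\<^sub>L \<iota> D)"
    unfolding local_upto_def
  proof (intro ballI impI)
    fix B B' assume B: "B \<in> msets M" "B' \<in> msets M" "separated d r B' B"
    have "B' \<inter> D' = {} \<or> D \<inter> B = {}"
    proof (rule ccontr)
      assume "\<not> ?thesis"
      then obtain x y where "x \<in> D" "x \<in> B" "y \<in> D'" "y \<in> B'" by blast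
      then show False using near[of x y] B(3) unfolding separated_def by (meson leD)
    qed
    moreover have "\<iota> B' o\<^sub>L (\<iota> D' o\<^sub>L T o\<^sub>L \<iota> D) o\<^sub>L \<iota> B = \<iota> (B' \<inter> D') o\<^sub>L T o\<^sub>L \<iota> (D \<inter> B)"
      unfolding ind_Int[OF B(2) D(2), symmetric] ind_Int[OF D(1) B(1), symmetric] blinfun_compose_assoc ..
    ultimately show "norm (\<iota> B' o\<^sub>L (\<iota> D' o\<^sub>L T o\<^sub>L \<iota> D) o\<^sub>L \<iota> B) \<le> 0"
      by (elim disjE) simp_all
  qed
qed fact

lemma finite_propagation_rank1:
  assumes "D \<in> msets M" "D' \<in> msets M" "r \<ge> 0" "\<iota> D a = a" "\<iota> D' b = b"
    and near: "\<And>x y. x \<in> D \<Longrightarrow> y \<in> D' \<Longrightarrow> d y x \<le> ennreal r"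
  shows "rank1 b a \<in> finite_propagation"
proof -
  have "\<iota> D' o\<^sub>L rank1 b a o\<^sub>L \<iota> D = rank1 b a"
    using assms by (simp add: compose_rank1 rank1_compose ind_clinear adj_ind)
  moreover have "rank1 b a \<in> BO"
    using ind_range[OF assms(1), of a] ind_range[OF assms(2), of b] assms(4,5) by (intro BO_rank1) simp_all
  then have "\<iota> D' o\<^sub>L rank1 b a o\<^sub>L \<iota> D \<in> finite_propagation"
    by (rule finite_propagation_compress[OF _ assms(1-3) near])
  ultimately show ?thesis by simp
qed

lemma piece_near: "A \<in> P \<Longrightarrow> x \<in> A \<Longrightarrow> y \<in> A \<Longrightarrow> d y x \<le> ennreal r0"
  using piece(2) unfolding diam_le_def by blast

lemma closed_BO: "closed BO"
  unfolding closed_sequential_limits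
proof (intro allI impI)
  fix t l assume *: "(\<forall>n. t n \<in> BO) \<and> t \<longlonglongrightarrow> l"
  then have lim: "(\<lambda>n. t n v) \<longlonglongrightarrow> l v" for v
    by (intro tendsto_intros) auto
  show "l \<in> BO"
    unfolding bounded_operators_def clinear_op_def
  proof (intro CollectI conjI allI impI)
    fix c v
    have "(\<lambda>n. t n (c *\<^sub>C v)) \<longlonglongrightarrow> c *\<^sub>C l v"
      using bounded_linear.tendsto[OF bounded_linear_scaleC lim[of v], of c] *
      by (simp add: clinear_op_ext_scaleC BO_clinear)
    then show "l (c *\<^sub>C v) = c *\<^sub>C l v" using LIMSEQ_unique lim by blast
  next
    show "l v \<in> H" for v
      using closed_sequentially[OF closed_H _ lim[of v]] * BO_range by blast
  next
    fix v assume "\<forall>w\<in>H. cinner w v = 0"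
    then have "t n v = 0" for n using * BO_orthogonal by blast
    then show "l v = 0" using lim[of v] LIMSEQ_unique[of "\<lambda>n. t n v" 0 "l v"] by simp
  qed
qed

end

section \<open>The two Roe algebras as instances of one locale\<close>

lemma closure_image_subset:
  fixes S :: "'a::metric_space set"
  assumes "\<And>t. t \<in> S \<Longrightarrow> f t \<in> S" "t \<in> closure S"
    and "\<And>u. (\<And>n. u n \<in> S) \<Longrightarrow> u \<longlonglongrightarrow> t \<Longrightarrow> (\<lambda>n. f (u n)) \<longlonglongrightarrow> f t"
  shows "f t \<in> closure S"
proof -
  obtain u where "\<forall>n. u n \<in> S" "u \<longlonglongrightarrow> t" using assms(2) unfolding closure_sequential by blast
  then show ?thesis unfolding closure_sequential
    using assms(1,3) by (intro exI[of _ "\<lambda>n. f (u n)"]) auto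
qed

locale roe_algebra = discrete_coarse_space X d M P r0 s0
  for X :: "'a set" and d :: "'a \<Rightarrow> 'a \<Rightarrow> ennreal" and M :: "('a, 'h::complex_hilbert) coarse_module"
    and P r0 s0 +
  fixes R :: "('h \<Rightarrow>\<^sub>L 'h) set"
  assumes R_BO: "t \<in> R \<Longrightarrow> t \<in> BO"
    and R_quasi_local: "t \<in> R \<Longrightarrow> quasi_local d M t"
    and R_finite_propagation: "t \<in> finite_propagation \<Longrightarrow> t \<in> R"
    and R_add: "s \<in> R \<Longrightarrow> t \<in> R \<Longrightarrow> s + t \<in> R"
    and R_scaleC: "t \<in> R \<Longrightarrow> scaleC_op c t \<in> R"
    and R_compose: "s \<in> R \<Longrightarrow> t \<in> R \<Longrightarrow> s o\<^sub>L t \<in> R"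
    and R_adj: "t \<in> R \<Longrightarrow> adj t \<in> R"

context discrete_coarse_space
begin

lemma roe_algebra_ql: "roe_algebra X d M P r0 s0 (Roe_ql d M)"
proof unfold_locales
  fix s t c
  note [simp] = Roe_ql_def
  show "t \<in> Roe_ql d M \<Longrightarrow> t \<in> BO" "t \<in> Roe_ql d M \<Longrightarrow> quasi_local d M t" by auto
  show "t \<in> finite_propagation \<Longrightarrow> t \<in> Roe_ql d M"
    using finite_propagation_quasi_local by (auto simp: finite_propagation_def)
  show "t \<in> Roe_ql d M \<Longrightarrow> adj t \<in> Roe_ql d M"
    unfolding Roe_ql_def quasi_local_iff mem_Collect_eq using BO_adj local_upto_adj BO_clinear by meson
  {
    assume t: "t \<in> Roe_ql d M"
    have "quasi_local d M (scaleC_op c t)"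
      unfolding quasi_local_iff
    proof (intro allI impI)
      fix e :: real assume "e > 0"
      \<comment> \<open>Adding 1 avoids a division by zero for \<open>c = 0\<close>.\<close>
      then have "e / (cmod c + 1) > 0" by (simp add: add_nonneg_pos)
      then obtain r where r: "r \<ge> 0" "local_upto (e / (cmod c + 1)) r t"
        using t by (auto simp: quasi_local_iff)
      have "cmod c * (e / (cmod c + 1)) \<le> e"
        using \<open>e > 0\<close> mult_left_mono[of "cmod c / (cmod c + 1)" 1 e]
        by (simp add: add_nonneg_pos pos_divide_le_eq mult.commute)
      then have "local_upto e r (scaleC_op c t)"
        by (rule local_upto_mono[OF local_upto_scaleC[OF r(2)] _ order_refl])
      then show "\<exists>r\<ge>0. local_upto e r (scaleC_op c t)" using r(1) by blast
    qed
    then show "scaleC_op c t \<in> Roe_ql d M" using t BO_scaleC by (simp add: Roe_ql_def)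
  }
  assume st: "s \<in> Roe_ql d M" "t \<in> Roe_ql d M"
  have "quasi_local d M (s + t)"
    unfolding quasi_local_iff
  proof (intro allI impI)
    fix e :: real assume "e > 0"
    then have "e / 2 > 0" by simp
    then obtain r r' where r: "r \<ge> 0" "local_upto (e / 2) r s" "local_upto (e / 2) r' t"
      using st unfolding Roe_ql_def quasi_local_iff mem_Collect_eq by meson
    show "\<exists>r\<ge>0. local_upto e r (s + t)"
      using local_upto_add[OF r(2,3)] r(1) by (intro exI[of _ "max r r'"]) simp
  qed
  then show "s + t \<in> Roe_ql d M" using st BO_add by (simp add: Roe_ql_def)
  have "quasi_local d M (s o\<^sub>L t)"
    unfolding quasi_local_iff
  proof (intro allI impI)
    fix e :: real assume "e > 0"
    \<comment> \<open>Chosen so that the error \<open>\<delta> * norm t + norm s * \<delta>\<close>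
      of the product stays below \<open>e\<close>; the summand 1 covers
      \<open>s = t = 0\<close>.\<close>
    define \<delta> where "\<delta> = e / (norm s + norm t + 1)"
    have pos: "norm s + norm t + 1 > 0" by (simp add: add_nonneg_pos)
    then have "\<delta> > 0" using \<open>e > 0\<close> by (simp add: \<delta>_def)
    then obtain r r' where r: "r \<ge> 0" "r' \<ge> 0" "local_upto \<delta> r s" "local_upto \<delta> r' t"
      using st unfolding Roe_ql_def quasi_local_iff mem_Collect_eq by meson
    have "\<delta> * norm t + norm s * \<delta> \<le> e"
    proof -
      have "\<delta> * norm t + norm s * \<delta> \<le> \<delta> * (norm s + norm t + 1)"
        using \<open>\<delta> > 0\<close> by (simp add: algebra_simps)
      also have "\<dots> = e" using pos by (simp add: \<delta>_def)
      finally show ?thesis .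
    qed
    then have "local_upto e (r + (r' + r0)) (s o\<^sub>L t)"
      using st by (intro local_upto_mono[OF local_upto_compose[OF _ r(3,4,1,2)] _ order_refl])
        (simp_all add: Roe_ql_def)
    then show "\<exists>r\<ge>0. local_upto e r (s o\<^sub>L t)"
      using r r0 by (intro exI[of _ "r + (r' + r0)"]) simp
  qed
  then show "s o\<^sub>L t \<in> Roe_ql d M" using st BO_compose by (simp add: Roe_ql_def)
qed

lemma roe_algebra_cp: "roe_algebra X d M P r0 s0 (Roe_cp d M)"
proof unfold_locales
  have cp: "Roe_cp d M = closure finite_propagation"
    unfolding Roe_cp_def finite_propagation_def ..
  fix s t c
  have BO: "t \<in> BO" if "t \<in> Roe_cp d M" for t
  proof -
    have "closure finite_propagation \<subseteq> BO"
      using closed_BO by (intro closure_minimal) (auto simp: finite_propagation_def)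
    then show ?thesis using that cp by auto
  qed
  show "t \<in> Roe_cp d M \<Longrightarrow> t \<in> BO" by (rule BO)
  show "t \<in> finite_propagation \<Longrightarrow> t \<in> Roe_cp d M"
    unfolding cp using closure_subset by blast
  {
    assume t: "t \<in> Roe_cp d M"
    show "quasi_local d M t"
      unfolding quasi_local_iff
    proof (intro allI impI)
      fix e :: real assume "e > 0"
      then obtain s where s: "s \<in> finite_propagation" "norm (s - t) < e"
        using t unfolding cp closure_approachable dist_norm by blast
      then obtain r where r: "r \<ge> 0" "local_upto 0 r s" unfolding finite_propagation_iff by blast
      \<comment> \<open>The remainder \<open>t - s\<close> has norm below \<open>e\<close>, so it
        satisfies the bound at every distance; adding the finite propagation operator
        \<open>s\<close> back introduces no further error beyond distance \<open>r\<close>.\<close>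
      have "local_upto e r (t - s)"
        unfolding local_upto_def
        using norm_compose_ind_le[of _ _ "t - s"] s(2)
        by (metis less_imp_le norm_minus_commute order_trans)
      then have "local_upto (0 + e) (max r r) (s + (t - s))" by (rule local_upto_add[OF r(2)])
      then show "\<exists>r\<ge>0. local_upto e r t" using r(1) by auto
    qed
    show "scaleC_op c t \<in> Roe_cp d M"
      unfolding cp
    proof (rule closure_image_subset[where f = "scaleC_op c"])
      show "t \<in> closure finite_propagation" using t cp by simp
      fix u :: "nat \<Rightarrow> _" assume "u \<longlonglongrightarrow> t"
      then have "(\<lambda>n. cmod c * norm (u n - t)) \<longlonglongrightarrow> cmod c * 0"
        by (intro tendsto_mult tendsto_const) (simp add: LIM_zero_iff tendsto_norm_zero_iff)
      moreover have "norm (scaleC_op c (u n) - scaleC_op c t) = cmod c * norm (u n - t)" for n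
      proof -
        have "scaleC_op c (u n) - scaleC_op c t = scaleC_op c (u n - t)"
          by (rule blinfun_eqI) (simp add: scaleC_op.rep_eq blinfun.diff_left
              linear_diff[OF bounded_linear.linear[OF bounded_linear_scaleC]])
        then show ?thesis by (simp add: norm_scaleC_op_eq)
      qed
      ultimately show "(\<lambda>n. scaleC_op c (u n)) \<longlonglongrightarrow> scaleC_op c t"
        by (subst LIM_zero_iff[symmetric], subst tendsto_norm_zero_iff[symmetric]) simp
    qed (rule finite_propagation_scaleC)
    show "adj t \<in> Roe_cp d M"
      unfolding cp
    proof (rule closure_image_subset[where f = adj])
      show "t \<in> closure finite_propagation" using t cp by simp
      fix u :: "nat \<Rightarrow> _" assume u: "\<And>n. u n \<in> finite_propagation" "u \<longlonglongrightarrow> t"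
      have cl: "clinear_op (u n)" "clinear_op t" for n
        using u(1)[of n] BO[OF t] by (auto simp: finite_propagation_def intro: BO_clinear)
      have "(\<lambda>n. norm (u n - t)) \<longlonglongrightarrow> 0"
        using u(2) by (simp add: LIM_zero_iff tendsto_norm_zero_iff)
      moreover have "norm (adj (u n) - adj t) \<le> norm (u n - t)" for n
        using norm_adj_le[OF clinear_op_diff[OF cl]] adj_diff[OF cl] by simp
      ultimately have "(\<lambda>n. adj (u n) - adj t) \<longlonglongrightarrow> 0"
        using Lim_null_comparison[OF always_eventually, of "\<lambda>n. adj (u n) - adj t" "\<lambda>n. norm (u n - t)"]
        by simp
      then show "(\<lambda>n. adj (u n)) \<longlonglongrightarrow> adj t"
        by (rule LIM_zero_cancel)
    qed (rule finite_propagation_adj)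
  }
  assume st: "s \<in> Roe_cp d M" "t \<in> Roe_cp d M"
  obtain u where u: "\<forall>n. u n \<in> finite_propagation" "u \<longlonglongrightarrow> s"
    using st(1)[unfolded cp closure_sequential] by auto
  obtain w where w: "\<forall>n. w n \<in> finite_propagation" "w \<longlonglongrightarrow> t"
    using st(2)[unfolded cp closure_sequential] by auto
  show "s + t \<in> Roe_cp d M"
    unfolding cp closure_sequential
    by (rule exI[of _ "\<lambda>n. u n + w n"])
      (simp add: u(1) w(1) finite_propagation_add tendsto_add[OF u(2) w(2)])
  show "s o\<^sub>L t \<in> Roe_cp d M"
    unfolding cp closure_sequential
    by (rule exI[of _ "\<lambda>n. u n o\<^sub>L w n"])
      (simp add: u(1) w(1) finite_propagation_compose
        bounded_bilinear.tendsto[OF bounded_bilinear_blinfun_compose u(2) w(2)])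
qed

end

section \<open>A gliding hump\<close>

text \<open>A summable complex family is absolutely summable, so the sum over any \<open>B\<close>
  missing \<open>F\<close> is dominated by the absolute tail. That makes one \<open>F\<close> work
  for all \<open>B\<close> at once.\<close>

lemma infsum_tail_small:
  fixes m :: "'i \<Rightarrow> complex"
  assumes "m summable_on P" "e > 0"
  shows "\<exists>F. finite F \<and> F \<subseteq> P \<and> (\<forall>B\<subseteq>P. B \<inter> F = {} \<longrightarrow> cmod (infsum m B) \<le> e)"
proof -
  have abs: "(\<lambda>j. cmod (m j)) summable_on P"
    using assms(1) summable_on_iff_abs_summable_on_complex by blast
  obtain F where F: "finite F" "F \<subseteq> P"
    "dist (sum (\<lambda>j. cmod (m j)) F) (infsum (\<lambda>j. cmod (m j)) P) \<le> e"
    using infsum_finite_approximation[OF abs assms(2)] by blast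
  show ?thesis
  proof (intro exI conjI allI impI)
    show "finite F" "F \<subseteq> P" by fact+
    fix B assume B: "B \<subseteq> P" "B \<inter> F = {}"
    have absB: "(\<lambda>j. cmod (m j)) summable_on B" by (rule summable_on_subset_banach[OF abs B(1)])
    have "cmod (infsum m B) \<le> infsum (\<lambda>j. cmod (m j)) B"
      using absB by (intro norm_infsum_bound) simp
    also have "\<dots> = infsum (\<lambda>j. cmod (m j)) (B \<union> F) - sum (\<lambda>j. cmod (m j)) F"
      using infsum_Un_disjoint[OF absB summable_on_finite[OF F(1)] B(2)] F(1) by simp
    also have "infsum (\<lambda>j. cmod (m j)) (B \<union> F) \<le> infsum (\<lambda>j. cmod (m j)) P"
      using B F by (intro infsum_mono2 abs summable_on_subset_banach[OF abs]) auto
    finally show "cmod (infsum m B) \<le> e" using F(3) by (simp add: dist_real_def abs_if split: if_splits)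
  qed
qed

text \<open>A Schur-type property of \<open>l^1\<close>, tested on indicator functions only. If the
  sums over \<open>Q n\<close> stayed above \<open>e\<close>, nearly disjoint humps could be
  selected along a subsequence, and their union \<open>B\<close> would be one fixed set on which the
  sums do not tend to 0.\<close>

lemma schur_gliding_hump:
  fixes m :: "nat \<Rightarrow> 'i \<Rightarrow> complex"
  assumes summ: "\<And>n. m n summable_on P"
    and lim: "\<And>Q. Q \<subseteq> P \<Longrightarrow> (\<lambda>n. infsum (m n) Q) \<longlonglongrightarrow> 0"
    and Q: "\<And>n. finite (Q n)" "\<And>n. Q n \<subseteq> P"
    and e: "e > 0"
  shows "\<exists>n. cmod (sum (m n) (Q n)) \<le> e"
proof (rule ccontr)
  assume "\<nexists>n. cmod (sum (m n) (Q n)) \<le> e"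
  then have big: "cmod (sum (m n) (Q n)) > e" for n by (simp add: not_le)
  \<comment> \<open>A state is an index with a finite window. The next index makes all sums inside
    the old window small, which is possible because a finite window has finitely many subsets. The
    next window contains the new hump and almost all the mass of the new \<open>m\<close>.\<close>
  define good where "good x y \<longleftrightarrow> fst x < fst y \<and> snd x \<union> Q (fst y) \<subseteq> snd y \<and>
    (\<forall>G\<subseteq>snd x. cmod (sum (m (fst y)) G) \<le> e/8) \<and>
    (\<forall>B\<subseteq>P. B \<inter> snd y = {} \<longrightarrow> cmod (infsum (m (fst y)) B) \<le> e/8)" for x y :: "nat \<times> 'i set"
  have "\<exists>f. \<forall>k. (finite (snd (f k)) \<and> snd (f k) \<subseteq> P) \<and> good (f k) (f (Suc k))"
  proof (rule dependent_nat_choice)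
    show "\<exists>x :: nat \<times> 'i set. finite (snd x) \<and> snd x \<subseteq> P" by (intro exI[of _ "(0, {})"]) auto
    fix x :: "nat \<times> 'i set" and k :: nat
    assume x: "finite (snd x) \<and> snd x \<subseteq> P"
    have "(\<lambda>n. sum (m n) G) \<longlonglongrightarrow> 0" if "G \<in> Pow (snd x)" for G
    proof -
      have "G \<subseteq> P" "finite G" using that x by (auto intro: finite_subset)
      then show ?thesis using lim[of G] by simp
    qed
    then have "\<forall>G\<in>Pow (snd x). \<forall>\<^sub>F n in sequentially. cmod (sum (m n) G) < e/8"
    proof (intro ballI)
      fix G assume "G \<in> Pow (snd x)"
      then have "\<forall>\<^sub>F n in sequentially. dist (sum (m n) G) 0 < e/8"
        using \<open>\<And>G. G \<in> Pow (snd x) \<Longrightarrow> (\<lambda>n. sum (m n) G) \<longlonglongrightarrow> 0\<close> e by (intro tendstoD) auto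
      then show "\<forall>\<^sub>F n in sequentially. cmod (sum (m n) G) < e/8" by simp
    qed
    then have "\<forall>\<^sub>F n in sequentially. \<forall>G\<in>Pow (snd x). cmod (sum (m n) G) < e/8"
      using x by (intro eventually_ball_finite) simp_all
    then obtain n0 where n0: "\<And>n. n \<ge> n0 \<Longrightarrow> \<forall>G\<in>Pow (snd x). cmod (sum (m n) G) < e/8"
      unfolding eventually_sequentially by blast
    define n where "n = max n0 (Suc (fst x))"
    have "e/8 > 0" using e by simp
    from infsum_tail_small[OF summ[of n] this] obtain F where F: "finite F" "F \<subseteq> P"
      "\<forall>B\<subseteq>P. B \<inter> F = {} \<longrightarrow> cmod (infsum (m n) B) \<le> e/8"
      by (elim exE conjE)
    show "\<exists>y. (finite (snd y) \<and> snd y \<subseteq> P) \<and> good x y"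
    proof (intro exI conjI)
      show "finite (snd (n, F \<union> snd x \<union> Q n))" "snd (n, F \<union> snd x \<union> Q n) \<subseteq> P"
        using F x Q by auto
      show "good x (n, F \<union> snd x \<union> Q n)"
        unfolding good_def fst_conv snd_conv
      proof (intro conjI allI impI)
        show "fst x < n" by (simp add: n_def)
        show "snd x \<union> Q n \<subseteq> F \<union> snd x \<union> Q n" by blast
        show "cmod (sum (m n) G) \<le> e/8" if "G \<subseteq> snd x" for G
          using n0[of n] that by (simp add: n_def less_imp_le)
        show "cmod (infsum (m n) B) \<le> e/8" if "B \<subseteq> P" "B \<inter> (F \<union> snd x \<union> Q n) = {}" for B
        proof -
          have "B \<inter> F = {}" using that(2) by blast
          then show ?thesis by (rule F(3)[rule_format, OF that(1)])
        qed
      qed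
    qed
  qed
  then obtain f where f: "\<And>k. finite (snd (f k))" "\<And>k. snd (f k) \<subseteq> P" "\<And>k. good (f k) (f (Suc k))"
    by auto
  \<comment> \<open>The shift by one pairs the index with the window \<open>F k\<close> preceding
    its hump; the hump and most of the mass of \<open>m (n k)\<close> lie in
    \<open>F (Suc k)\<close>.\<close>
  define n where "n k = fst (f (Suc k))" for k
  define F where "F k = snd (f k)" for k
  have F: "finite (F k)" "F k \<subseteq> P" for k using f by (auto simp: F_def)
  have FQ: "F k \<subseteq> F (Suc k)" "Q (n k) \<subseteq> F (Suc k)" for k
    using f(3)[of k] by (auto simp: good_def F_def n_def)
  have small: "G \<subseteq> F k \<Longrightarrow> cmod (sum (m (n k)) G) \<le> e/8"
    and tail: "B \<subseteq> P \<Longrightarrow> B \<inter> F (Suc k) = {} \<Longrightarrow> cmod (infsum (m (n k)) B) \<le> e/8" for k G B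
    using f(3)[of k] by (auto simp: good_def F_def n_def)
  have n_mono: "strict_mono n"
    unfolding strict_mono_Suc_iff using f(3) by (simp add: good_def n_def)
  have F_mono: "i \<le> j \<Longrightarrow> F i \<subseteq> F j" for i j
    using lift_Suc_mono_le[of F, OF FQ(1)] .
  define B where "B = (\<Union>k. Q (n k) - F k)"
  have BP: "B \<subseteq> P" using Q by (auto simp: B_def)
  \<comment> \<open>Three errors of at most \<open>e/8\<close> are subtracted from \<open>e\<close>:
    the part of \<open>Q (n k)\<close> inside \<open>F k\<close>, the part of \<open>B\<close>
    inside \<open>F k\<close>, and the tail of \<open>B\<close> beyond \<open>F (Suc k)\<close>.
    More than \<open>e/2\<close> remains.\<close>
  have large: "cmod (infsum (m (n k)) B) \<ge> e/2" for k
  proof -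
    define K where "K = Q (n k) - F k"
    \<comment> \<open>Earlier humps lie inside \<open>F k\<close> and later ones avoid
      \<open>F (Suc k)\<close>, so between the two windows \<open>B\<close> consists of the hump
      \<open>K\<close> alone.\<close>
    have split: "B = (B \<inter> F k \<union> K) \<union> (B - F (Suc k))"
    proof -
      have "x \<in> F k" if x: "x \<in> B" "x \<in> F (Suc k)" "x \<notin> K" for x
      proof -
        obtain l where l: "x \<in> Q (n l)" "x \<notin> F l" using x(1) by (auto simp: B_def)
        have "l \<noteq> k" using x l by (auto simp: K_def)
        moreover have "\<not> l > k" using F_mono[of "Suc k" l] x l by auto
        ultimately have "Suc l \<le> k" by simp
        then show ?thesis using F_mono FQ(2)[of l] l by blast
      qed
      moreover have "K \<subseteq> B" "K \<subseteq> F (Suc k)" using FQ by (auto simp: B_def K_def)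
      ultimately show ?thesis by blast
    qed
    let ?m = "m (n k)"
    have fin: "finite (B \<inter> F k)" "finite K" using F Q by (auto simp: K_def)
    have summ': "?m summable_on A" if "A \<subseteq> P" for A
      by (rule summable_on_subset_banach[OF summ that])
    have "infsum ?m B = infsum ?m (B \<inter> F k \<union> K) + infsum ?m (B - F (Suc k))"
      using BP F(2)[of k] FQ[of k] Q(2)[of "n k"]
      by (subst split, intro infsum_Un_disjoint summ') (auto simp: K_def)
    also have "infsum ?m (B \<inter> F k \<union> K) = sum ?m (B \<inter> F k) + sum ?m K"
      using fin by (subst infsum_finite) (auto simp: K_def intro!: sum.union_disjoint)
    finally have eq: "infsum ?m B = sum ?m (B \<inter> F k) + sum ?m K + infsum ?m (B - F (Suc k))" .
    have "sum ?m (Q (n k)) = sum ?m (Q (n k) \<inter> F k) + sum ?m K"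
      unfolding K_def using sum.Int_Diff[OF Q(1)] .
    then have "cmod (sum ?m (Q (n k))) \<le> cmod (sum ?m (Q (n k) \<inter> F k)) + cmod (sum ?m K)"
      by (simp add: norm_triangle_ineq)
    then have K: "cmod (sum ?m K) \<ge> e - e/8"
      using big[of "n k"] small[of "Q (n k) \<inter> F k" k] by auto
    have "cmod (sum ?m K) \<le> cmod (infsum ?m B) + cmod (sum ?m (B \<inter> F k)) + cmod (infsum ?m (B - F (Suc k)))"
    proof -
      have K_eq: "sum ?m K = infsum ?m B - sum ?m (B \<inter> F k) - infsum ?m (B - F (Suc k))"
        using eq by simp
      show ?thesis
        unfolding K_eq using norm_triangle_ineq4[of "infsum ?m B - sum ?m (B \<inter> F k)" "infsum ?m (B - F (Suc k))"]
          norm_triangle_ineq4[of "infsum ?m B" "sum ?m (B \<inter> F k)"]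
        by linarith
    qed
    moreover have "cmod (infsum ?m (B - F (Suc k))) \<le> e/8" "cmod (sum ?m (B \<inter> F k)) \<le> e/8"
      using BP by (intro tail small; blast)+
    ultimately show ?thesis using K e by linarith
  qed
  have "(\<lambda>k. infsum (m (n k)) B) \<longlonglongrightarrow> 0"
    using LIMSEQ_subseq_LIMSEQ[OF lim[OF BP] n_mono] by (simp add: o_def)
  then obtain k where "cmod (infsum (m (n k)) B) < e/2"
    using e by (auto simp: tendsto_iff eventually_sequentially dest!: spec[of _ "e/2"])
  then show False using large[of k] by simp
qed

section \<open>Isomorphisms of Roe-like algebras\<close>

context discrete_coarse_space
begin

lemma ind_Union_finite: "finite G \<Longrightarrow> G \<subseteq> P \<Longrightarrow> \<iota> (\<Union>G) = (\<Sum>C\<in>G. \<iota> C)"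
proof (induction G rule: finite_induct)
  case (insert C G)
  have "C \<inter> B = {}" if "B \<in> G" for B
    using pieces_disjoint[of C B] insert.prems insert.hyps(2) that by auto
  then have "C \<inter> \<Union>G = {}" by blast
  then have "\<iota> (C \<union> \<Union>G) = \<iota> C + \<iota> (\<Union>G)"
    using insert.prems by (intro ind_Un piece Union_pieces_measurable) auto
  then show ?case using insert by simp
qed simp

lemma ind_Union_has_sum:
  assumes "v \<in> H" "Q \<subseteq> P" shows "((\<lambda>C. \<iota> C v) has_sum \<iota> (\<Union>Q) v) Q"
proof -
  have "((\<lambda>C. \<iota> (\<Union>Q) (\<iota> C v)) has_sum \<iota> (\<Union>Q) v) P"
    by (rule has_sum_bounded_linear[OF blinfun.bounded_linear_right piece_has_sum[OF assms(1)]])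
  moreover have "\<iota> (\<Union>Q) (\<iota> C v) = \<iota> C v" if "C \<in> Q" for C
  proof -
    have "\<Union>Q \<inter> C = C" using that by blast
    then show ?thesis using that assms(2) by (subst ind_apply_Int) (auto intro: piece Union_pieces_measurable)
  qed
  moreover have "\<iota> (\<Union>Q) (\<iota> C v) = 0" if "C \<in> P - Q" for C
  proof -
    have "\<Union>Q \<inter> C = {}" using that assms(2) pieces_disjoint[of _ C] by blast
    then show ?thesis using that assms(2) by (subst ind_apply_Int) (auto intro: piece Union_pieces_measurable)
  qed
  ultimately show ?thesis
    using assms(2) by (subst has_sum_cong_neutral[where T = P and g = "\<lambda>C. \<iota> (\<Union>Q) (\<iota> C v)"]) auto
qed

end

locale roe_isomorphism =
  X: roe_algebra X dX M PX rX sX R + Y: roe_algebra Y dY N PY rY sY S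
  for X :: "'a set" and dX and M :: "('a, 'h::complex_hilbert) coarse_module" and PX rX sX R
    and Y :: "'b set" and dY and N :: "('b, 'k::complex_hilbert) coarse_module" and PY rY sY S +
  fixes \<phi> :: "('h \<Rightarrow>\<^sub>L 'h) \<Rightarrow> ('k \<Rightarrow>\<^sub>L 'k)"
  assumes iso: "star_isomorphism R S \<phi>"
begin

lemma phi_bij: "bij_betw \<phi> R S"
  and phi_add: "s \<in> R \<Longrightarrow> t \<in> R \<Longrightarrow> \<phi> (s + t) = \<phi> s + \<phi> t"
  and phi_scaleC: "t \<in> R \<Longrightarrow> \<phi> (scaleC_op c t) = scaleC_op c (\<phi> t)"
  and phi_compose: "s \<in> R \<Longrightarrow> t \<in> R \<Longrightarrow> \<phi> (s o\<^sub>L t) = \<phi> s o\<^sub>L \<phi> t"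
  and phi_adj: "t \<in> R \<Longrightarrow> \<phi> (adj t) = adj (\<phi> t)"
  using iso unfolding star_isomorphism_def by auto

lemma phi_in: "t \<in> R \<Longrightarrow> \<phi> t \<in> S"
  using phi_bij bij_betwE by blast

lemma phi_inj: "s \<in> R \<Longrightarrow> t \<in> R \<Longrightarrow> \<phi> s = \<phi> t \<Longrightarrow> s = t"
  using phi_bij unfolding bij_betw_def inj_on_def by blast

definition "\<psi> = inv_into R \<phi>"

lemma psi_in: "s \<in> S \<Longrightarrow> \<psi> s \<in> R"
  unfolding \<psi>_def using phi_bij by (metis bij_betw_def inv_into_into)

lemma phi_psi: "s \<in> S \<Longrightarrow> \<phi> (\<psi> s) = s"
  unfolding \<psi>_def using phi_bij by (rule bij_betw_inv_into_right)

lemma psi_phi: "t \<in> R \<Longrightarrow> \<psi> (\<phi> t) = t"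
  unfolding \<psi>_def using phi_bij by (rule bij_betw_inv_into_left)

lemma phi_zero: "\<phi> 0 = 0"
proof -
  have "0 \<in> R" using X.R_finite_propagation[OF X.finite_propagation_ind[of "{}"]] by simp
  then show ?thesis using phi_scaleC[of 0 0] by simp
qed

lemma psi_iso: "star_isomorphism S R \<psi>"
  unfolding star_isomorphism_def
proof (intro conjI ballI allI)
  show "bij_betw \<psi> S R" unfolding \<psi>_def by (rule bij_betw_inv_into[OF phi_bij])
  fix s t c assume t: "t \<in> S"
  show "\<psi> (scaleC_op c t) = scaleC_op c (\<psi> t)"
    by (rule phi_inj) (simp_all add: t psi_in phi_psi phi_scaleC X.R_scaleC Y.R_scaleC)
  show "\<psi> (adj t) = adj (\<psi> t)"
    by (rule phi_inj) (simp_all add: t psi_in phi_psi phi_adj X.R_adj Y.R_adj)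
  assume s: "s \<in> S"
  show "\<psi> (s + t) = \<psi> s + \<psi> t"
    by (rule phi_inj) (simp_all add: s t psi_in phi_psi phi_add X.R_add Y.R_add)
  show "\<psi> (s o\<^sub>L t) = \<psi> s o\<^sub>L \<psi> t"
    by (rule phi_inj) (simp_all add: s t psi_in phi_psi phi_compose X.R_compose Y.R_compose)
qed

text \<open>Makes everything proved in this locale available with \<open>X\<close> and
  \<open>Y\<close> exchanged.\<close>

lemma roe_isomorphism_inverse: "roe_isomorphism Y dY N PY rY sY S X dX M PX rX sX R \<psi>"
  using psi_iso X.roe_algebra_axioms Y.roe_algebra_axioms
  by (intro roe_isomorphism.intro roe_isomorphism_axioms.intro)

text \<open>Stands for \<open>w = U v\<close> up to a phase, as if \<open>\<phi>\<close> were
  conjugation by a unitary \<open>U\<close>. Comparing rank-one projections instead of vectors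
  removes the phase.\<close>

definition linked :: "'h \<Rightarrow> 'k \<Rightarrow> bool" where
  "linked v w \<longleftrightarrow> norm v = 1 \<and> norm w = 1 \<and> rank1 v v \<in> R \<and> \<phi> (rank1 v v) = rank1 w w"

lemma linkedD:
  assumes "linked v w"
  shows "norm v = 1" "norm w = 1" "rank1 v v \<in> R" "rank1 w w \<in> S" "\<phi> (rank1 v v) = rank1 w w"
    "\<psi> (rank1 w w) = rank1 v v" "v \<in> hspace M" "w \<in> hspace N"
proof -
  show 1: "norm v = 1" "norm w = 1" "rank1 v v \<in> R" "\<phi> (rank1 v v) = rank1 w w"
    using assms unfolding linked_def by auto
  show 2: "rank1 w w \<in> S" "\<psi> (rank1 w w) = rank1 v v"
    using 1(3,4) phi_in psi_phi by metis+
  show "v \<in> hspace M" "w \<in> hspace N"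
    using X.BO_range[OF X.R_BO[OF 1(3)], of v] Y.BO_range[OF Y.R_BO[OF 2(1)], of w]
      rank1_self_apply[OF 1(1)] rank1_self_apply[OF 1(2)] by simp_all
qed

lemma R_clinear: "t \<in> R \<Longrightarrow> clinear_op t" and S_clinear: "s \<in> S \<Longrightarrow> clinear_op s"
  using X.BO_clinear X.R_BO Y.BO_clinear Y.R_BO by blast+

lemma rank1_sandwich:
  "clinear_op t \<Longrightarrow> rank1 v' v' o\<^sub>L t o\<^sub>L rank1 v v = scaleC_op (cinner v' (blinfun_apply t v)) (rank1 v' v)"
  by (simp add: blinfun_compose_assoc compose_rank1 rank1_compose_rank1)

text \<open>Sandwiching \<open>t\<close> between two copies of the projection onto \<open>v\<close>
  leaves that projection times the coefficient, and \<open>\<phi>\<close> preserves scalars.\<close>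

lemma linked_cinner:
  assumes vw: "linked v w" and t: "t \<in> R"
  shows "cinner v (t v) = cinner w (\<phi> t w)"
proof -
  note l = linkedD[OF vw]
  have "scaleC_op (cinner v (t v)) (rank1 w w) = \<phi> (rank1 v v o\<^sub>L t o\<^sub>L rank1 v v)"
    using l t by (simp add: rank1_sandwich R_clinear phi_scaleC)
  also have "\<dots> = rank1 w w o\<^sub>L \<phi> t o\<^sub>L rank1 w w"
    using l t by (simp add: phi_compose X.R_compose)
  also have "\<dots> = scaleC_op (cinner w (\<phi> t w)) (rank1 w w)"
    using t by (simp add: rank1_sandwich S_clinear phi_in)
  finally have "scaleC_op (cinner v (t v)) (rank1 w w) w = scaleC_op (cinner w (\<phi> t w)) (rank1 w w) w"
    by simp
  then have "(cinner v (t v) - cinner w (\<phi> t w)) *\<^sub>C w = 0"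
    by (simp add: scaleC_op.rep_eq rank1_self_apply l)
      (metis scaleC_add_left diff_add_cancel add_cancel_right_left)
  then have "cmod (cinner v (t v) - cinner w (\<phi> t w)) * norm w = 0"
    by (metis norm_scaleC norm_zero)
  then show ?thesis using l by simp
qed

text \<open>The elementary half of isometry. The compression \<open>t\<close> of \<open>s\<close>
  equals \<open>c\<close> times the partial isometry from \<open>v\<close> to \<open>v'\<close>, so
  \<open>adj t\<close> composed with \<open>t\<close> is the squared modulus of \<open>c\<close>
  times the projection onto \<open>v\<close>. Its image under \<open>\<phi>\<close> has a norm that
  can be read off from \<open>w\<close>. Working with \<open>t\<close> keeps the argument in
  \<open>R\<close> even when \<open>rank1 v' v\<close> is not in \<open>R\<close>.\<close>

lemma linked_norm_lower:
  assumes vw: "linked v w" "linked v' w'" and s: "s \<in> R"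
  shows "cmod (cinner v' (s v)) \<le> norm (\<phi> s)"
proof -
  note l = linkedD[OF vw(1)] and l' = linkedD[OF vw(2)]
  define c where "c = cinner v' (s v)"
  define t where "t = rank1 v' v' o\<^sub>L s o\<^sub>L rank1 v v"
  have t: "t \<in> R" using l l' s by (simp add: t_def X.R_compose)
  have teq: "t = scaleC_op c (rank1 v' v)"
    using s by (simp add: t_def c_def rank1_sandwich R_clinear)
  have "adj t = scaleC_op (cnj c) (rank1 v v')"
    unfolding teq by (rule adj_eqI)
      (simp add: scaleC_op.rep_eq rank1_apply cinner_scaleC_left cinner_scaleC_right cinner_commute[of v'])
  then have "adj t o\<^sub>L t = scaleC_op ((cmod c)\<^sup>2) (rank1 v v)"
    by (simp add: teq scaleC_op_compose_left scaleC_op_compose_right clinear_op_rank1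
        rank1_compose_rank1 scaleC_op_scaleC_op cinner_self l' mult_cnj_cmod mult.commute[of "cnj c"])
  then have "adj (\<phi> t) o\<^sub>L \<phi> t = scaleC_op ((cmod c)\<^sup>2) (rank1 w w)"
    using t l by (metis phi_adj phi_compose phi_scaleC X.R_adj)
  then have "(cmod c)\<^sup>2 = norm (adj (\<phi> t) o\<^sub>L \<phi> t)"
    using l by (simp add: norm_scaleC_op_eq norm_rank1_unit norm_power)
  also have "\<dots> \<le> norm (adj (\<phi> t)) * norm (\<phi> t)" by (rule norm_blinfun_compose)
  also have "\<dots> \<le> (norm (\<phi> t))\<^sup>2"
    using norm_adj_le[OF S_clinear[OF phi_in[OF t]]] by (simp add: power2_eq_square mult_right_mono)
  finally have "cmod c \<le> norm (\<phi> t)" by (auto intro: power2_le_imp_le)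
  also have "\<phi> t = rank1 w' w' o\<^sub>L \<phi> s o\<^sub>L rank1 w w"
    unfolding t_def using l l' s by (simp add: phi_compose X.R_compose)
  also have "norm \<dots> \<le> norm (rank1 w' w') * norm (\<phi> s) * norm (rank1 w w)"
    by (meson mult_right_mono norm_blinfun_compose norm_ge_zero order_trans)
  finally show ?thesis using l l' by (simp add: norm_rank1_unit c_def)
qed

text \<open>The image of a rank-one projection \<open>p\<close> is a projection \<open>e\<close> with \<open>e s e\<close> a multiple of \<open>e\<close> for
  all \<open>s\<close> in \<open>S\<close>; as \<open>S\<close> contains a rank-one operator not annihilated by \<open>e\<close>, the rank of \<open>e\<close> is one.\<close>

lemma linked_exists:
  assumes v: "norm v = 1" "rank1 v v \<in> R"
  obtains w where "linked v w"
proof -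
  define p where "p = rank1 v v"
  define e where "e = \<phi> p"
  have p: "p \<in> R" "p o\<^sub>L p = p" "adj p = p"
    using v by (simp_all add: p_def rank1_compose_rank1 cinner_self adj_rank1)
  have e: "e \<in> S" "e o\<^sub>L e = e" "adj e = e"
    using p phi_in phi_compose[of p p] phi_adj[of p] by (auto simp: e_def)
  have ecl: "clinear_op e" using e(1) S_clinear by blast
  have "p \<noteq> 0" using v rank1_self_apply[of v] by (auto simp: p_def)
  then have "e \<noteq> 0"
    using phi_inj[of p 0] p(1) phi_zero X.R_scaleC[OF p(1), of 0] by (auto simp: e_def)
  \<comment> \<open>The projections of the pieces sum strongly to the identity of
    \<open>hspace N\<close>, so a nonzero \<open>e\<close> cannot vanish on all of them.\<close>
  have "\<exists>C\<in>PY. \<exists>z. e (ind N C z) \<noteq> 0"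
  proof (rule ccontr)
    assume "\<not> ?thesis"
    then have 0: "e (ind N C z) = 0" if "C \<in> PY" for C z using that by blast
    have "e z = 0" for z
    proof -
      have "((\<lambda>C. e (ind N C (ind N Y z))) has_sum e (ind N Y z)) PY"
        by (intro has_sum_bounded_linear[OF blinfun.bounded_linear_right] Y.piece_has_sum Y.ind_range) simp
      then have "((\<lambda>C. 0) has_sum e (ind N Y z)) PY"
        by (rule has_sum_cong[THEN iffD1, rotated]) (simp add: 0)
      then have "e (ind N Y z) = 0" by (rule has_sum_unique) (simp add: has_sum_0)
      then show ?thesis using Y.ind_space_apply Y.R_BO[OF e(1)] by metis
    qed
    then show False using \<open>e \<noteq> 0\<close> by (auto intro!: blinfun_eqI)
  qed
  then obtain C u where C: "C \<in> PY" and u: "e u \<noteq> 0" "ind N C u = u"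
    using Y.ind_idem Y.piece by metis
  \<comment> \<open>As \<open>u\<close> lives in one piece, this operator has finite propagation and
    thus a preimage \<open>s\<close>. Computing \<open>\<phi> (p o\<^sub>L s o\<^sub>L p)\<close> in
    two ways exhibits a multiple of \<open>e\<close> as the rank-one operator of \<open>e u\<close>;
    applying both sides to \<open>e u\<close> identifies the factor.\<close>
  have "rank1 u u \<in> S"
    using C u Y.r0 Y.piece Y.piece_near
    by (intro Y.R_finite_propagation Y.finite_propagation_rank1[where D = C and D' = C and r = rY]) auto
  define s where "s = \<psi> (rank1 u u)"
  have s: "s \<in> R" "\<phi> s = rank1 u u"
    using \<open>rank1 u u \<in> S\<close> psi_in phi_psi by (auto simp: s_def)
  define c where "c = cinner v (s v)"
  have "\<phi> (p o\<^sub>L s o\<^sub>L p) = scaleC_op c e"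
    using s(1) p(1) by (simp add: p_def rank1_sandwich R_clinear phi_scaleC c_def e_def)
  moreover have "\<phi> (p o\<^sub>L s o\<^sub>L p) = rank1 (e u) (e u)"
    using s p(1) ecl e(3)
    by (simp add: phi_compose X.R_compose rank1_compose compose_rank1 flip: e_def)
  ultimately have eq: "rank1 (e u) (e u) = scaleC_op c e" by simp
  have "e (e u) = e u" using e(2) by (metis blinfun_apply_blinfun_compose)
  then have "(complex_of_real ((norm (e u))\<^sup>2) - c) *\<^sub>C e u = 0"
    using arg_cong[OF eq, of "\<lambda>t. blinfun_apply t (e u)"]
    by (simp add: rank1_apply cinner_self scaleC_op.rep_eq)
      (metis scaleC_add_left diff_add_cancel add_cancel_right_left)
  then have c: "c = complex_of_real ((norm (e u))\<^sup>2)"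
    using u(1) by (metis norm_scaleC norm_zero mult_eq_0_iff norm_eq_zero eq_iff_diff_eq_0)
  define w where "w = complex_of_real (inverse (norm (e u))) *\<^sub>C e u"
  have "rank1 w w = scaleC_op (complex_of_real ((inverse (norm (e u)))\<^sup>2) * c) e"
    unfolding w_def rank1_scaleC eq scaleC_op_scaleC_op by (simp add: power2_eq_square)
  also have "complex_of_real ((inverse (norm (e u)))\<^sup>2) * c = 1"
    using u(1) by (simp add: c power_inverse flip: of_real_power of_real_mult of_real_inverse)
  finally have "rank1 w w = e" by simp
  moreover have "norm w = 1" using u(1) by (simp add: w_def norm_scaleC norm_inverse)
  ultimately show ?thesis using v by (intro that[of w]) (simp add: linked_def e_def p_def)
qed

section \<open>The transported \<open>Y\<close>-module structure on \<open>hspace M\<close>\<close>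

definition q :: "'b set \<Rightarrow> 'h \<Rightarrow>\<^sub>L 'h" where "q C = \<psi> (ind N C)"

lemma ind_S: "C \<in> msets N \<Longrightarrow> ind N C \<in> S"
  by (intro Y.R_finite_propagation Y.finite_propagation_ind)

lemma q_R: "C \<in> msets N \<Longrightarrow> q C \<in> R"
  and phi_q: "C \<in> msets N \<Longrightarrow> \<phi> (q C) = ind N C"
  by (simp_all add: q_def ind_S psi_in phi_psi)

lemma q_eqI: "t \<in> R \<Longrightarrow> C \<in> msets N \<Longrightarrow> \<phi> t = ind N C \<Longrightarrow> q C = t"
  by (rule phi_inj) (auto simp: q_R phi_q)

lemma q_compose: "C \<in> msets N \<Longrightarrow> C' \<in> msets N \<Longrightarrow> q C o\<^sub>L q C' = q (C \<inter> C')"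
  by (rule q_eqI[symmetric]) (auto simp: q_R phi_q phi_compose X.R_compose Y.ind_Int)

lemma q_Un: "C \<in> msets N \<Longrightarrow> C' \<in> msets N \<Longrightarrow> C \<inter> C' = {} \<Longrightarrow> q (C \<union> C') = q C + q C'"
  by (rule q_eqI) (auto simp: q_R phi_q phi_add X.R_add Y.ind_Un)

lemma q_empty [simp]: "q {} = 0"
  using q_Un[of "{}" "{}"] by simp

lemma adj_q: "C \<in> msets N \<Longrightarrow> adj (q C) = q C"
  by (rule q_eqI[symmetric]) (auto simp: q_R phi_q phi_adj X.R_adj Y.adj_ind)

lemma q_projection: "C \<in> msets N \<Longrightarrow> is_projection (q C)"
  by (simp add: is_projection_def q_compose adj_q)

lemma q_clinear: "C \<in> msets N \<Longrightarrow> clinear_op (q C)"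
  by (rule R_clinear[OF q_R])

lemma q_orthogonal:
  assumes "C \<in> msets N" "C' \<in> msets N" "C \<inter> C' = {}"
  shows "cinner (q C v) (q C' v') = 0"
proof -
  have "cinner (q C v) (q C' v') = cinner v (q C (q C' v'))"
    using assms q_clinear q_projection by (simp add: projection_cinner)
  also have "q C (q C' v') = 0"
    using q_compose[OF assms(1,2)] assms(3) by (metis blinfun_apply_blinfun_compose q_empty blinfun.zero_left)
  finally show ?thesis by simp
qed

lemma q_Union_finite: "finite G \<Longrightarrow> G \<subseteq> PY \<Longrightarrow> q (\<Union>G) = (\<Sum>C\<in>G. q C)"
proof (induction G rule: finite_induct)
  case (insert C G)
  have "C \<inter> B = {}" if "B \<in> G" for B
    using Y.pieces_disjoint[of C B] insert.prems insert.hyps(2) that by auto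
  then have "C \<inter> \<Union>G = {}" by blast
  then have "q (C \<union> \<Union>G) = q C + q (\<Union>G)"
    using insert.prems by (intro q_Un Y.piece Y.Union_pieces_measurable) auto
  then show ?case using insert by simp
qed simp

text \<open>For a projection \<open>p\<close> the coefficient \<open>cinner v (p v)\<close> is the
  squared norm of \<open>p v\<close>, so \<open>linked_cinner\<close> carries the distribution of
  \<open>w\<close> over \<open>Y\<close> to \<open>v\<close>.\<close>

lemma norm_q_linked:
  assumes "linked v w" "C \<in> msets N" shows "norm (q C v) = norm (ind N C w)"
proof -
  have "complex_of_real ((norm (q C v))\<^sup>2) = complex_of_real ((norm (ind N C w))\<^sup>2)"
    using linked_cinner[OF assms(1) q_R[OF assms(2)]] assms(2)
      projection_cinner_self[OF q_clinear q_projection]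
      projection_cinner_self[OF Y.ind_clinear Y.ind_projection]
    by (simp add: phi_q)
  then have "(norm (q C v))\<^sup>2 = (norm (ind N C w))\<^sup>2" by (simp only: of_real_eq_iff)
  then show ?thesis by simp
qed

lemma norm_diff_q_linked:
  assumes "linked v w" "C \<in> msets N" shows "norm (v - q C v) = norm (w - ind N C w)"
proof -
  have "(norm (v - q C v))\<^sup>2 = (norm (w - ind N C w))\<^sup>2"
    using projection_pythagoras[OF q_clinear q_projection, OF assms(2) assms(2), of v]
      projection_pythagoras[OF Y.ind_clinear Y.ind_projection, OF assms(2) assms(2), of w]
      arg_cong[OF norm_q_linked[OF assms], of "\<lambda>x. x\<^sup>2"] linkedD(1,2)[OF assms(1)]
    unfolding linkedD(1)[OF assms(1)] linkedD(2)[OF assms(1)] by linarith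
  then show ?thesis by simp
qed

text \<open>\<open>\<psi>\<close> is not known to respect strongly convergent infinite sums. For a
  linked vector, however, each remainder of the sum over \<open>q C v\<close> has the same norm as
  the remainder of the convergent sum over \<open>ind N C w\<close>.\<close>

lemma q_has_sum:
  assumes vw: "linked v w" and Q: "Q \<subseteq> PY"
  shows "((\<lambda>C. q C v) has_sum q (\<Union>Q) v) Q"
proof -
  have w: "w \<in> hspace N" using linkedD[OF vw] by blast
  have eq: "dist (\<Sum>C\<in>G. q C v) (q (\<Union>Q) v) = dist (\<Sum>C\<in>G. ind N C w) (ind N (\<Union>Q) w)"
    if G: "finite G" "G \<subseteq> Q" for G
  proof -
    have m: "\<Union>G \<in> msets N" "\<Union>(Q - G) \<in> msets N" "G \<subseteq> PY"
      using G Q by (auto intro!: Y.Union_pieces_measurable)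
    have disj: "\<Union>G \<inter> \<Union>(Q - G) = {}" "\<Union>G \<union> \<Union>(Q - G) = \<Union>Q"
      using G Q Y.pieces_disjoint by blast+
    have "q (\<Union>Q) v - (\<Sum>C\<in>G. q C v) = q (\<Union>(Q - G)) v"
      using q_Un[OF m(1,2) disj(1)] disj(2) q_Union_finite[OF G(1) m(3)]
      by (simp add: blinfun.sum_left blinfun.add_left)
    moreover have "ind N (\<Union>Q) w - (\<Sum>C\<in>G. ind N C w) = ind N (\<Union>(Q - G)) w"
      using Y.ind_Un[OF m(1,2) disj(1)] disj(2) Y.ind_Union_finite[OF G(1) m(3)]
      by (simp add: blinfun.sum_left blinfun.add_left)
    ultimately show ?thesis
      using norm_q_linked[OF vw m(2)] by (metis dist_commute dist_norm)
  qed
  have "((\<lambda>C. ind N C w) has_sum ind N (\<Union>Q) w) Q" by (rule Y.ind_Union_has_sum[OF w Q])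
  then show ?thesis
    unfolding has_sum_def tendsto_iff eventually_finite_subsets_at_top using eq by metis
qed

lemma linked_piece:
  assumes "A \<in> PX" "norm v = 1" "ind M A v = v" obtains w where "linked v w"
proof (rule linked_exists[OF assms(2)])
  show "rank1 v v \<in> R"
    by (rule X.R_finite_propagation, rule X.finite_propagation_rank1[where D = A and D' = A and r = rX])
      (use assms X.r0 X.piece X.piece_near in auto)
qed

text \<open>Every single \<open>q (\<Union>Q)\<close> lies in \<open>R\<close>, hence is quasi-local; the gliding hump makes the
  estimate uniform over the finite sets \<open>Q\<close>.\<close>

lemma q_uniformly_quasi_local:
  assumes \<delta>: "\<delta> > 0"
  obtains r where "r \<ge> 0"
    "\<And>A A' Q v. A \<in> PX \<Longrightarrow> A' \<in> msets M \<Longrightarrow> separated dX r A' A \<Longrightarrow> finite Q \<Longrightarrow> Q \<subseteq> PY \<Longrightarrow>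
      norm v = 1 \<Longrightarrow> ind M A v = v \<Longrightarrow> norm (ind M A' (q (\<Union>Q) v)) \<le> \<delta>"
proof (rule ccontr)
  assume not_thesis: "\<not> thesis"
  have "\<exists>A A' Q v. A \<in> PX \<and> A' \<in> msets M \<and> separated dX (real n) A' A \<and> finite Q \<and> Q \<subseteq> PY \<and>
      norm v = 1 \<and> ind M A v = v \<and> norm (ind M A' (q (\<Union>Q) v)) > \<delta>" for n
  proof (rule ccontr)
    assume no: "\<not> ?thesis"
    have thesis
    proof (rule that[of "real n"])
      fix A A' Q v
      assume "A \<in> PX" "A' \<in> msets M" "separated dX (real n) A' A" "finite Q" "Q \<subseteq> PY"
        "norm v = 1" "ind M A v = v"
      then have "\<not> norm (ind M A' (q (\<Union>Q) v)) > \<delta>" using no by blast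
      then show "norm (ind M A' (q (\<Union>Q) v)) \<le> \<delta>" by simp
    qed simp
    then show False using not_thesis by contradiction
  qed
  then obtain A A' Q v where *: "\<And>n. A n \<in> PX" "\<And>n. A' n \<in> msets M"
    "\<And>n. separated dX (real n) (A' n) (A n)" "\<And>n. finite (Q n)" "\<And>n. Q n \<subseteq> PY"
    "\<And>n. norm (v n) = 1" "\<And>n. ind M (A n) (v n) = v n"
    "\<And>n. norm (ind M (A' n) (q (\<Union>(Q n)) (v n))) > \<delta>"
    by metis
  define z where "z n = ind M (A' n) (q (\<Union>(Q n)) (v n))" for n
  define a where "a n = complex_of_real (inverse (norm (z n))) *\<^sub>C z n" for n
  have z: "norm (z n) > 0" for n using order.strict_trans[OF \<delta> *(8)[of n]] by (simp only: z_def)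
  have a: "norm (a n) = 1" "ind M (A' n) (a n) = a n" for n
  proof -
    show "norm (a n) = 1" using z[of n] by (simp add: a_def norm_scaleC norm_inverse)
    have "ind M (A' n) (z n) = z n" unfolding z_def by (rule X.ind_idem[OF *(2)])
    then show "ind M (A' n) (a n) = a n"
      unfolding a_def clinear_op_ext_scaleC[OF X.ind_clinear[OF *(2)]] by simp
  qed
  \<comment> \<open>A complex measure on the set of pieces of \<open>Y\<close>. On a fixed
    \<open>Q'\<close> it tends to 0, because \<open>q (\<Union>Q')\<close> is one quasi-local
    operator and the supports drift apart; on \<open>Q n\<close> it equals
    \<open>norm (z n)\<close>, which exceeds \<open>\<delta>\<close>. The gliding hump forbids this
    combination.\<close>
  define m where "m n C = cinner (a n) (q C (v n))" for n C
  have hs: "(m n has_sum cinner (a n) (q (\<Union>Q') (v n))) Q'" if Q': "Q' \<subseteq> PY" for n Q'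
  proof -
    obtain w where w: "linked (v n) w" by (rule linked_piece[OF *(1,6,7)])
    show ?thesis
      unfolding m_def[abs_def] by (rule has_sum_bounded_linear[OF bounded_linear_cinner q_has_sum[OF w Q']])
  qed
  have "\<exists>n. cmod (sum (m n) (Q n)) \<le> \<delta>"
  proof (rule schur_gliding_hump[where P = PY])
    show "m n summable_on PY" for n using hs[of PY n] has_sum_imp_summable by blast
    fix Q' assume Q': "Q' \<subseteq> PY"
    have qR: "q (\<Union>Q') \<in> R" by (intro q_R Y.Union_pieces_measurable Q')
    show "(\<lambda>n. infsum (m n) Q') \<longlonglongrightarrow> 0"
    proof (rule LIMSEQ_I)
      fix e :: real assume "e > 0"
      then obtain r where r: "r \<ge> 0" "X.local_upto (e/2) r (q (\<Union>Q'))"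
        using X.R_quasi_local[OF qR] unfolding X.quasi_local_iff by (meson half_gt_zero)
      have "norm (infsum (m n) Q' - 0) < e" if n: "n \<ge> nat \<lceil>r\<rceil>" for n
      proof -
        have "separated dX r (A' n) (A n)"
          using X.separated_mono[OF *(3)[of n], of r] n by linarith
        then have le: "norm (ind M (A' n) o\<^sub>L q (\<Union>Q') o\<^sub>L ind M (A n)) \<le> e/2"
          using r(2) *(1,2) X.piece unfolding X.local_upto_def by blast
        have "infsum (m n) Q' = cinner (a n) (q (\<Union>Q') (v n))"
          using hs[OF Q'] by (rule infsumI)
        also have "\<dots> = cinner (ind M (A' n) (a n)) (q (\<Union>Q') (ind M (A n) (v n)))"
          by (simp add: a *(7))
        also have "\<dots> = cinner (a n) ((ind M (A' n) o\<^sub>L q (\<Union>Q') o\<^sub>L ind M (A n)) (v n))"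
          using *(2) by (simp add: X.ind_selfadjoint)
        finally have "cmod (infsum (m n) Q') \<le> norm (ind M (A' n) o\<^sub>L q (\<Union>Q') o\<^sub>L ind M (A n))"
          using Cauchy_Schwarz_cinner[of "a n" "(ind M (A' n) o\<^sub>L q (\<Union>Q') o\<^sub>L ind M (A n)) (v n)"]
            norm_blinfun[of "ind M (A' n) o\<^sub>L q (\<Union>Q') o\<^sub>L ind M (A n)" "v n"]
          by (simp add: a *(6))
        then show ?thesis using le \<open>e > 0\<close> by simp
      qed
      then show "\<exists>no. \<forall>n\<ge>no. norm (infsum (m n) Q' - 0) < e" by blast
    qed
  qed (rule *(4) *(5) \<delta>)+
  then obtain n where "cmod (sum (m n) (Q n)) \<le> \<delta>" by blast
  moreover have "sum (m n) (Q n) = norm (z n)"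
  proof -
    have "sum (m n) (Q n) = cinner (a n) (q (\<Union>(Q n)) (v n))"
      using *(4,5) by (simp add: m_def q_Union_finite blinfun.sum_left cinner_sum_right)
    also have "\<dots> = cinner (a n) (z n)"
      unfolding z_def using a(2)[of n] X.ind_selfadjoint[OF *(2)] by metis
    also have "\<dots> = norm (z n)"
      using z[of n] by (simp add: a_def cinner_scaleC_left cinner_self power2_eq_square)
    finally show ?thesis .
  qed
  ultimately show False using *(8)[of n] \<delta> unfolding z_def by simp
qed

end

section \<open>Concentration\<close>

context discrete_coarse_space
begin

lemma BO_orthogonal_sum:
  assumes "clinear_op T" "\<And>v. (\<lambda>k. cinner (a k) v *\<^sub>C b k) sums T v"
    and "\<And>k. a k \<in> H" "\<And>k. b k \<in> H"
  shows "T \<in> BO"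
  unfolding bounded_operators_def
proof (intro CollectI conjI allI impI)
  show "clinear_op T" by fact
  fix v
  have lim: "(\<lambda>n. \<Sum>k<n. cinner (a k) v *\<^sub>C b k) \<longlonglongrightarrow> T v" using assms(2)[of v] by (simp add: sums_def)
  have "(\<Sum>k<n. cinner (a k) v *\<^sub>C b k) \<in> H" for n
    by (induction n) (auto intro: H_add H_scaleC assms)
  then show "T v \<in> H" using closed_sequentially[OF closed_H _ lim] by blast
  assume "\<forall>w\<in>H. cinner w v = 0"
  then have "(\<lambda>k. cinner (a k) v *\<^sub>C b k) = (\<lambda>k. 0)" using assms(3) by auto
  then show "T v = 0" using assms(2)[of v] sums_unique2[OF _ sums_zero] by simp
qed

lemma ind_complement_antimono:
  assumes "D \<in> msets M" "D' \<in> msets M" "D \<subseteq> D'" "v \<in> H"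
  shows "norm (v - \<iota> D' v) \<le> norm (v - \<iota> D v)"
proof -
  have "\<iota> D' (\<iota> D v) = \<iota> D v"
    using assms by (simp add: ind_apply_Int Int_absorb1)
  then have "v - \<iota> D' v = \<iota> (X - D') (v - \<iota> D v)"
    using assms by (simp add: blinfun.diff_right ind_Diff_apply ind_range)
  then show ?thesis using ind_norm_le[OF compl_sets[OF assms(2)]] by metis
qed

end

context roe_isomorphism
begin

text \<open>Compressing the projection onto \<open>v\<close> by \<open>q C\<close> corresponds to
  compressing the one onto \<open>w\<close> by \<open>ind N C\<close>. By
  \<open>norm_q_linked\<close> the two cut vectors have equal norm, so one factor \<open>c\<close>
  normalizes both.\<close>

lemma linked_normalize:
  assumes vw: "linked v w" and C: "C \<in> msets N" and nz: "q C v \<noteq> 0"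
  defines "c \<equiv> complex_of_real (inverse (norm (q C v)))"
  shows "linked (c *\<^sub>C q C v) (c *\<^sub>C ind N C w)"
proof -
  note l = linkedD[OF vw]
  have n: "norm (ind N C w) = norm (q C v)" using norm_q_linked[OF vw C] by simp
  have R: "q C o\<^sub>L rank1 v v o\<^sub>L q C \<in> R" using l C by (simp add: X.R_compose q_R)
  have eq: "rank1 (c *\<^sub>C q C v) (c *\<^sub>C q C v) = scaleC_op (c * cnj c) (q C o\<^sub>L rank1 v v o\<^sub>L q C)"
    using C by (simp add: rank1_scaleC compose_rank1 rank1_compose q_clinear adj_q)
  have "\<phi> (q C o\<^sub>L rank1 v v o\<^sub>L q C) = ind N C o\<^sub>L rank1 w w o\<^sub>L ind N C"
    using l C by (simp add: phi_compose X.R_compose q_R phi_q)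
  then have "\<phi> (rank1 (c *\<^sub>C q C v) (c *\<^sub>C q C v)) = rank1 (c *\<^sub>C ind N C w) (c *\<^sub>C ind N C w)"
    unfolding eq using C R
    by (simp add: phi_scaleC rank1_scaleC compose_rank1 rank1_compose Y.ind_clinear Y.adj_ind)
  moreover have "rank1 (c *\<^sub>C q C v) (c *\<^sub>C q C v) \<in> R" unfolding eq using R by (rule X.R_scaleC)
  ultimately show ?thesis
    using nz n unfolding linked_def by (simp add: norm_scaleC c_def norm_inverse)
qed

text \<open>Averaging over signs: if \<open>1 - 1\<^sub>D\<close> is small on all \<open>q B v\<close>, it is small relative to
  \<open>norm (q C v)\<close> for at least one piece \<open>C\<close>, however small \<open>q C v\<close> is.\<close>

lemma concentrated_piece:
  assumes vw: "linked v w" and D: "D \<in> msets M" and e: "e > 0"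
    and small: "\<And>Q. finite Q \<Longrightarrow> Q \<subseteq> PY \<Longrightarrow> norm (ind M (X - D) (q (\<Union>Q) v)) \<le> e / 4"
  obtains C where "C \<in> PY" "q C v \<noteq> 0" "norm (ind M (X - D) (q C v)) \<le> e * norm (q C v)"
proof -
  have w: "w \<in> hspace N" "norm w = 1" using linkedD[OF vw] by auto
  \<comment> \<open>Finitely many pieces retain norm at least \<open>3/4\<close>, hence squared mass
    at least \<open>9/16\<close>. The parts outside \<open>D\<close> will have total squared mass at
    most \<open>e\<^sup>2 / 4\<close>, so they cannot exceed the ratio \<open>e\<close> on every
    piece.\<close>
  obtain J where J: "finite J" "J \<subseteq> PY" "dist (\<Sum>C\<in>J. ind N C w) w \<le> 1/4"
    using has_sum_finite_approximation[OF Y.piece_has_sum[OF w(1)], of "1/4"] by auto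
  have Jm: "\<Union>J \<in> msets N" by (rule Y.Union_pieces_measurable[OF J(2)])
  have "norm (q (\<Union>J) v) = norm (\<Sum>C\<in>J. ind N C w)"
    using norm_q_linked[OF vw Jm] Y.ind_Union_finite[OF J(1,2)] by (simp add: blinfun.sum_left)
  then have "norm (q (\<Union>J) v) \<ge> 3/4"
    using J(3) w(2) norm_triangle_ineq2[of w "\<Sum>C\<in>J. ind N C w"] by (simp add: dist_norm norm_minus_commute)
  then have half: "(norm (q (\<Union>J) v))\<^sup>2 \<ge> 9/16"
    using power_mono[of "3/4" "norm (q (\<Union>J) v)" 2] by (simp add: power_divide)
  have "inner (q C v) (q C' v) = 0" if "C \<in> J" "C' \<in> J" "C \<noteq> C'" for C C'
    using q_orthogonal[of C C' v v] that J(2) Y.piece Y.pieces_disjoint[of C C']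
    by (metis Re_cinner subsetD zero_complex.simps(1))
  then have "(norm (\<Sum>C\<in>J. q C v))\<^sup>2 = (\<Sum>C\<in>J. (norm (q C v))\<^sup>2)"
    by (intro norm_sum_Pythagorean J) (simp add: pairwise_def orthogonal_def)
  then have mass: "(\<Sum>C\<in>J. (norm (q C v))\<^sup>2) \<ge> 9/16"
    using half by (simp add: q_Union_finite[OF J(1,2)] blinfun.sum_left)
  define u where "u C = ind M (X - D) (q C v)" for C
  obtain G where G: "G \<subseteq> J" "(\<Sum>C\<in>J. (norm (u C))\<^sup>2) \<le> (norm ((\<Sum>C\<in>G. u C) - (\<Sum>C\<in>J - G. u C)))\<^sup>2"
    by (rule sum_norm_square_le_signed_sum[OF J(1)])
  have "norm (\<Sum>C\<in>Q. u C) \<le> e / 4" if "Q \<subseteq> J" for Q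
  proof -
    have Q: "finite Q" "Q \<subseteq> PY" using that J by (auto intro: finite_subset)
    have "(\<Sum>C\<in>Q. u C) = ind M (X - D) (q (\<Union>Q) v)"
      by (simp add: u_def q_Union_finite[OF Q] blinfun.sum_left blinfun.sum_right)
    then show ?thesis using small[OF Q] by simp
  qed
  \<comment> \<open>The positive and the negative half of the signed sum are sums over sets of
    pieces, so the assumption on all finite \<open>Q\<close> bounds each by
    \<open>e / 4\<close>.\<close>
  from this[OF G(1)] this[of "J - G"]
  have "norm (\<Sum>C\<in>G. u C) + norm (\<Sum>C\<in>J - G. u C) \<le> e / 2" by auto
  then have "norm ((\<Sum>C\<in>G. u C) - (\<Sum>C\<in>J - G. u C)) \<le> e / 2"
    by (rule order_trans[OF norm_triangle_ineq4])
  then have "(norm ((\<Sum>C\<in>G. u C) - (\<Sum>C\<in>J - G. u C)))\<^sup>2 \<le> (e / 2)\<^sup>2"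
    by (intro power_mono) auto
  then have total: "(\<Sum>C\<in>J. (norm (u C))\<^sup>2) \<le> e\<^sup>2 / 4" using G(2) by (simp add: power_divide)
  have "\<exists>C\<in>J. q C v \<noteq> 0 \<and> norm (u C) \<le> e * norm (q C v)"
  proof (rule ccontr)
    assume "\<not> ?thesis"
    then have no: "norm (u C) > e * norm (q C v)" if "C \<in> J" "q C v \<noteq> 0" for C
      using that by (meson not_le)
    have "e\<^sup>2 * (norm (q C v))\<^sup>2 \<le> (norm (u C))\<^sup>2" if "C \<in> J" for C
    proof (cases "q C v = 0")
      case False
      then have "(e * norm (q C v))\<^sup>2 \<le> (norm (u C))\<^sup>2"
        using no[OF that] e by (intro power_mono) auto
      then show ?thesis by (simp add: power_mult_distrib)
    qed simp
    then have "e\<^sup>2 * (\<Sum>C\<in>J. (norm (q C v))\<^sup>2) \<le> (\<Sum>C\<in>J. (norm (u C))\<^sup>2)"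
      unfolding sum_distrib_left by (rule sum_mono)
    moreover have "e\<^sup>2 * (9/16) \<le> e\<^sup>2 * (\<Sum>C\<in>J. (norm (q C v))\<^sup>2)"
      using mass by (intro mult_left_mono) auto
    moreover have "e\<^sup>2 > 0" using e by simp
    ultimately show False using total by linarith
  qed
  then show ?thesis using that J(2) unfolding u_def by blast
qed

text \<open>Both halves have the same form, so exchanging \<open>\<phi>\<close> and
  \<open>\<psi>\<close> merely transposes the relation. The vectors are normalized, which makes the
  error \<open>1/100\<close> a relative one.\<close>

definition witness :: "real \<Rightarrow> 'a \<Rightarrow> 'b \<Rightarrow> 'h \<Rightarrow> 'k \<Rightarrow> 'a set \<Rightarrow> 'b set \<Rightarrow> bool" where
  "witness K x y v w D C \<longleftrightarrow> linked v w \<and>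
     D \<in> msets M \<and> (\<forall>a\<in>D. dX x a \<le> ennreal K) \<and> norm (v - ind M D v) \<le> 1/100 \<and>
     C \<in> msets N \<and> (\<forall>c\<in>C. dY y c \<le> ennreal K) \<and> norm (w - ind N C w) \<le> 1/100"

definition related :: "real \<Rightarrow> 'a \<Rightarrow> 'b \<Rightarrow> bool" where
  "related K x y \<longleftrightarrow> x \<in> X \<and> y \<in> Y \<and> (\<exists>v w D C. witness K x y v w D C)"

lemma related_mono: "related K x y \<Longrightarrow> K \<le> K' \<Longrightarrow> related K' x y"
  unfolding related_def witness_def by (meson ennreal_leI order_trans)

text \<open>A unit vector in a piece near \<open>x\<close> is cut down to one well-chosen piece of
  \<open>Y\<close>, where its partner then lives exactly. The radius \<open>r\<close> is uniform
  over all pieces, so one \<open>K\<close> serves every \<open>x\<close>.\<close>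

lemma related_left_total: "\<exists>K\<ge>0. \<forall>x\<in>X. \<exists>y. related K x y"
proof -
  \<comment> \<open>\<open>concentrated_piece\<close> with error \<open>1/100\<close> asks for a
    quarter of it, \<open>1/400\<close>.\<close>
  obtain r where r: "r \<ge> 0"
    "\<And>A A' Q v. A \<in> PX \<Longrightarrow> A' \<in> msets M \<Longrightarrow> separated dX r A' A \<Longrightarrow> finite Q \<Longrightarrow> Q \<subseteq> PY \<Longrightarrow>
      norm v = 1 \<Longrightarrow> ind M A v = v \<Longrightarrow> norm (ind M A' (q (\<Union>Q) v)) \<le> 1/400"
    by (rule q_uniformly_quasi_local[of "1/400"]) auto
  \<comment> \<open>\<open>rY\<close> bounds the piece of \<open>Y\<close>. On the other side,
    \<open>sX\<close> leads from \<open>x\<close> to the piece \<open>A\<close>, and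
    \<open>r + rX\<close> from \<open>A\<close> to the points of its rounded neighbourhood.\<close>
  define K where "K = max rY (sX + (r + rX))"
  have nonneg: "0 \<le> rX" "0 \<le> sX" "0 \<le> rY" using X.r0 X.s0 Y.r0 by auto
  show ?thesis
  proof (intro exI[of _ K] conjI ballI)
    show "K \<ge> 0" using nonneg by (simp add: K_def)
    fix x assume x: "x \<in> X"
    obtain A where A: "A \<in> PX" "ind M A \<noteq> 0" "\<And>a. a \<in> A \<Longrightarrow> dX x a \<le> ennreal sX"
      using X.supported[OF x] by blast
    have Am: "A \<in> msets M" "A \<subseteq> X" using X.piece[OF A(1)] X.measurable_subset by auto
    obtain z where "ind M A z \<noteq> 0" using A(2) by (metis blinfun_eqI zero_blinfun.rep_eq)
    define v where "v = complex_of_real (inverse (norm (ind M A z))) *\<^sub>C ind M A z"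
    have v: "norm v = 1" "ind M A v = v"
      using \<open>ind M A z \<noteq> 0\<close> Am
      by (simp_all add: v_def norm_scaleC norm_inverse clinear_op_ext_scaleC[OF X.ind_clinear] X.ind_idem)
    obtain w where vw: "linked v w" by (rule linked_piece[OF A(1) v])
    define D where "D = X.nbhd r A"
    have D: "D \<in> msets M" "X - D \<in> msets M"
      using X.nbhd_measurable X.compl_sets by (auto simp: D_def)
    have "separated dX r (X - D) A" using X.separated_nbhd[OF Am(2)] by (simp add: D_def)
    then obtain C where C: "C \<in> PY" "q C v \<noteq> 0"
      "norm (ind M (X - D) (q C v)) \<le> 1/100 * norm (q C v)"
      using r(2)[OF A(1) D(2) _ _ _ v]
      by (elim concentrated_piece[OF vw D(1), of "1/100", rotated -1]) simp_all
    have Cm: "C \<in> msets N" by (rule Y.piece[OF C(1)])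
    define c where "c = complex_of_real (inverse (norm (q C v)))"
    have l: "linked (c *\<^sub>C q C v) (c *\<^sub>C ind N C w)"
      unfolding c_def by (rule linked_normalize[OF vw Cm C(2)])
    have "norm (c *\<^sub>C q C v - ind M D (c *\<^sub>C q C v)) = norm (ind M (X - D) (c *\<^sub>C q C v))"
      using X.ind_Diff_apply[OF D(1), of "c *\<^sub>C q C v"] linkedD(7)[OF l] by simp
    also have "\<dots> = cmod c * norm (ind M (X - D) (q C v))"
      using D by (simp add: clinear_op_ext_scaleC[OF X.ind_clinear] norm_scaleC)
    also have "\<dots> \<le> cmod c * (1/100 * norm (q C v))"
      using C(3) by (intro mult_left_mono) auto
    also have "\<dots> = 1/100" using C(2) by (simp add: c_def norm_inverse)
    finally have vD: "norm (c *\<^sub>C q C v - ind M D (c *\<^sub>C q C v)) \<le> 1/100" .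
    obtain y where y: "y \<in> C" using C(1) Y.piece_nonempty by (metis equals0I)
    have "dX x b \<le> ennreal K" if b: "b \<in> D" for b
    proof -
      obtain a where a: "a \<in> A" "dX a b \<le> ennreal (r + rX)"
        using X.nbhdD[OF b[unfolded D_def] Am(2) r(1)] by blast
      have "dX x b \<le> dX x a + dX a b"
        using X.dist_triangle x a(1) Am(2) b D(1) X.measurable_subset by blast
      also have "\<dots> \<le> ennreal sX + ennreal (r + rX)" using A(3)[OF a(1)] a(2) by (rule add_mono)
      also have "\<dots> \<le> ennreal K" using nonneg r(1) by (simp add: K_def flip: ennreal_plus)
      finally show ?thesis .
    qed
    moreover have "dY y c' \<le> ennreal K" if "c' \<in> C" for c'
      using Y.piece_near[OF C(1) that y] by (rule order_trans) (auto simp: K_def intro: ennreal_leI)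
    moreover have "ind N C (c *\<^sub>C ind N C w) = c *\<^sub>C ind N C w"
      using Cm by (simp add: clinear_op_ext_scaleC[OF Y.ind_clinear] Y.ind_idem)
    ultimately have "witness K x y (c *\<^sub>C q C v) (c *\<^sub>C ind N C w) D C"
      unfolding witness_def using l vD D Cm by auto
    moreover have "y \<in> Y" using y Cm Y.measurable_subset by blast
    ultimately show "\<exists>y. related K x y" unfolding related_def using x by blast
  qed
qed

section \<open>Related points at bounded distance\<close>

lemma witnessD:
  assumes "witness K x y v w D C"
  shows "linked v w" "D \<in> msets M" "C \<in> msets N" "\<And>a. a \<in> D \<Longrightarrow> dX x a \<le> ennreal K"
    "\<And>c. c \<in> C \<Longrightarrow> dY y c \<le> ennreal K" "norm (v - ind M D v) \<le> 1/100" "norm (v - q C v) \<le> 1/100"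
  using assms norm_diff_q_linked[of v w C] unfolding witness_def by auto

text \<open>The coefficient is bounded by the norm of
  \<open>ind N C' o\<^sub>L \<phi> T o\<^sub>L ind N C\<close> through
  \<open>linked_norm_lower\<close>. Were \<open>C\<close> and \<open>C'\<close> separated by
  \<open>r\<close>, that norm would be at most \<open>1/4\<close>; the two radii \<open>K\<close>
  then lead from \<open>C\<close> and \<open>C'\<close> to \<open>y\<close> and
  \<open>y'\<close>.\<close>

lemma dist_le_of_not_small:
  assumes w1: "witness K x y v w D C" and w2: "witness K x' y' v' w' D' C'"
    and xy: "y \<in> Y" "y' \<in> Y" "K \<ge> 0"
    and T: "T \<in> R" "Y.local_upto (1/4) r (\<phi> T)" "r \<ge> 0"
    and big: "cmod (cinner (q C' v') (T (q C v))) > 1/4"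
  shows "dY y y' \<le> ennreal (r + 2 * K)"
proof (rule ccontr)
  note w1 = witnessD[OF w1] and w2 = witnessD[OF w2]
  assume far: "\<not> ?thesis"
  have "separated dY r C' C"
    unfolding separated_def
  proof (intro ballI)
    fix c c' assume c: "c \<in> C" "c' \<in> C'"
    then have cY: "c \<in> Y" "c' \<in> Y" using w1(3) w2(3) Y.measurable_subset by auto
    show "ennreal r < dY c' c"
    proof (rule ccontr)
      assume "\<not> ennreal r < dY c' c"
      then have "dY c c' \<le> ennreal r" using Y.dist_sym cY by simp
      moreover have "dY c' y' \<le> ennreal K" using w2(5)[OF c(2)] Y.dist_sym cY xy by simp
      ultimately have "dY y c + (dY c c' + dY c' y') \<le> ennreal K + (ennreal r + ennreal K)"
        using w1(5)[OF c(1)] by (intro add_mono)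
      moreover have "dY y y' \<le> dY y c + (dY c c' + dY c' y')"
        using Y.dist_triangle[of y c y'] Y.dist_triangle[of c c' y'] cY xy
        by (meson add_left_mono order_trans)
      ultimately have "dY y y' \<le> ennreal (r + 2 * K)"
        using xy(3) T(3) by (simp add: ennreal_plus[symmetric] algebra_simps del: ennreal_plus)
      then show False using far by contradiction
    qed
  qed
  then have "norm (ind N C' o\<^sub>L \<phi> T o\<^sub>L ind N C) \<le> 1/4"
    using T(2) w1(3) w2(3) unfolding Y.local_upto_def by blast
  moreover have "\<phi> (q C' o\<^sub>L T o\<^sub>L q C) = ind N C' o\<^sub>L \<phi> T o\<^sub>L ind N C"
    using T(1) w1(3) w2(3) by (simp add: phi_compose X.R_compose q_R phi_q)
  moreover have "cmod (cinner v' ((q C' o\<^sub>L T o\<^sub>L q C) v)) \<le> norm (\<phi> (q C' o\<^sub>L T o\<^sub>L q C))"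
    by (rule linked_norm_lower[OF w1(1) w2(1)]) (use T(1) w1(3) w2(3) in \<open>simp add: X.R_compose q_R\<close>)
  moreover have "cinner v' ((q C' o\<^sub>L T o\<^sub>L q C) v) = cinner (q C' v') (T (q C v))"
    using w2(3) by (simp add: projection_cinner q_clinear q_projection)
  ultimately show False using big by simp
qed

lemma R_local_upto:
  assumes "T \<in> R" obtains r where "r \<ge> 0" "Y.local_upto (1/4) r (\<phi> T)"
  using Y.R_quasi_local[OF phi_in[OF assms]] unfolding Y.quasi_local_iff
  by (metis zero_less_divide_1_iff zero_less_numeral)

lemma cinner_perturb:
  fixes T :: "'h \<Rightarrow>\<^sub>L 'h"
  assumes "norm T \<le> 1" "norm a \<le> 1" "norm d' \<le> 1"
  shows "cmod (cinner d' (T d)) \<le> cmod (cinner a' (T a)) + norm (a' - d') + norm (a - d)"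
proof -
  have "cinner d' (T d) = cinner a' (T a) - (cinner (a' - d') (T a) + cinner d' (T (a - d)))"
    by (simp add: cinner_diff_left cinner_diff_right blinfun.diff_right)
  then have "cmod (cinner d' (T d)) \<le> cmod (cinner a' (T a)) +
      (cmod (cinner (a' - d') (T a)) + cmod (cinner d' (T (a - d))))"
    using norm_triangle_ineq4[of "cinner a' (T a)" "cinner (a' - d') (T a) + cinner d' (T (a - d))"]
      norm_triangle_ineq[of "cinner (a' - d') (T a)" "cinner d' (T (a - d))"] by simp
  moreover have "cmod (cinner (a' - d') (T a)) \<le> norm (a' - d')"
  proof -
    have "norm (T a) \<le> 1 * 1" using assms by (intro order_trans[OF norm_blinfun] mult_mono) auto
    then show ?thesis
      using Cauchy_Schwarz_cinner[of "a' - d'" "T a"] mult_left_mono[of "norm (T a)" 1 "norm (a' - d')"] by simp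
  qed
  moreover have "cmod (cinner d' (T (a - d))) \<le> norm (a - d)"
  proof -
    have "norm (T (a - d)) \<le> 1 * norm (a - d)"
      using assms by (intro order_trans[OF norm_blinfun] mult_right_mono) auto
    then show ?thesis
      using Cauchy_Schwarz_cinner[of d' "T (a - d)"] mult_mono[of "norm d'" 1 "norm (T (a - d))" "norm (a - d)"]
        assms(3) by simp
  qed
  ultimately show ?thesis by simp
qed

text \<open>\<open>q C\<close> and \<open>ind M D\<close> need not commute, but each moves
  \<open>v\<close> by at most \<open>1/100\<close>, so each almost fixes the image of the other; the
  constants add up such errors.\<close>

lemma witness_norms:
  assumes "witness K x y v w D C"
  shows "norm (q C v) \<le> 1" "norm (ind M D v) \<le> 1" "99/100 \<le> norm (q C v)" "99/100 \<le> norm (ind M D v)"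
    "norm (q C v - ind M D v) \<le> 2/100" "norm (q C v - ind M D (q C v)) \<le> 3/100"
    "norm (ind M D (q C v)) \<le> 1" "96/100 \<le> norm (ind M D (q C v))"
    "v \<in> hspace M" "q C v \<in> hspace M"
proof -
  note w = witnessD[OF assms]
  note l = linkedD[OF w(1)]
  show 1: "norm (q C v) \<le> 1" "norm (ind M D v) \<le> 1"
    using projection_norm_le[OF q_clinear[OF w(3)] q_projection[OF w(3)], of v] X.ind_norm_le[OF w(2), of v] l
    by auto
  show 2: "99/100 \<le> norm (q C v)" "99/100 \<le> norm (ind M D v)"
    using norm_triangle_ineq2[of v "q C v"] norm_triangle_ineq2[of v "ind M D v"] w l by auto
  show 3: "norm (q C v - ind M D v) \<le> 2/100"
    using norm_triangle_ineq4[of "v - ind M D v" "v - q C v"] w(6,7) by simp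
  have "norm (ind M D (v - q C v)) \<le> 1/100"
    using X.ind_norm_le[OF w(2), of "v - q C v"] w(7) by simp
  then show 4: "norm (q C v - ind M D (q C v)) \<le> 3/100"
    using norm_triangle_ineq[of "q C v - ind M D v" "ind M D (v - q C v)"] 3
    by (simp add: blinfun.diff_right)
  show "norm (ind M D (q C v)) \<le> 1" "96/100 \<le> norm (ind M D (q C v))"
    using X.ind_norm_le[OF w(2), of "q C v"] norm_triangle_ineq2[of "q C v" "ind M D (q C v)"] 1 2 4 by auto
  show "v \<in> hspace M" "q C v \<in> hspace M"
    using l X.BO_range[OF X.R_BO[OF q_R[OF w(3)]]] by auto
qed

text \<open>The fourth power of \<open>0.96\<close> is about \<open>0.849\<close>. After losing at
  most two perturbations of \<open>3/100\<close>, the coefficients remain well above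
  \<open>1/4\<close>.\<close>

lemma norm_square_product_large:
  fixes a b :: real
  assumes "96/100 \<le> a" "96/100 \<le> b" shows "84/100 < a\<^sup>2 * b\<^sup>2"
proof -
  have "(96/100)\<^sup>2 * (96/100)\<^sup>2 \<le> a\<^sup>2 * b\<^sup>2" using assms by (intro mult_mono power_mono) auto
  then show ?thesis by (simp add: power2_eq_square)
qed

text \<open>A single rank-one operator between the two witnesses, compressed to nearby sets, has
  finite propagation and a large coefficient. The resulting bound depends on the pair, so it yields
  finiteness only; this is what allows real-valued distances in the uniform argument that
  follows.\<close>

lemma related_dist_finite:
  assumes rel: "related K x y" "related K x' y'" and "K \<ge> 0" "dX x x' \<le> ennreal r" "r \<ge> 0"
  shows "dY y y' < \<infinity>"
proof -
  obtain v w D C where w: "witness K x y v w D C" using rel unfolding related_def by blast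
  obtain v' w' D' C' where w': "witness K x' y' v' w' D' C'" using rel unfolding related_def by blast
  note W = witnessD[OF w] witness_norms[OF w] and W' = witnessD[OF w'] witness_norms[OF w']
  have pts: "x \<in> X" "x' \<in> X" "y \<in> Y" "y' \<in> Y" using rel unfolding related_def by auto
  define a a' where "a = q C v" and "a' = q C' v'"
  define T where "T = ind M D' o\<^sub>L rank1 a' a o\<^sub>L ind M D"
  have "T \<in> X.finite_propagation"
    unfolding T_def
  proof (rule X.finite_propagation_compress[where r = "K + (r + K)"])
    show "rank1 a' a \<in> X.BO" using W W' by (intro X.BO_rank1) (auto simp: a_def a'_def)
    fix b b' assume b: "b \<in> D" "b' \<in> D'"
    then have bX: "b \<in> X" "b' \<in> X" using W(2) W'(2) X.measurable_subset by auto
    have "dX b' b \<le> dX b' x' + (dX x' x + dX x b)"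
      using X.dist_triangle[of b' x' b] X.dist_triangle[of x' x b] bX pts by (meson add_left_mono order_trans)
    also have "\<dots> \<le> ennreal K + (ennreal r + ennreal K)"
      using W(4)[OF b(1)] W'(4)[OF b(2)] assms(4) X.dist_sym bX pts by (intro add_mono) auto
    also have "\<dots> = ennreal (K + (r + K))"
      using assms by (simp add: ennreal_plus[symmetric] del: ennreal_plus)
    finally show "dX b' b \<le> ennreal (K + (r + K))" .
  qed (use W W' assms in auto)
  then have T: "T \<in> R" by (rule X.R_finite_propagation)
  have "cinner a' (T a) = cinner (ind M D' a') (cinner a (ind M D a) *\<^sub>C a')"
    using W'(2) by (simp add: T_def rank1_apply X.ind_selfadjoint)
  also have "\<dots> = cinner a (ind M D a) * cinner (ind M D' a') a'"
    by (simp add: cinner_scaleC_right)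
  also have "cinner (ind M D' a') a' = (norm (ind M D' a'))\<^sup>2"
    using X.ind_selfadjoint[OF W'(2)] projection_cinner_self[OF X.ind_clinear X.ind_projection] W'(2) by simp
  also have "cinner a (ind M D a) = (norm (ind M D a))\<^sup>2"
    using projection_cinner_self[OF X.ind_clinear X.ind_projection] W(2) by simp
  finally have "cmod (cinner a' (T a)) = (norm (ind M D a))\<^sup>2 * (norm (ind M D' a'))\<^sup>2"
    by (simp add: norm_mult norm_power)
  then have "cmod (cinner a' (T a)) > 1/4"
    using norm_square_product_large[of "norm (ind M D a)" "norm (ind M D' a')"] W W'
    by (simp add: a_def a'_def)
  moreover obtain s where "s \<ge> 0" "Y.local_upto (1/4) s (\<phi> T)" using R_local_upto[OF T] .
  ultimately have "dY y y' \<le> ennreal (s + 2 * K)"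
    using dist_le_of_not_small[OF w w' pts(3,4) assms(3) T] by (simp add: a_def a'_def)
  then show ?thesis using ennreal_less_top le_less_trans infinity_ennreal_def by metis
qed

lemma witness_enlarge:
  assumes "witness K x y v w D C" "D' \<in> msets M" "D \<subseteq> D'"
  shows "norm (v - ind M D' v) \<le> 1/100"
  using assms X.ind_complement_antimono[of D D' v] witness_norms(9)[OF assms(1)]
  unfolding witness_def by (meson order_trans)

text \<open>If the \<open>y\<close> related to a bounded set were unbounded, a sequence \<open>y k\<close> of them tending to
  infinity would have pairwise orthogonal vectors \<open>q (C k) (v k)\<close>, and the weighted shift along
  these, compressed to the bounded set, would be mapped to an operator which is not quasi-local.\<close>

lemma related_bounded_fibre:
  assumes K: "K \<ge> 0" and x0: "x0 \<in> X" and L: "L \<ge> 0"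
  obtains B where "B \<ge> 0"
    "\<And>x y x' y'. related K x y \<Longrightarrow> related K x' y' \<Longrightarrow> dX x0 x \<le> ennreal L \<Longrightarrow>
      dX x0 x' \<le> ennreal L \<Longrightarrow> dY y y' \<le> ennreal B"
proof (cases "\<exists>x y. related K x y \<and> dX x0 x \<le> ennreal L")
  case False
  then show ?thesis using that[of 0] by blast
next
  case True
  then obtain xs ys where xys: "related K xs ys" "dX x0 xs \<le> ennreal L" by blast
  define G where "G = {p. related K (fst p) (snd p) \<and> dX x0 (fst p) \<le> ennreal L}"
  \<comment> \<open>\<open>enn2real\<close> loses nothing on \<open>G\<close>: all these
    \<open>y\<close> lie at finite distance from \<open>ys\<close> by
    \<open>related_dist_finite\<close>.\<close>
  define g where "g p = enn2real (dY ys (snd p))" for p :: "'a \<times> 'b"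
  have G: "fst p \<in> X" "snd p \<in> Y" if "p \<in> G" for p
    using that by (auto simp: G_def related_def)
  have ysY: "ys \<in> Y" "xs \<in> X" using xys(1) by (auto simp: related_def)
  have g: "dY ys (snd p) = ennreal (g p)" "g p \<ge> 0" if p: "p \<in> G" for p
  proof -
    have "dX xs (fst p) \<le> dX xs x0 + dX x0 (fst p)"
      using X.dist_triangle ysY x0 G(1)[OF p] by blast
    also have "\<dots> \<le> ennreal L + ennreal L"
      using p xys(2) X.dist_sym ysY x0 by (intro add_mono) (auto simp: G_def)
    also have "\<dots> = ennreal (L + L)" using L by (simp add: ennreal_plus[symmetric] del: ennreal_plus)
    finally have "dY ys (snd p) < \<infinity>"
      using related_dist_finite[OF xys(1) _ K, of "fst p" "snd p" "L + L"] p L by (auto simp: G_def)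
    then show "dY ys (snd p) = ennreal (g p)" "g p \<ge> 0" by (auto simp: g_def)
  qed
  have "\<exists>B. \<forall>p\<in>G. g p \<le> B"
  proof (rule ccontr)
    assume "\<not> ?thesis"
    then have unb: "\<exists>p\<in>G. g p > B" for B by (meson not_le)
    \<comment> \<open>The part \<open>2 * K\<close> of the gap makes the sets \<open>C k\<close>
      pairwise disjoint; the part \<open>real k\<close> makes consecutive distances
      unbounded.\<close>
    have "\<exists>f. \<forall>k. f k \<in> G \<and> g (f (Suc k)) > g (f k) + real k + 2 * K"
    proof (rule dependent_nat_choice[where P = "\<lambda>_ p. p \<in> G"
          and Q = "\<lambda>k p p'. g p' > g p + real k + 2 * K"])
      show "\<exists>p. p \<in> G" using unb by blast
      show "\<exists>p'. p' \<in> G \<and> g p + real k + 2 * K < g p'" for p k using unb by blast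
    qed
    then obtain f where f: "\<And>k. f k \<in> G" "\<And>k. g (f (Suc k)) > g (f k) + real k + 2 * K" by blast
    define x y where "x k = fst (f k)" and "y k = snd (f k)" for k
    have "\<exists>v w D C. witness K (x k) (y k) v w D C" for k
      using f(1)[of k] by (auto simp: G_def related_def x_def y_def)
    then obtain v w D C where W: "\<And>k. witness K (x k) (y k) (v k) (w k) (D k) (C k)" by metis
    have pts: "x k \<in> X" "y k \<in> Y" "dX x0 (x k) \<le> ennreal L" for k
      using G[OF f(1)[of k]] f(1)[of k] by (auto simp: G_def x_def y_def)
    have mono: "i \<le> j \<Longrightarrow> g (f i) \<le> g (f j)" for i j
    proof (rule lift_Suc_mono_le[of "\<lambda>k. g (f k)"])
      show "g (f n) \<le> g (f (Suc n))" for n using f(2)[of n] K by simp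
    qed
    have far: "dY (y i) (y j) > ennreal (real i + 2 * K)" if "i < j" for i j
    proof (rule ccontr)
      assume "\<not> ?thesis"
      then have "dY ys (y i) + dY (y i) (y j) \<le> ennreal (g (f i)) + ennreal (real i + 2 * K)"
        using g(1)[OF f(1)[of i]] by (intro add_mono) (auto simp: y_def)
      moreover have "dY ys (y j) \<le> dY ys (y i) + dY (y i) (y j)"
        using Y.dist_triangle ysY pts by blast
      ultimately have "ennreal (g (f j)) \<le> ennreal (g (f i)) + ennreal (real i + 2 * K)"
        using g(1)[OF f(1)[of j]] by (simp add: y_def)
      then have "ennreal (g (f j)) \<le> ennreal (g (f i) + (real i + 2 * K))"
        using g(2)[OF f(1)[of i]] K by (subst ennreal_plus) auto
      then have "g (f j) \<le> g (f i) + (real i + 2 * K)"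
        using g(2)[OF f(1)[of i]] K by (subst (asm) ennreal_le_iff) auto
      moreover have "g (f (Suc i)) \<le> g (f j)" using mono that by simp
      ultimately show False using f(2)[of i] by linarith
    qed
    have "C i \<inter> C j = {}" if "i < j" for i j
    proof (rule ccontr)
      assume "C i \<inter> C j \<noteq> {}"
      then obtain c where c: "c \<in> C i" "c \<in> C j" by blast
      then have cY: "c \<in> Y" using witnessD(3)[OF W] Y.measurable_subset by blast
      have "dY (y i) (y j) \<le> dY (y i) c + dY c (y j)" using Y.dist_triangle pts cY by blast
      also have "\<dots> \<le> ennreal K + ennreal K"
        using witnessD(5)[OF W c(1)] witnessD(5)[OF W c(2)] Y.dist_sym[OF cY pts(2)] by (intro add_mono) auto
      also have "\<dots> \<le> ennreal (real i + 2 * K)"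
        using K by (subst ennreal_plus[symmetric]) (auto intro: ennreal_leI)
      finally show False using far[OF that] by (meson leD)
    qed
    then have disj: "C i \<inter> C j = {}" if "i \<noteq> j" for i j
      using that by (metis Int_commute linorder_neqE_nat)
    \<comment> \<open>The sets \<open>D k\<close> all crowd into one bounded set, so orthogonality
      has to come from \<open>Y\<close>: disjoint \<open>C k\<close> give orthogonal ranges of
      \<open>q (C k)\<close>.\<close>
    define a where "a k = q (C k) (v k)" for k
    have orth: "cinner (a i) (a j) = 0" if "i \<noteq> j" for i j
      unfolding a_def by (rule q_orthogonal[OF witnessD(3)[OF W] witnessD(3)[OF W] disj[OF that]])
    have a: "norm (a k) \<le> 1" "99/100 \<le> norm (a k)" "a k \<in> hspace M" for k
      using witness_norms[OF W[of k]] by (auto simp: a_def)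
    obtain T0 where T0: "clinear_op T0" "norm T0 \<le> 1" "\<And>u. (\<lambda>k. cinner (a k) u *\<^sub>C a (Suc k)) sums T0 u"
      by (rule orthogonal_rank1_sum[of a "\<lambda>k. a (Suc k)"]) (auto simp: orth a)
    \<comment> \<open>One bounded measurable set containing every \<open>D k\<close>. Compressing
      \<open>T0\<close> to \<open>E\<close> gives finite propagation and changes the relevant
      coefficients only slightly, because each \<open>a k\<close> almost lives in
      \<open>E\<close>.\<close>
    define E where "E = X.nbhd (L + K) {x0}"
    have E: "E \<in> msets M" unfolding E_def by (rule X.nbhd_measurable)
    have DE: "D k \<subseteq> E" for k
    proof
      fix b assume b: "b \<in> D k"
      then have bX: "b \<in> X" using witnessD(2)[OF W] X.measurable_subset by blast
      have "dX x0 b \<le> dX x0 (x k) + dX (x k) b" using X.dist_triangle x0 pts bX by blast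
      also have "\<dots> \<le> ennreal L + ennreal K" using pts(3) witnessD(4)[OF W b] by (rule add_mono)
      finally show "b \<in> E" unfolding E_def using L K bX by (intro X.nbhdI[of x0]) auto
    qed
    define T where "T = ind M E o\<^sub>L T0 o\<^sub>L ind M E"
    define \<rho> where "\<rho> = (L + K) + rX"
    have "T \<in> X.finite_propagation"
      unfolding T_def
    proof (rule X.finite_propagation_compress[OF _ E E, where r = "\<rho> + \<rho>"])
      show "T0 \<in> X.BO" by (rule X.BO_orthogonal_sum[OF T0(1,3)]) (auto simp: a)
      have \<rho>: "\<rho> \<ge> 0" using L K X.r0 by (simp add: \<rho>_def)
      then show "\<rho> + \<rho> \<ge> 0" by simp
      fix b b' assume b: "b \<in> E" "b' \<in> E"
      have near: "dX x0 z \<le> ennreal \<rho>" if "z \<in> E" for z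
        using X.nbhdD[OF that[unfolded E_def]] x0 L K unfolding \<rho>_def by auto
      have bX: "b \<in> X" "b' \<in> X" using b E X.measurable_subset by auto
      have "dX b' b \<le> dX b' x0 + dX x0 b" using X.dist_triangle bX x0 by blast
      also have "\<dots> \<le> ennreal \<rho> + ennreal \<rho>"
        using near[OF b(1)] near[OF b(2)] X.dist_sym[OF bX(2) x0] by (intro add_mono) auto
      finally show "dX b' b \<le> ennreal (\<rho> + \<rho>)" using \<rho> by (simp add: ennreal_plus[symmetric] del: ennreal_plus)
    qed
    then have T: "T \<in> R" by (rule X.R_finite_propagation)
    obtain s where s: "s \<ge> 0" "Y.local_upto (1/4) s (\<phi> T)" using R_local_upto[OF T] .
    have big: "cmod (cinner (a (Suc k)) (T (a k))) > 1/4" for k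
    proof -
      have close: "norm (ind M E (a i) - a i) \<le> 3/100" for i
      proof -
        have "norm (ind M E (a i - v i)) \<le> 1/100"
          using X.ind_norm_le[OF E, of "a i - v i"] witnessD(7)[OF W[of i]]
          by (simp add: a_def norm_minus_commute)
        moreover have "norm (ind M E (v i) - v i) \<le> 1/100"
          using witness_enlarge[OF W[of i] E DE] by (simp add: norm_minus_commute)
        moreover have "norm (v i - a i) \<le> 1/100" using witnessD(7)[OF W[of i]] by (simp add: a_def)
        ultimately show ?thesis
          using norm_triangle_ineq[of "ind M E (a i - v i)" "ind M E (v i) - a i"]
            norm_triangle_ineq[of "ind M E (v i) - v i" "v i - a i"]
          by (simp add: blinfun.diff_right)
      qed
      have "(\<lambda>j. cinner (a j) (a k) *\<^sub>C a (Suc j)) = (\<lambda>j. if j = k then cinner (a k) (a k) *\<^sub>C a (Suc k) else 0)"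
        by (auto simp: orth)
      then have "T0 (a k) = cinner (a k) (a k) *\<^sub>C a (Suc k)"
        using T0(3)[of "a k"] sums_unique2[OF _ sums_single[of k "\<lambda>j. cinner (a k) (a k) *\<^sub>C a (Suc k)"]] by metis
      then have "cmod (cinner (a (Suc k)) (T0 (a k))) = (norm (a k))\<^sup>2 * (norm (a (Suc k)))\<^sup>2"
        by (simp add: cinner_scaleC_right cinner_self norm_mult norm_power)
      moreover have "84/100 < (norm (a k))\<^sup>2 * (norm (a (Suc k)))\<^sup>2"
        using a(2)[of k] a(2)[of "Suc k"] by (intro norm_square_product_large) auto
      moreover have "cmod (cinner (a (Suc k)) (T0 (a k))) \<le> cmod (cinner (ind M E (a (Suc k))) (T0 (ind M E (a k)))) +
          norm (ind M E (a (Suc k)) - a (Suc k)) + norm (ind M E (a k) - a k)"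
        using X.ind_norm_le[OF E, of "a k"] a(1)[of k] by (intro cinner_perturb T0 a) auto
      moreover have "cinner (ind M E (a (Suc k))) (T0 (ind M E (a k))) = cinner (a (Suc k)) (T (a k))"
        using E by (simp add: T_def X.ind_selfadjoint)
      ultimately show ?thesis using close[of k] close[of "Suc k"] by simp
    qed
    have le: "dY (y k) (y (Suc k)) \<le> ennreal (s + 2 * K)" for k
      by (rule dist_le_of_not_small[OF W W pts(2) pts(2) K T s(2,1)]) (use big[of k] in \<open>simp add: a_def\<close>)
    obtain k :: nat where "s < real k" using reals_Archimedean2 by blast
    then have "ennreal (s + 2 * K) \<le> ennreal (real k + 2 * K)" by (intro ennreal_leI) simp
    then show False using le[of k] far[of k "Suc k"] by (meson leD lessI order_trans)
  qed
  then obtain B where B: "\<And>p. p \<in> G \<Longrightarrow> g p \<le> B" by blast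
  have B0: "B \<ge> 0" using B[of "(xs, ys)"] g(2)[of "(xs, ys)"] xys by (auto simp: G_def)
  show ?thesis
  proof (rule that[of "B + B"])
    show "B + B \<ge> 0" using B0 by simp
    fix x y x' y'
    assume *: "related K x y" "related K x' y'" "dX x0 x \<le> ennreal L" "dX x0 x' \<le> ennreal L"
    then have p: "(x, y) \<in> G" "(x', y') \<in> G" by (auto simp: G_def)
    have yY: "y \<in> Y" "y' \<in> Y" using * by (auto simp: related_def)
    have "dY y y' \<le> dY y ys + dY ys y'" using Y.dist_triangle yY ysY by blast
    also have "\<dots> \<le> ennreal B + ennreal B"
      using g(1)[OF p(1)] g(1)[OF p(2)] B[OF p(1)] B[OF p(2)] Y.dist_sym[OF yY(1) ysY(1)]
      by (intro add_mono) (auto intro: ennreal_leI)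
    finally show "dY y y' \<le> ennreal (B + B)"
      using B0 by (simp add: ennreal_plus[symmetric] del: ennreal_plus)
  qed
qed

text \<open>Orthogonality comes from \<open>X\<close> here: the sets \<open>D k\<close> and
  \<open>D' k\<close> belonging to different \<open>k\<close> are disjoint, so the vectors are cut
  by these sets instead of by \<open>q\<close>. All transitions fit into one operator
  \<open>T\<close> of finite propagation, and the single radius of \<open>\<phi> T\<close> bounds
  every distance.\<close>

lemma related_far_apart:
  fixes x x' :: "nat \<Rightarrow> 'a" and y y' :: "nat \<Rightarrow> 'b"
  assumes K: "K \<ge> 0" and r: "r \<ge> 0"
    and rel: "\<And>k. related K (x k) (y k)" "\<And>k. related K (x' k) (y' k)"
    and near: "\<And>k. dX (x k) (x' k) \<le> ennreal r"
    and far: "\<And>i j. i < j \<Longrightarrow> dX (x i) (x j) > ennreal (2 * K + 2 * r)"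
  shows "\<exists>B. \<forall>k. dY (y k) (y' k) \<le> ennreal B"
proof -
  obtain v w D C where W: "\<And>k. witness K (x k) (y k) (v k) (w k) (D k) (C k)"
    using rel(1) unfolding related_def by metis
  obtain v' w' D' C' where W': "\<And>k. witness K (x' k) (y' k) (v' k) (w' k) (D' k) (C' k)"
    using rel(2) unfolding related_def by metis
  have pts: "x k \<in> X" "y k \<in> Y" "x' k \<in> X" "y' k \<in> Y" for k using rel unfolding related_def by auto
  have D: "D k \<in> msets M" "D' k \<in> msets M" for k using witnessD(2)[OF W] witnessD(2)[OF W'] by auto
  have DX: "b \<in> D k \<Longrightarrow> b \<in> X" "b \<in> D' k \<Longrightarrow> b \<in> X" for b k
    using D X.measurable_subset by blast+
  \<comment> \<open>Both sets of index \<open>k\<close> lie in the ball of radius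
    \<open>K + r\<close> about \<open>x k\<close>, so centres more than twice that apart give
    disjoint balls.\<close>
  have cover: "dX (x k) b \<le> ennreal (K + r)" if "b \<in> D k \<or> b \<in> D' k" for b k
    using that
  proof
    assume "b \<in> D k"
    then show ?thesis using witnessD(4)[OF W] r by (meson ennreal_leI le_add_same_cancel1 order_trans)
  next
    assume b: "b \<in> D' k"
    have "dX (x k) b \<le> dX (x k) (x' k) + dX (x' k) b" using X.dist_triangle pts DX b by blast
    also have "\<dots> \<le> ennreal r + ennreal K" using near witnessD(4)[OF W' b] by (rule add_mono)
    finally show ?thesis using K r by (simp add: add.commute)
  qed
  have no_common: "False" if b: "b \<in> D i \<or> b \<in> D' i" "b \<in> D j \<or> b \<in> D' j" and "i < j" for b i j
  proof -
    have bX: "b \<in> X" using b DX by blast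
    have "dX (x i) (x j) \<le> dX (x i) b + dX b (x j)" using X.dist_triangle pts bX by blast
    also have "\<dots> \<le> ennreal (K + r) + ennreal (K + r)"
      using cover[OF b(1)] cover[OF b(2)] X.dist_sym[OF bX pts(1)] by (intro add_mono) auto
    also have "\<dots> = ennreal (2 * K + 2 * r)"
      using K r by (simp add: ennreal_plus[symmetric] algebra_simps del: ennreal_plus)
    finally show False using far[OF that(3)] by (meson leD)
  qed
  have disj: "(D i \<union> D' i) \<inter> (D j \<union> D' j) = {}" if "i \<noteq> j" for i j
  proof (rule ccontr)
    assume "(D i \<union> D' i) \<inter> (D j \<union> D' j) \<noteq> {}"
    then obtain b where b: "b \<in> D i \<or> b \<in> D' i" "b \<in> D j \<or> b \<in> D' j" by blast
    show False using that no_common[OF b] no_common[OF b(2,1)] by (cases i j rule: linorder_cases) auto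
  qed
  define a b where "a k = ind M (D k) (v k)" and "b k = ind M (D' k) (v' k)" for k
  have orth: "cinner (a i) (a j) = 0" "cinner (b i) (b j) = 0" if "i \<noteq> j" for i j
  proof -
    have e: "D i \<inter> D j = {}" "D' i \<inter> D' j = {}" using disj[OF that] by auto
    show "cinner (a i) (a j) = 0" "cinner (b i) (b j) = 0"
      unfolding a_def b_def using D e by (simp_all add: X.ind_selfadjoint X.ind_apply_Int)
  qed
  have norms: "norm (a k) \<le> 1" "norm (b k) \<le> 1" "99/100 \<le> norm (a k)" "99/100 \<le> norm (b k)"
    "norm (q (C k) (v k) - a k) \<le> 2/100" "norm (q (C' k) (v' k) - b k) \<le> 2/100"
    "norm (q (C k) (v k)) \<le> 1" for k
    using witness_norms[OF W[of k]] witness_norms[OF W'[of k]] by (auto simp: a_def b_def)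
  obtain T where T: "clinear_op T" "norm T \<le> 1" "\<And>u. (\<lambda>k. cinner (a k) u *\<^sub>C b k) sums T u"
    by (rule orthogonal_rank1_sum[of a b]) (auto simp: orth norms)
  have "X.local_upto 0 ((K + r) + (K + r)) T"
    unfolding X.local_upto_def
  proof (intro ballI impI)
    fix A A' assume A: "A \<in> msets M" "A' \<in> msets M" "separated dX ((K + r) + (K + r)) A' A"
    have zero: "cinner (a k) (ind M A u) *\<^sub>C ind M A' (b k) = 0" for k u
    proof -
      have "A \<inter> D k = {} \<or> A' \<inter> D' k = {}"
      proof (rule ccontr)
        assume "\<not> ?thesis"
        then obtain z z' where z: "z \<in> A" "z \<in> D k" "z' \<in> A'" "z' \<in> D' k" by blast
        have "dX z' z \<le> dX z' (x k) + dX (x k) z" using X.dist_triangle pts DX z by blast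
        also have "\<dots> \<le> ennreal (K + r) + ennreal (K + r)"
          using cover[of z k] cover[of z' k] z X.dist_sym[OF DX(2)[OF z(4)] pts(1)[of k]]
          by (intro add_mono) auto
        also have "\<dots> = ennreal ((K + r) + (K + r))"
          using K r by (simp add: ennreal_plus[symmetric] del: ennreal_plus)
        finally show False using A(3) z unfolding separated_def by (meson leD)
      qed
      then show ?thesis
      proof
        assume "A \<inter> D k = {}"
        then have "ind M A (a k) = 0" using A D by (simp add: a_def X.ind_apply_Int)
        then have "cinner (a k) (ind M A u) = 0" using X.ind_selfadjoint[OF A(1), of "a k" u] by simp
        then show ?thesis by simp
      next
        assume "A' \<inter> D' k = {}"
        then show ?thesis using A D by (simp add: b_def X.ind_apply_Int)
      qed
    qed
    have "ind M A' (T (ind M A u)) = 0" for u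
    proof -
      have "(\<lambda>k. ind M A' (cinner (a k) (ind M A u) *\<^sub>C b k)) sums ind M A' (T (ind M A u))"
        by (rule bounded_linear.sums[OF blinfun.bounded_linear_right T(3)])
      then have "(\<lambda>k. 0) sums ind M A' (T (ind M A u))"
        using A(2) zero by (simp add: clinear_op_ext_scaleC[OF X.ind_clinear])
      then show ?thesis using sums_unique2 sums_zero by blast
    qed
    then have "ind M A' o\<^sub>L T o\<^sub>L ind M A = 0" by (intro blinfun_eqI) simp
    then show "norm (ind M A' o\<^sub>L T o\<^sub>L ind M A) \<le> 0" by simp
  qed
  moreover have "T \<in> X.BO"
    by (rule X.BO_orthogonal_sum[OF T(1,3)]) (auto simp: a_def b_def intro: X.ind_range D)
  ultimately have "T \<in> X.finite_propagation"
    unfolding X.finite_propagation_iff using K r by (intro conjI exI[of _ "(K + r) + (K + r)"]) auto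
  then have TR: "T \<in> R" by (rule X.R_finite_propagation)
  obtain s where s: "s \<ge> 0" "Y.local_upto (1/4) s (\<phi> T)" using R_local_upto[OF TR] .
  have "cmod (cinner (q (C' k) (v' k)) (T (q (C k) (v k)))) > 1/4" for k
  proof -
    have "(\<lambda>j. cinner (a j) (a k) *\<^sub>C b j) = (\<lambda>j. if j = k then cinner (a k) (a k) *\<^sub>C b k else 0)"
      by (auto simp: orth)
    then have "T (a k) = cinner (a k) (a k) *\<^sub>C b k"
      using T(3)[of "a k"] sums_unique2[OF _ sums_single[of k "\<lambda>j. cinner (a k) (a k) *\<^sub>C b k"]] by metis
    then have "cmod (cinner (b k) (T (a k))) = (norm (a k))\<^sup>2 * (norm (b k))\<^sup>2"
      by (simp add: cinner_scaleC_right cinner_self norm_mult norm_power)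
    moreover have "84/100 < (norm (a k))\<^sup>2 * (norm (b k))\<^sup>2"
      using norms(3,4)[of k] by (intro norm_square_product_large) auto
    moreover have "cmod (cinner (b k) (T (a k))) \<le> cmod (cinner (q (C' k) (v' k)) (T (q (C k) (v k)))) +
        norm (q (C' k) (v' k) - b k) + norm (q (C k) (v k) - a k)"
      by (rule cinner_perturb[OF T(2) norms(7,2)])
    ultimately show ?thesis using norms(5,6)[of k] by simp
  qed
  then have "dY (y k) (y' k) \<le> ennreal (s + 2 * K)" for k
    by (intro dist_le_of_not_small[OF W W' pts(2) pts(4) K TR s(2,1)])
  then show ?thesis by blast
qed

lemma related_controlled:
  assumes K: "K \<ge> 0" and r: "r \<ge> 0"
  obtains B where "B \<ge> 0"
    "\<And>x y x' y'. related K x y \<Longrightarrow> related K x' y' \<Longrightarrow> dX x x' \<le> ennreal r \<Longrightarrow> dY y y' \<le> ennreal B"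
proof -
  have "\<exists>n. \<forall>x y x' y'. related K x y \<longrightarrow> related K x' y' \<longrightarrow> dX x x' \<le> ennreal r \<longrightarrow>
      dY y y' \<le> ennreal (real n)"
  proof (rule ccontr)
    assume "\<not> ?thesis"
    then have "\<forall>n. \<exists>x y x' y'. related K x y \<and> related K x' y' \<and> dX x x' \<le> ennreal r \<and>
        dY y y' > ennreal (real n)"
      by (meson not_le)
    then obtain x y x' y' where *: "\<And>n. related K (x n) (y n)" "\<And>n. related K (x' n) (y' n)"
      "\<And>n. dX (x n) (x' n) \<le> ennreal r" "\<And>n. dY (y n) (y' n) > ennreal (real n)"
      by metis
    have pts: "x n \<in> X" "x' n \<in> X" for n using *(1,2) unfolding related_def by auto
    \<comment> \<open>The separation that \<open>related_far_apart\<close> requires.\<close>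
    define L where "L = 2 * K + 2 * r"
    have L: "L \<ge> 0" using K r by (simp add: L_def)
    \<comment> \<open>Infinitely many indices in one ball would put their pairs into the ball of
      radius \<open>L + r\<close>, the \<open>r\<close> allowing for \<open>x' n\<close>; there
      \<open>related_bounded_fibre\<close> bounds all distances in \<open>Y\<close>.\<close>
    have fin: "finite {n. dX (x m) (x n) \<le> ennreal L}" for m
    proof (rule ccontr)
      assume inf: "infinite {n. dX (x m) (x n) \<le> ennreal L}"
      obtain B where B: "B \<ge> 0"
        "\<And>z u z' u'. related K z u \<Longrightarrow> related K z' u' \<Longrightarrow> dX (x m) z \<le> ennreal (L + r) \<Longrightarrow>
          dX (x m) z' \<le> ennreal (L + r) \<Longrightarrow> dY u u' \<le> ennreal B"
        using related_bounded_fibre[OF K pts(1)[of m], of "L + r"] L r by (metis add_nonneg_nonneg)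
      obtain n where n: "n > nat \<lceil>B\<rceil>" "dX (x m) (x n) \<le> ennreal L"
        using inf unfolding infinite_nat_iff_unbounded by blast
      have "dX (x m) (x' n) \<le> dX (x m) (x n) + dX (x n) (x' n)" using X.dist_triangle pts by blast
      also have "\<dots> \<le> ennreal L + ennreal r" using n(2) *(3) by (rule add_mono)
      also have "\<dots> = ennreal (L + r)" using L r by simp
      finally have 2: "dX (x m) (x' n) \<le> ennreal (L + r)" .
      have 1: "dX (x m) (x n) \<le> ennreal (L + r)" using n(2) r by (meson ennreal_leI le_add_same_cancel1 order_trans)
      have "dY (y n) (y' n) \<le> ennreal B" by (rule B(2)[OF *(1,2) 1 2])
      also have "\<dots> \<le> ennreal (real n)" using n(1) by (intro ennreal_leI) linarith
      finally show False using *(4)[of n] by (meson leD)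
    qed
    \<comment> \<open>Separating all indices up to \<open>h k\<close> from all those beyond
      \<open>h (Suc k)\<close> turns a condition on consecutive choices into separation of every
      pair.\<close>
    have "\<exists>h. \<forall>k. True \<and> (h k < h (Suc k) \<and> (\<forall>j\<le>h k. \<forall>n\<ge>h (Suc k). dX (x j) (x n) > ennreal L))"
    proof (rule dependent_nat_choice[where P = "\<lambda>_ _. True"
          and Q = "\<lambda>_ i i'. i < i' \<and> (\<forall>j\<le>i. \<forall>n\<ge>i'. dX (x j) (x n) > ennreal L)"])
      fix i :: nat
      have "finite (\<Union>j\<le>i. {n. dX (x j) (x n) \<le> ennreal L})" using fin by auto
      then obtain N where N: "\<And>n j. j \<le> i \<Longrightarrow> dX (x j) (x n) \<le> ennreal L \<Longrightarrow> n < N"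
        unfolding finite_nat_iff_bounded by blast
      show "\<exists>i'. True \<and> i < i' \<and> (\<forall>j\<le>i. \<forall>n\<ge>i'. dX (x j) (x n) > ennreal L)"
      proof (intro exI[of _ "max N (Suc i)"] conjI allI impI)
        fix j n assume "j \<le> i" "max N (Suc i) \<le> n"
        then show "dX (x j) (x n) > ennreal L" using N[of j n] by (meson leD max.boundedE not_le)
      qed auto
    qed auto
    then obtain h where h: "\<And>k. h k < h (Suc k)"
      "\<And>k j n. j \<le> h k \<Longrightarrow> h (Suc k) \<le> n \<Longrightarrow> dX (x j) (x n) > ennreal L" by blast
    have hm: "strict_mono h" using h(1) by (simp add: strict_mono_Suc_iff)
    have "\<exists>B. \<forall>k. dY (y (h k)) (y' (h k)) \<le> ennreal B"
    proof (rule related_far_apart[OF K r *(1,2,3)[of "h _"]])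
      fix i j :: nat assume "i < j"
      then have "h (Suc i) \<le> h j" using strict_mono_less_eq[OF hm] by simp
      then show "dX (x (h i)) (x (h j)) > ennreal (2 * K + 2 * r)" using h(2)[of "h i" i "h j"] by (simp add: L_def)
    qed
    then obtain B where B: "\<And>k. dY (y (h k)) (y' (h k)) \<le> ennreal B" by blast
    obtain k :: nat where k: "B < real k" using reals_Archimedean2 by blast
    \<comment> \<open>The distance at index \<open>h k\<close> exceeds \<open>real (h k)\<close>, so
      a bound on the subsequence is contradicted as well.\<close>
    have "k \<le> h k" using strict_mono_imp_increasing[OF hm] .
    then have "ennreal B \<le> ennreal (real (h k))" using k by (intro ennreal_leI) linarith
    then show False using B[of k] *(4)[of "h k"] by (meson leD order_trans)
  qed
  then show ?thesis using that by (metis of_nat_0_le_iff)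
qed

text \<open>\<open>f\<close> and \<open>g\<close> choose related points with a common
  \<open>K\<close>. Both \<open>x\<close> and \<open>g (f x)\<close> are related to
  \<open>f x\<close>, so closeness to the identity is control of the opposite relation at distance
  0.\<close>

lemma roe_isomorphism_imp_coarsely_equivalent: "coarsely_equivalent X dX Y dY"
proof -
  interpret I: roe_isomorphism Y dY N PY rY sY S X dX M PX rX sX R \<psi>
    by (rule roe_isomorphism_inverse)
  have linked: "I.linked w v \<longleftrightarrow> linked v w" for v w
  proof
    assume "I.linked w v"
    note l = I.linkedD[OF this]
    have "\<phi> (rank1 v v) = rank1 w w" using phi_psi[OF l(3)] l(5) by simp
    then show "linked v w" using l unfolding linked_def by simp
  next
    assume "linked v w"
    from linkedD[OF this] show "I.linked w v" unfolding I.linked_def by simp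
  qed
  have related: "I.related K y x \<longleftrightarrow> related K x y" for K x y
    unfolding related_def I.related_def witness_def I.witness_def linked by blast
  obtain K1 where K1: "K1 \<ge> 0" "\<And>x. x \<in> X \<Longrightarrow> \<exists>y. related K1 x y" using related_left_total by blast
  obtain K2 where K2: "K2 \<ge> 0" "\<And>y. y \<in> Y \<Longrightarrow> \<exists>x. I.related K2 y x" using I.related_left_total by blast
  define K where "K = max K1 K2"
  have K: "K \<ge> 0" using K1(1) by (simp add: K_def)
  have "\<exists>y. related K x y" if "x \<in> X" for x
    using K1(2)[OF that] related_mono[of K1 _ _ K] by (auto simp: K_def)
  then obtain f where f: "\<And>x. x \<in> X \<Longrightarrow> related K x (f x)" by metis
  have "\<exists>x. related K x y" if "y \<in> Y" for y
    using K2(2)[OF that] related_mono[of K2 _ _ K] related by (auto simp: K_def)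
  then obtain g where g: "\<And>y. y \<in> Y \<Longrightarrow> related K (g y) y" by metis
  have fY: "f x \<in> Y" if "x \<in> X" for x using f[OF that] unfolding related_def by auto
  have gX: "g y \<in> X" if "y \<in> Y" for y using g[OF that] unfolding related_def by auto
  have "controlled X dX Y dY f"
    unfolding controlled_def
  proof (intro allI impI)
    fix r :: real assume "r \<ge> 0"
    from related_controlled[OF K this] obtain B where "B \<ge> 0"
      "\<And>x y x' y'. related K x y \<Longrightarrow> related K x' y' \<Longrightarrow> dX x x' \<le> ennreal r \<Longrightarrow> dY y y' \<le> ennreal B"
      by metis
    then show "\<exists>B\<ge>0. \<forall>x\<in>X. \<forall>x'\<in>X. dX x x' \<le> ennreal r \<longrightarrow> dY (f x) (f x') \<le> ennreal B"
      using f by blast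
  qed
  moreover have "controlled Y dY X dX g"
    unfolding controlled_def
  proof (intro allI impI)
    fix r :: real assume "r \<ge> 0"
    from I.related_controlled[OF K this] obtain B where "B \<ge> 0"
      "\<And>x y x' y'. related K x y \<Longrightarrow> related K x' y' \<Longrightarrow> dY y y' \<le> ennreal r \<Longrightarrow> dX x x' \<le> ennreal B"
      unfolding related by metis
    then show "\<exists>B\<ge>0. \<forall>y\<in>Y. \<forall>y'\<in>Y. dY y y' \<le> ennreal r \<longrightarrow> dX (g y) (g y') \<le> ennreal B"
      using g by blast
  qed
  moreover have "close_maps X dX (g \<circ> f) id"
  proof -
    obtain B where B:
      "\<And>x y x' y'. related K x y \<Longrightarrow> related K x' y' \<Longrightarrow> dY y y' \<le> ennreal 0 \<Longrightarrow> dX x x' \<le> ennreal B"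
      using I.related_controlled[OF K order_refl] unfolding related by metis
    have "dX (g (f x)) x \<le> ennreal B" if x: "x \<in> X" for x
      using B[OF g[OF fY[OF x]] f[OF x]] Y.dist_eq_0_iff[OF fY[OF x] fY[OF x]] by simp
    then have "(SUP x\<in>X. dX ((g \<circ> f) x) (id x)) \<le> ennreal B" by (intro SUP_least) simp
    then show ?thesis unfolding close_maps_def using ennreal_less_top le_less_trans infinity_ennreal_def by metis
  qed
  moreover have "close_maps Y dY (f \<circ> g) id"
  proof -
    obtain B where B:
      "\<And>x y x' y'. related K x y \<Longrightarrow> related K x' y' \<Longrightarrow> dX x x' \<le> ennreal 0 \<Longrightarrow> dY y y' \<le> ennreal B"
      using related_controlled[OF K order_refl] by metis
    have "dY (f (g y)) y \<le> ennreal B" if y: "y \<in> Y" for y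
      using B[OF f[OF gX[OF y]] g[OF y]] X.dist_eq_0_iff[OF gX[OF y] gX[OF y]] by simp
    then have "(SUP y\<in>Y. dY ((f \<circ> g) y) (id y)) \<le> ennreal B" by (intro SUP_least) simp
    then show ?thesis unfolding close_maps_def using ennreal_less_top le_less_trans infinity_ennreal_def by metis
  qed
  ultimately show ?thesis unfolding coarsely_equivalent_def using fY gX by blast
qed

end

section \<open>Ample discrete modules and the uniform module\<close>

text \<open>A set \<open>A\<close> of infinite rank has a nonzero projection. Its range decomposes
  along the partition, so some piece \<open>B\<close> has nonzero
  \<open>ind M (B \<inter> A)\<close>. That piece meets \<open>A\<close> and is within
  \<open>t + (r + r0)\<close> of \<open>x\<close>: first to \<open>A\<close>, then across
  \<open>A\<close>, then across \<open>B\<close>.\<close>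

lemma ample_discrete_coarse_space:
  fixes M :: "('a, 'h::complex_hilbert) coarse_module"
  assumes "extended_metric_space X d" "ample_module X d M" "discrete_module X d M"
  shows "\<exists>P r0 s0. discrete_coarse_space X d M P r0 s0"
proof -
  interpret extended_metric_space X d by fact
  have mod: "X_module X d M" using assms(3) unfolding discrete_module_def by blast
  then interpret algebra X "msets M" unfolding X_module_def by blast
  have ind_Int: "ind M A o\<^sub>L ind M A' = ind M (A \<inter> A')"
    and ind_Un: "A \<inter> A' = {} \<Longrightarrow> ind M (A \<union> A') = ind M A + ind M A'"
    and ind_H: "ind M A v \<in> hspace M" if "A \<in> msets M" "A' \<in> msets M" for A A' v
    using mod that unfolding X_module_def bounded_operators_def by auto
  have ind_empty: "ind M {} = 0" using ind_Un[of "{}" "{}"] by simp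
  obtain r0 P where rP: "r0 \<ge> 0" "partition_on X P" "\<forall>A\<in>P. A \<in> msets M \<and> diam_le d r0 A"
    "\<forall>v\<in>hspace M. ((\<lambda>A. ind M A v) has_sum v) P"
    "\<forall>C\<subseteq>X. (\<forall>A\<in>P. C \<inter> A \<in> msets M) \<longrightarrow> C \<in> msets M"
    using assms(3) unfolding discrete_module_def by (elim conjE exE)
  have P: "r0 \<ge> 0" "partition_on X P" "A \<in> P \<Longrightarrow> A \<in> msets M" "A \<in> P \<Longrightarrow> diam_le d r0 A"
    "v \<in> hspace M \<Longrightarrow> ((\<lambda>A. ind M A v) has_sum v) P"
    "C \<subseteq> X \<Longrightarrow> (\<And>A. A \<in> P \<Longrightarrow> C \<inter> A \<in> msets M) \<Longrightarrow> C \<in> msets M" for A v C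
    using rP(1-4) by simp_all (use rP(5) in simp)
  obtain r where r: "r \<ge> 0" "coarsely_dense X d (\<Union>{A\<in>msets M. diam_le d r A \<and> infinite_rank (ind M A)})"
    using assms(2) unfolding ample_module_def by blast
  then obtain s where s: "\<forall>x\<in>X. \<exists>y\<in>\<Union>{A\<in>msets M. diam_le d r A \<and> infinite_rank (ind M A)}. d x y \<le> ennreal s"
    unfolding coarsely_dense_def by (elim conjE exE)
  \<comment> \<open>The bound in \<open>coarsely_dense\<close> may be negative, where
    \<open>ennreal\<close> returns 0; the maximum lets radii be added.\<close>
  define t where "t = max 0 s"
  have "\<exists>B\<in>P. ind M B \<noteq> 0 \<and> (\<forall>b\<in>B. d x b \<le> ennreal (t + (r + r0)))" if x: "x \<in> X" for x
  proof -
    obtain y A where A: "A \<in> msets M" "diam_le d r A" "infinite_rank (ind M A)" "y \<in> A" "d x y \<le> ennreal s"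
      using bspec[OF s x] by blast
    have "ind M A \<noteq> 0"
    proof
      assume "ind M A = 0"
      interpret V: vector_space "scaleC :: complex \<Rightarrow> 'h \<Rightarrow> 'h" by (rule vector_space_scaleC)
      have "range (blinfun_apply (ind M A)) \<subseteq> cspan {}"
        using \<open>ind M A = 0\<close> V.span_zero by auto
      then show False using A(3) unfolding infinite_rank_def by blast
    qed
    then obtain v where v: "ind M A v \<noteq> 0" by (metis blinfun_eqI zero_blinfun.rep_eq)
    have "\<exists>B\<in>P. ind M B (ind M A v) \<noteq> 0"
    proof (rule ccontr)
      assume "\<not> ?thesis"
      then have "((\<lambda>B. ind M B (ind M A v)) has_sum 0) P" by (intro has_sum_0) auto
      then show False using has_sum_unique[OF P(5)[OF ind_H[OF A(1) A(1)], of v]] v by metis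
    qed
    then obtain B where B: "B \<in> P" "ind M B (ind M A v) \<noteq> 0" by blast
    then have "ind M (B \<inter> A) v \<noteq> 0"
      using ind_Int[OF P(3)[OF B(1)] A(1)] by (metis blinfun_apply_blinfun_compose)
    then have "B \<inter> A \<noteq> {}" using ind_empty by auto
    then obtain c where c: "c \<in> B" "c \<in> A" by blast
    have sub: "A \<subseteq> X" "B \<subseteq> X" using A(1) P(3)[OF B(1)] sets_into_space by auto
    have "d x b \<le> ennreal (t + (r + r0))" if b: "b \<in> B" for b
    proof -
      have X: "b \<in> X" "c \<in> X" "y \<in> X" using b c A sub by auto
      have "d x b \<le> d x y + (d y c + d c b)"
        using dist_triangle[of x y b] dist_triangle[of y c b] X x by (meson add_left_mono order_trans)
      also have "\<dots> \<le> ennreal t + (ennreal r + ennreal r0)"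
        using A(2,4,5) P(4)[OF B(1)] c b unfolding diam_le_def t_def
        by (intro add_mono) (auto intro: order_trans[OF _ ennreal_leI])
      also have "\<dots> = ennreal (t + (r + r0))"
        using P(1) r(1) by (simp add: t_def ennreal_plus[symmetric] del: ennreal_plus)
      finally show ?thesis .
    qed
    moreover have "ind M B \<noteq> 0" using B(2) by auto
    ultimately show ?thesis using B(1) by blast
  qed
  note supp = this
  have "t + (r + r0) \<ge> 0" using P(1) r(1) by (simp add: t_def)
  then have "discrete_coarse_space X d M P r0 (t + (r + r0))"
  proof unfold_locales
    show "C \<in> msets M" if "C \<subseteq> X" "\<And>A. A \<in> P \<Longrightarrow> C \<inter> A \<in> msets M" for C
      using rP(5) that by simp
  qed (use mod P(1-5) supp in \<open>simp_all\<close>)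
  then show ?thesis by blast
qed

section \<open>Square-summable functions as a discrete module\<close>

lemma mult_ind_apply [simp]: "ell2_apply (mult_ind A f) x = (if x \<in> A then ell2_apply f x else 0)"
  by (simp add: mult_ind.rep_eq)

lemma ell2_apply_scaleC [simp]: "ell2_apply (c *\<^sub>C f) x = c * ell2_apply f x"
  by (simp add: scaleC_ell2_def)

lemma ell2_apply_sum: "ell2_apply (sum f F) x = (\<Sum>i\<in>F. ell2_apply (f i) x)"
  by (induction F rule: infinite_finite_induct) auto

lemma cinner_mult_ind: "cinner (mult_ind A f) g = cinner f (mult_ind A g)"
  unfolding cinner_ell2_def ell2_cinner_def by (intro infsum_cong) simp

lemma mult_ind_Int: "mult_ind A o\<^sub>L mult_ind B = mult_ind (A \<inter> B)"
  by (intro blinfun_eqI ell2_ext) simp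

lemma is_projection_mult_ind: "is_projection (mult_ind A)"
  unfolding is_projection_def by (simp add: mult_ind_Int adj_eqI cinner_mult_ind)

text \<open>By Pythagoras, the squared error after restricting \<open>f\<close> to a finite
  \<open>G\<close> is the tail of the convergent sum of squares.\<close>

lemma mult_ind_singletons_has_sum:
  assumes "\<And>x. x \<notin> X \<Longrightarrow> ell2_apply f x = 0"
  shows "((\<lambda>A. mult_ind A f) has_sum f) ((\<lambda>x. {x}) ` X)"
proof -
  have "((\<lambda>x. mult_ind {x} f) has_sum f) X"
    unfolding has_sum_def tendsto_iff eventually_finite_subsets_at_top
  proof (intro allI impI)
    fix e :: real assume "e > 0"
    have "((\<lambda>x. (cmod (ell2_apply f x))\<^sup>2) has_sum (norm f)\<^sup>2) UNIV"
      unfolding norm_ell2_square by (rule has_sum_infsum[OF ell2_apply_summable])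
    then have "((\<lambda>x. (cmod (ell2_apply f x))\<^sup>2) has_sum (norm f)\<^sup>2) X"
      by (subst has_sum_cong_neutral[where T = UNIV and g = "\<lambda>x. (cmod (ell2_apply f x))\<^sup>2"]) (auto simp: assms)
    then obtain F where F: "finite F" "F \<subseteq> X"
      "\<And>G. finite G \<Longrightarrow> F \<subseteq> G \<Longrightarrow> G \<subseteq> X \<Longrightarrow>
        dist (\<Sum>x\<in>G. (cmod (ell2_apply f x))\<^sup>2) ((norm f)\<^sup>2) < e\<^sup>2"
      using \<open>e > 0\<close> unfolding has_sum_def tendsto_iff eventually_finite_subsets_at_top
      by (meson zero_less_power)
    have "dist (\<Sum>x\<in>G. mult_ind {x} f) f < e" if G: "finite G" "F \<subseteq> G" "G \<subseteq> X" for G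
    proof -
      have split: "(\<Sum>x\<in>G. mult_ind {x} f) = mult_ind G f"
        using G(1) by (intro ell2_ext) (simp add: ell2_apply_sum)
      have "(norm f)\<^sup>2 = (norm (mult_ind G f))\<^sup>2 + (norm (f - mult_ind G f))\<^sup>2"
        by (rule projection_pythagoras[OF _ is_projection_mult_ind])
          (auto simp: clinear_op_def intro!: ell2_ext)
      moreover have "(norm (mult_ind G f))\<^sup>2 = (\<Sum>x\<in>G. (cmod (ell2_apply f x))\<^sup>2)"
        unfolding norm_ell2_square
        by (subst infsum_cong_neutral[where T = G and g = "\<lambda>x. (cmod (ell2_apply f x))\<^sup>2"]) (auto simp: G(1))
      ultimately have "(norm (f - mult_ind G f))\<^sup>2 < e\<^sup>2" using F(3)[OF G] by (simp add: dist_real_def)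
      then show ?thesis
        using \<open>e > 0\<close> unfolding split by (auto simp: dist_norm norm_minus_commute intro: power2_less_imp_less)
    qed
    then show "\<exists>F. finite F \<and> F \<subseteq> X \<and> (\<forall>G. finite G \<and> F \<subseteq> G \<and> G \<subseteq> X \<longrightarrow>
        dist (\<Sum>x\<in>G. mult_ind {x} f) f < e)"
      using F(1,2) by blast
  qed
  then show ?thesis by (subst has_sum_reindex) (auto simp: o_def)
qed

lift_definition ell2_delta :: "'a \<Rightarrow> 'a ell2" is "\<lambda>x y. if y = x then 1 else 0"
proof -
  fix x :: 'a
  have "(\<lambda>y. (cmod (if y = x then 1 else 0))\<^sup>2) summable_on {x}" by simp
  then show "(\<lambda>y. (cmod (if y = x then 1 else 0))\<^sup>2) summable_on UNIV"
    by (rule summable_on_cong_neutral[THEN iffD1, rotated -1]) auto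
qed

text \<open>Singletons have diameter 0, and the delta function at \<open>x\<close> shows that the
  piece containing \<open>x\<close> acts by a nonzero projection; hence both constants are
  0.\<close>

lemma ell2_discrete_coarse_space:
  assumes "extended_metric_space X d"
  shows "discrete_coarse_space X d (ell2_module X) ((\<lambda>x. {x}) ` X) 0 0"
proof -
  interpret extended_metric_space X d by fact
  interpret vector_space "scaleC :: complex \<Rightarrow> 'a ell2 \<Rightarrow> 'a ell2" by (rule vector_space_scaleC)
  define H where "H = {f :: 'a ell2. \<forall>x. x \<notin> X \<longrightarrow> ell2_apply f x = 0}"
  have sel: "msets (ell2_module X) = Pow X" "hspace (ell2_module X) = H" "ind (ell2_module X) = mult_ind"
    by (simp_all add: ell2_module_def H_def)
  have sub: "csubspace H" by (auto simp: H_def subspace_def)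
  have cl: "clinear_op (mult_ind A)" for A :: "'a set"
    unfolding clinear_op_def by (auto intro!: ell2_ext)
  have fix_H: "f \<in> H \<longleftrightarrow> mult_ind X f = f" for f
    by (auto simp: H_def intro!: ell2_ext dest: arg_cong[of _ _ "\<lambda>f. ell2_apply f _"] split: if_splits)
  have "closed H"
  proof -
    have "H = {f. mult_ind X f = f}" using fix_H by blast
    then show ?thesis by (simp add: closed_Collect_eq continuous_intros)
  qed
  have mem: "mult_ind A f \<in> H" if "A \<subseteq> X" for A f using that by (auto simp: H_def)
  have BO: "mult_ind A \<in> bounded_operators H" if A: "A \<subseteq> X" for A
    unfolding bounded_operators_def
  proof (intro CollectI conjI allI impI cl mem[OF A])
    fix v assume "\<forall>w\<in>H. cinner w v = 0"
    then have "cinner (mult_ind A v) v = 0" using mem[OF A] by blast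
    moreover have "cinner (mult_ind A v) v = cinner (mult_ind A v) (mult_ind A v)"
      unfolding cinner_mult_ind using mult_ind_Int[of A A] by (metis Int_absorb blinfun_apply_blinfun_compose)
    ultimately show "mult_ind A v = 0" by (simp add: cinner_self)
  qed
  have diam: "diam_le d 0 {x}" if "x \<in> X" for x
    using dist_eq_0_iff[OF that that] by (simp add: diam_le_def)
  let ?S = "\<Union>A\<in>{A \<in> Pow X. diam_le d 0 A}. mult_ind A ` H"
  have dense: "closure (cspan ?S) = H"
  proof
    have "?S \<subseteq> H" using mem by blast
    from span_minimal[OF this sub] show "closure (cspan ?S) \<subseteq> H"
      using \<open>closed H\<close> by (rule closure_minimal)
    show "H \<subseteq> closure (cspan ?S)"
    proof
      fix f assume f: "f \<in> H"
      show "f \<in> closure (cspan ?S)"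
        unfolding closure_approachable
      proof (intro allI impI)
        fix e :: real assume "e > 0"
        have "((\<lambda>A. mult_ind A f) has_sum f) ((\<lambda>x. {x}) ` X)"
          using f by (intro mult_ind_singletons_has_sum) (simp add: H_def)
        from has_sum_finite_approximation[OF this, of "e / 2"] \<open>e > 0\<close>
        obtain F where F: "finite F" "F \<subseteq> (\<lambda>x. {x}) ` X" "dist (\<Sum>A\<in>F. mult_ind A f) f \<le> e / 2"
          by auto
        have "(\<Sum>A\<in>F. mult_ind A f) \<in> cspan ?S"
        proof (intro span_sum span_base)
          fix A assume "A \<in> F"
          then obtain x where "x \<in> X" "A = {x}" using F(2) by blast
          then show "mult_ind A f \<in> ?S" using f diam by (intro UN_I[of A] imageI) auto
        qed
        then show "\<exists>g\<in>cspan ?S. dist g f < e" using F(3) \<open>e > 0\<close> by (intro bexI) auto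
      qed
    qed
  qed
  have "X_module X d (ell2_module X)"
    unfolding X_module_def sel
  proof (intro conjI ballI impI)
    show "\<exists>r\<ge>0. closure (cspan (\<Union>A\<in>{A \<in> Pow X. diam_le d r A}. mult_ind A ` H)) = H"
      using dense by (intro exI[of _ 0]) simp
    show "mult_ind (A \<union> A') = mult_ind A + mult_ind A'" if "A \<inter> A' = {}" for A A' :: "'a set"
      using that by (intro blinfun_eqI ell2_ext) (auto simp: blinfun.add_left)
    show "mult_ind X f = f" if "f \<in> H" for f using that fix_H by simp
  qed (use sub \<open>closed H\<close> BO in \<open>auto simp: algebra_Pow mult_ind_Int is_projection_mult_ind\<close>)
  moreover have "mult_ind {x} \<noteq> 0" for x :: 'a
  proof
    assume "mult_ind {x} = 0"
    then have "ell2_apply (mult_ind {x} (ell2_delta x)) x = 0" by simp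
    then show False by (simp add: ell2_delta.rep_eq)
  qed
  moreover have "((\<lambda>A. mult_ind A f) has_sum f) ((\<lambda>x. {x}) ` X)" if "f \<in> H" for f
    using that by (intro mult_ind_singletons_has_sum) (simp add: H_def)
  ultimately show ?thesis
    using diam dist_eq_0_iff
    by unfold_locales (auto simp: sel partition_on_def pairwise_def)
qed

section \<open>Rigidity\<close>

lemma roe_algebra_ample:
  assumes "extended_metric_space X d" "ample_module X d M" "discrete_module X d M"
    "R \<in> {Roe_cp d M, Roe_ql d M}"
  shows "\<exists>P r s. roe_algebra X d M P r s R"
  using ample_discrete_coarse_space[OF assms(1-3)] assms(4)
    discrete_coarse_space.roe_algebra_cp discrete_coarse_space.roe_algebra_ql by blast

lemma roe_algebra_uniform:
  assumes "extended_metric_space X d"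
  shows "roe_algebra X d (ell2_module X) ((\<lambda>x. {x}) ` X) 0 0 (Roe_u X d)"
  unfolding Roe_u_def
  by (rule discrete_coarse_space.roe_algebra_cp[OF ell2_discrete_coarse_space[OF assms]])

lemma roe_algebras_rigid:
  assumes "roe_algebra X dX M PX rX sX R" "roe_algebra Y dY N PY rY sY S" "R \<cong>\<^sub>* S"
  shows "coarsely_equivalent X dX Y dY"
proof -
  obtain \<phi> where "star_isomorphism R S \<phi>" using assms(3) unfolding star_isomorphic_def by blast
  then have "roe_isomorphism X dX M PX rX sX R Y dY N PY rY sY S \<phi>"
    using assms by (intro roe_isomorphism.intro roe_isomorphism_axioms.intro)
  then show ?thesis by (rule roe_isomorphism.roe_isomorphism_imp_coarsely_equivalent)
qed

theorem corollaryE: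
  fixes X :: "'a set" and dX :: "'a \<Rightarrow> 'a \<Rightarrow> ennreal"
    and Y :: "'b set" and dY :: "'b \<Rightarrow> 'b \<Rightarrow> ennreal"
    and M :: "('a, 'h::complex_hilbert) coarse_module"
    and N :: "('b, 'k::complex_hilbert) coarse_module"
  assumes "extended_metric_space X dX" and "extended_metric_space Y dY"
    and "(ample_module X dX M \<and> discrete_module X dX M \<and>
          ample_module Y dY N \<and> discrete_module Y dY N \<and>
          (\<exists>R\<in>{Roe_cp dX M, Roe_ql dX M}. \<exists>S\<in>{Roe_cp dY N, Roe_ql dY N}. R \<cong>\<^sub>* S)) \<or>
         (ample_module X dX M \<and> discrete_module X dX M \<and>
          (\<exists>R\<in>{Roe_cp dX M, Roe_ql dX M}. R \<cong>\<^sub>* Roe_u Y dY)) \<or>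
         (ample_module Y dY N \<and> discrete_module Y dY N \<and>
          (\<exists>S\<in>{Roe_cp dY N, Roe_ql dY N}. Roe_u X dX \<cong>\<^sub>* S)) \<or>
         Roe_u X dX \<cong>\<^sub>* Roe_u Y dY"
  shows "coarsely_equivalent X dX Y dY"
  using assms(3)
proof (elim disjE conjE bexE)
  fix R S
  assume "ample_module X dX M" "discrete_module X dX M" "R \<in> {Roe_cp dX M, Roe_ql dX M}"
    and "ample_module Y dY N" "discrete_module Y dY N" "S \<in> {Roe_cp dY N, Roe_ql dY N}"
    and iso: "R \<cong>\<^sub>* S"
  then obtain P r s Q t u where "roe_algebra X dX M P r s R" "roe_algebra Y dY N Q t u S"
    using roe_algebra_ample assms(1,2) by metis
  then show ?thesis using iso by (rule roe_algebras_rigid)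
next
  fix R
  assume "ample_module X dX M" "discrete_module X dX M" "R \<in> {Roe_cp dX M, Roe_ql dX M}"
    and iso: "R \<cong>\<^sub>* Roe_u Y dY"
  then obtain P r s where "roe_algebra X dX M P r s R"
    using roe_algebra_ample assms(1) by metis
  then show ?thesis using roe_algebra_uniform[OF assms(2)] iso by (rule roe_algebras_rigid)
next
  fix S
  assume "ample_module Y dY N" "discrete_module Y dY N" "S \<in> {Roe_cp dY N, Roe_ql dY N}"
    and iso: "Roe_u X dX \<cong>\<^sub>* S"
  then obtain P r s where "roe_algebra Y dY N P r s S"
    using roe_algebra_ample assms(2) by metis
  with roe_algebra_uniform[OF assms(1)] show ?thesis using iso by (rule roe_algebras_rigid)
next
  assume "Roe_u X dX \<cong>\<^sub>* Roe_u Y dY"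
  with roe_algebra_uniform[OF assms(1)] roe_algebra_uniform[OF assms(2)] show ?thesis
    by (rule roe_algebras_rigid)
qed

end
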